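(* There is a $\mathbb Z[\boldsymbol q]$-algebra isomorphism $S^{\kappa}_{\boldsymbol q}(n,r)\cong S^{D}_{\boldsymbol q}(n,r)$. By base change, it extends to a $\mathbb Z[\upsilon,\upsilon^{-1}]$-algebra isomorphism $\mathcal S^{\kappa}_{\upsilon}(n,r)\cong\mathcal S^{D}_{\upsilon}(n,r)$.
   Context: Let $n\ge1$, $r\ge4$, $\mathcal A=\mathbb Z[\boldsymbol q]$ with $\boldsymbol q$ an indeterminate, $\mathcal Z=\mathbb Z[\upsilon,\upsilon^{-1}]$ regarded as an $\mathcal A$-algebra via $\boldsymbol q=\upsilon^2$. $W$ is the group of permutations $w$ of $[1,2r]=\{1,\dots,2r\}$ with $w(i)+w(2r+1-i)=2r+1$ for all $i$ (Weyl group of type $B_r$), with Coxeter generators $s_i=(i,i+1)(2r-i,2r+1-i)$ ($1\le i<r$) and $s_r=(r,r+1)$. $H=H_{\boldsymbol q,1}$ is the $\mathcal A$-algebra generated by $T_1,\dots,T_r$ with relations $T_iT_j=T_jT_i$ ($|i-j|\ge2$), $T_jT_{j+1}T_j=T_{j+1}T_jT_{j+1}$ ($1\le j<r-1$), $T_{r-1}T_rT_{r-1}T_r=T_rT_{r-1}T_rT_{r-1}$, $T_i^2=(\boldsymbol q-1)T_i+\boldsymbol q$ ($i<r$), $T_r^2=1$; it has basis $\{T_w\}_{w\in W}$ defined via reduced expressions. $\Lambda(n+1,r)=\{\lambda\in\mathbb N^{n+1}:\sum\lambda_i=r\}$. $W_\lambda$ is generated by the $s_j$, $1\le j\le r$,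 with $j\notin\{\lambda_1+\dots+\lambda_i: 1\le i\le n\}$; $x_\lambda=\sum_{w\in W_\lambda}T_w$. $\check W\le W$ is the subgroup of $w$ such that $\#\{i\in[1,r]:w(i)>r\}$ is even (Weyl group of type $D_r$), with Coxeter generators $s_1,\dots,s_{r-1},s_rs_{r-1}s_r$; $\check H\subset H$ is the subalgebra generated by $T_1,\dots,T_{r-1},T_rT_{r-1}T_r$ (the Hecke algebra of type $D_r$), with basis $\{T_w\}_{w\in\check W}$. Define $S^{\kappa}_{\boldsymbol q}(n,r)=\mathrm{End}_{\check H}\big(\bigoplus_{\lambda\in\Lambda(n+1,r)}x_\lambda H|_{\check H}\big)$. $\Lambda^{D}(n,r)$ consists of symbols $\lambda^\bullet$ for $\lambda\in\Lambda(n+1,r)$ with $\lambda_{n+1}\ne0$, and $\lambda^+,\lambda^-$ for $\lambda\in\Lambda(n+1,r)$ with $\lambda_{n+1}=0$; the parabolic subgroups of $\check W$ attached to them are $\check W_{\lambda^\bullet}=W_\lambda\cap\check W$, $\check W_{\lambda^+}=W_\lambda$, $\check W_{\lambda^-}=s_rW_\lambda s_r$. For $\alpha\in\Lambda^{D}(n,r)$ let $\check x_\alpha=\sum_{w\in\check W_\alpha}T_w$. Define $S^{D}_{\boldsymbol q}(n,r)=\mathrm{End}_{\check H}\big(\bigoplus_{\alpha\in\Lambda^{D}(n,r)}\check x_\alpha\check H\big)$. Over $\mathcal Z$: $\check{\mathcal H}_\upsilon=\check H\otimes_{\mathcal A}\mathcal Z$, $\mathcal S^{\kappa}_\upsilon(n,r)=S^{\kappa}_{\boldsymbol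 q}(n,r)\otimes_{\mathcal A}\mathcal Z$, and $\mathcal S^{D}_\upsilon(n,r)=\mathrm{End}_{\check{\mathcal H}_\upsilon}\big(\bigoplus_{\alpha\in\Lambda^{D}(n,r)}\check x_\alpha\check{\mathcal H}_\upsilon\big)$. *)

theory Defs
  imports
    "HOL-Library.Poly_Mapping"
    "HOL-Computational_Algebra.Polynomial"
    "HOL-Algebra.Algebra"
begin

section \<open>Algebras over a commutative ring\<close>

text \<open>
  An associative unital algebra over the commutative ring of all elements of a type \<open>'a\<close> is
  represented by the record type \<open>('a, 'b) module\<close>, which extends the ring record by a scalar
  multiplication; multiplication need not be commutative.
\<close>

definition algebra_iso ::
  "('a, 'b) module \<Rightarrow> ('a, 'c) module \<Rightarrow> ('b \<Rightarrow> 'c) set" where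
  "algebra_iso A B =
     {f \<in> ring_iso A B. \<forall>a. \<forall>x \<in> carrier A. f (a \<odot>\<^bsub>A\<^esub> x) = a \<odot>\<^bsub>B\<^esub> f x}"

definition monoid_algebra ::
  "('g, 'm) monoid_scheme \<Rightarrow> ('a::comm_ring_1, 'g \<Rightarrow>\<^sub>0 'a) module" where
  "monoid_algebra G =
     \<lparr>carrier = {f. Poly_Mapping.keys f \<subseteq> carrier G},
      monoid.mult = (\<lambda>f g. \<Sum>x\<in>Poly_Mapping.keys f. \<Sum>y\<in>Poly_Mapping.keys g.
                Poly_Mapping.single (x \<otimes>\<^bsub>G\<^esub> y)
                  (Poly_Mapping.lookup f x * Poly_Mapping.lookup g y)),
      one = Poly_Mapping.single \<one>\<^bsub>G\<^esub> 1,
      ring.zero = 0,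
      ring.add = (+),
      smult = (\<lambda>a. Poly_Mapping.map ((*) a))\<rparr>"

definition free_algebra :: "'x set \<Rightarrow> ('a::comm_ring_1, 'x list \<Rightarrow>\<^sub>0 'a) module" where
  "free_algebra Y = monoid_algebra \<lparr>carrier = lists Y, monoid.mult = (@), one = []\<rparr>"

text \<open>
  In the quotient of an algebra by a two-sided ideal, a scalar \<open>a\<close> acts as multiplication by the
  class of \<open>a \<cdot> 1\<close>.
\<close>

definition quotient_algebra :: "('a, 'b) module \<Rightarrow> 'b set \<Rightarrow> ('a, 'b set) module" where
  "quotient_algebra A I =
     ring.extend (A Quot I)
       \<lparr>smult = (\<lambda>a Y. (I +>\<^bsub>A\<^esub> (a \<odot>\<^bsub>A\<^esub> \<one>\<^bsub>A\<^esub>)) \<otimes>\<^bsub>A Quot I\<^esub> Y)\<rparr>"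

definition subalgebra_gen :: "('a, 'b) module \<Rightarrow> 'b set \<Rightarrow> ('a, 'b) module" where
  "subalgebra_gen A Y =
     A\<lparr>carrier := generate_ring A (Y \<union> range (\<lambda>a. a \<odot>\<^bsub>A\<^esub> \<one>\<^bsub>A\<^esub>))\<rparr>"

section \<open>Tensor products of algebras and base change\<close>

text \<open>
  The tensor product of two algebras \<open>B\<close> and \<open>C\<close> is the free abelian group on pairs \<open>(b, c)\<close>
  modulo the subgroup generated by the usual relations.  This group is the integral monoid ring
  of the product of the multiplicative monoids of \<open>B\<close> and \<open>C\<close>, whose product is
  \<open>(b, c) (b', c') = (b b', c c')\<close>; the subgroup is a two-sided ideal because multiplying a
  relation by a pair gives a relation again.
\<close>

definition tensor_free ::
  "('a, 'b) module \<Rightarrow> ('a, 'c) module \<Rightarrow> (int, 'b \<times> 'c \<Rightarrow>\<^sub>0 int) module" where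
  "tensor_free B C = monoid_algebra (B \<times>\<times> C)"

definition tensor_rels ::
  "('a, 'b) module \<Rightarrow> ('a, 'c) module \<Rightarrow> ('b \<times> 'c \<Rightarrow>\<^sub>0 int) set" where
  "tensor_rels B C = (let p = (\<lambda>b c. Poly_Mapping.single (b, c) (1::int)) in
     {p (b \<oplus>\<^bsub>B\<^esub> b') c - p b c - p b' c | b b' c.
        b \<in> carrier B \<and> b' \<in> carrier B \<and> c \<in> carrier C} \<union>
     {p b (c \<oplus>\<^bsub>C\<^esub> c') - p b c - p b c' | b c c'.
        b \<in> carrier B \<and> c \<in> carrier C \<and> c' \<in> carrier C} \<union>
     {p (a \<odot>\<^bsub>B\<^esub> b) c - p b (a \<odot>\<^bsub>C\<^esub> c) | a b c.
        b \<in> carrier B \<and> c \<in> carrier C})"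

definition tensor_ideal ::
  "('a, 'b) module \<Rightarrow> ('a, 'c) module \<Rightarrow> ('b \<times> 'c \<Rightarrow>\<^sub>0 int) set" where
  "tensor_ideal B C = generate (add_monoid (tensor_free B C)) (tensor_rels B C)"

definition pure_tensor ::
  "('a, 'b) module \<Rightarrow> ('a, 'c) module \<Rightarrow> 'b \<Rightarrow> 'c \<Rightarrow> ('b \<times> 'c \<Rightarrow>\<^sub>0 int) set" where
  "pure_tensor B C b c =
     tensor_ideal B C +>\<^bsub>tensor_free B C\<^esub> Poly_Mapping.single (b, c) 1"

text \<open>
  \<open>base_change B C\<close> is the tensor product of \<open>B\<close> and a commutative algebra \<open>C\<close>, regarded as an
  algebra over \<open>C\<close>: the scalar \<open>c\<close> acts as multiplication by \<open>1 \<otimes> c\<close>.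
\<close>

definition base_change ::
  "('a, 'b) module \<Rightarrow> ('a, 'c) module \<Rightarrow> ('c, ('b \<times> 'c \<Rightarrow>\<^sub>0 int) set) module" where
  "base_change B C = (let Q = tensor_free B C Quot tensor_ideal B C in
     ring.extend Q \<lparr>smult = (\<lambda>c Y. pure_tensor B C \<one>\<^bsub>B\<^esub> c \<otimes>\<^bsub>Q\<^esub> Y)\<rparr>)"

section \<open>Endomorphism algebras of direct sums of right ideals\<close>

text \<open>
  Let \<open>M i\<close> (\<open>i \<in> I\<close>) be a finite family of subgroups of an algebra \<open>B\<close> stable under right
  multiplication by a subalgebra with carrier \<open>K\<close>.  The external direct sum of the \<open>M i\<close> is
  \<open>Pi\<^sub>E I M\<close>.  Its endomorphisms over \<open>K\<close> are automatically linear over the ground ring, since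
  \<open>K\<close> contains the scalars.
\<close>

definition direct_sum_End ::
  "('a, 'b) module \<Rightarrow> 'b set \<Rightarrow> 'i set \<Rightarrow> ('i \<Rightarrow> 'b set) \<Rightarrow>
     ('a, ('i \<Rightarrow> 'b) \<Rightarrow> ('i \<Rightarrow> 'b)) module" where
  "direct_sum_End B K I M = (let D = Pi\<^sub>E I M in
     \<lparr>carrier = {f \<in> D \<rightarrow>\<^sub>E D.
        (\<forall>x\<in>D. \<forall>y\<in>D. f (\<lambda>i\<in>I. x i \<oplus>\<^bsub>B\<^esub> y i) = (\<lambda>i\<in>I. f x i \<oplus>\<^bsub>B\<^esub> f y i)) \<and>
        (\<forall>x\<in>D. \<forall>h\<in>K. f (\<lambda>i\<in>I. x i \<otimes>\<^bsub>B\<^esub> h) = (\<lambda>i\<in>I. f x i \<otimes>\<^bsub>B\<^esub> h))},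
      monoid.mult = (\<lambda>f g. compose D f g),
      one = (\<lambda>x\<in>D. x),
      ring.zero = (\<lambda>x\<in>D. \<lambda>i\<in>I. \<zero>\<^bsub>B\<^esub>),
      ring.add = (\<lambda>f g. \<lambda>x\<in>D. \<lambda>i\<in>I. f x i \<oplus>\<^bsub>B\<^esub> g x i),
      smult = (\<lambda>a f. \<lambda>x\<in>D. \<lambda>i\<in>I. a \<odot>\<^bsub>B\<^esub> f x i)\<rparr>)"

section \<open>The Weyl groups of types B and D\<close>

definition WB :: "nat \<Rightarrow> (nat \<Rightarrow> nat) set" where
  "WB r = {w. w permutes {1..2*r} \<and> (\<forall>i\<in>{1..2*r}. w i + w (2*r + 1 - i) = 2*r + 1)}"

definition cox :: "nat \<Rightarrow> nat \<Rightarrow> nat \<Rightarrow> nat" where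
  "cox r i =
     (if i < r then transpose i (i + 1) \<circ> transpose (2*r - i) (2*r + 1 - i)
      else transpose r (r + 1))"

definition cox_prod :: "nat \<Rightarrow> nat list \<Rightarrow> nat \<Rightarrow> nat" where
  "cox_prod r is = foldr (\<lambda>i w. cox r i \<circ> w) is id"

definition reduced_expr :: "nat \<Rightarrow> (nat \<Rightarrow> nat) \<Rightarrow> nat list \<Rightarrow> bool" where
  "reduced_expr r w is \<longleftrightarrow>
     is \<in> lists {1..r} \<and> cox_prod r is = w \<and>
     (\<forall>js\<in>lists {1..r}. cox_prod r js = w \<longrightarrow> length is \<le> length js)"

definition WD :: "nat \<Rightarrow> (nat \<Rightarrow> nat) set" where
  "WD r = {w \<in> WB r. even (card {i\<in>{1..r}. w i > r})}"

text \<open>Tuples in \<open>\<nat>\<^sup>m\<close> with sum \<open>r\<close>; the entry \<open>\<lambda>\<^sub>i\<close> is \<open>l ! (i - 1)\<close>.\<close>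

definition Lam :: "nat \<Rightarrow> nat \<Rightarrow> nat list set" where
  "Lam m r = {l. length l = m \<and> sum_list l = r}"

definition parabolic_B :: "nat \<Rightarrow> nat \<Rightarrow> nat list \<Rightarrow> (nat \<Rightarrow> nat) set" where
  "parabolic_B n r l =
     generate (sym_group (2*r))
       (cox r ` {j \<in> {1..r}. j \<notin> {sum_list (take i l) | i. 1 \<le> i \<and> i \<le> n}})"

datatype D_index = Dot "nat list" | Plus "nat list" | Minus "nat list"

definition LamD :: "nat \<Rightarrow> nat \<Rightarrow> D_index set" where
  "LamD n r =
     {Dot l | l. l \<in> Lam (n + 1) r \<and> l ! n \<noteq> 0} \<union>
     {Plus l | l. l \<in> Lam (n + 1) r \<and> l ! n = 0} \<union>
     {Minus l | l. l \<in> Lam (n + 1) r \<and> l ! n = 0}"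

fun parabolic_D :: "nat \<Rightarrow> nat \<Rightarrow> D_index \<Rightarrow> (nat \<Rightarrow> nat) set" where
  "parabolic_D n r (Dot l) = parabolic_B n r l \<inter> WD r"
| "parabolic_D n r (Plus l) = parabolic_B n r l"
| "parabolic_D n r (Minus l) = (\<lambda>w. cox r r \<circ> w \<circ> cox r r) ` parabolic_B n r l"

section \<open>The Hecke algebras\<close>

abbreviation qq :: "int poly" where "qq \<equiv> [:0, 1:]"

definition hecke_rels :: "nat \<Rightarrow> (nat list \<Rightarrow>\<^sub>0 int poly) set" where
  "hecke_rels r = (let m = (\<lambda>is. Poly_Mapping.single is (1::int poly)) in
     {m [i, j] - m [j, i] | i j.
        i \<in> {1..r} \<and> j \<in> {1..r} \<and> \<bar>int i - int j\<bar> \<ge> 2} \<union>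
     {m [j, j+1, j] - m [j+1, j, j+1] | j. 1 \<le> j \<and> j < r - 1} \<union>
     {m [r-1, r, r-1, r] - m [r, r-1, r, r-1]} \<union>
     {m [i, i] - Poly_Mapping.single [i] (qq - 1) - Poly_Mapping.single [] qq | i.
        1 \<le> i \<and> i < r} \<union>
     {m [r, r] - m []})"

definition hecke_ideal :: "nat \<Rightarrow> (nat list \<Rightarrow>\<^sub>0 int poly) set" where
  "hecke_ideal r = genideal (free_algebra {1..r}) (hecke_rels r)"

definition HB :: "nat \<Rightarrow> (int poly, (nat list \<Rightarrow>\<^sub>0 int poly) set) module" where
  "HB r = quotient_algebra (free_algebra {1..r}) (hecke_ideal r)"

definition Tgen :: "nat \<Rightarrow> nat \<Rightarrow> (nat list \<Rightarrow>\<^sub>0 int poly) set" where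
  "Tgen r i = hecke_ideal r +>\<^bsub>free_algebra {1..r}\<^esub> Poly_Mapping.single [i] 1"

text \<open>
  By Matsumoto's theorem \<open>T\<^sub>w\<close> does not depend on the reduced expression chosen for \<open>w\<close>.
\<close>

definition Tw :: "nat \<Rightarrow> (nat \<Rightarrow> nat) \<Rightarrow> (nat list \<Rightarrow>\<^sub>0 int poly) set" where
  "Tw r w = foldr (\<lambda>i h. Tgen r i \<otimes>\<^bsub>HB r\<^esub> h) (SOME is. reduced_expr r w is) \<one>\<^bsub>HB r\<^esub>"

definition HD :: "nat \<Rightarrow> (int poly, (nat list \<Rightarrow>\<^sub>0 int poly) set) module" where
  "HD r = subalgebra_gen (HB r)
     (Tgen r ` {1..<r} \<union> {Tgen r r \<otimes>\<^bsub>HB r\<^esub> Tgen r (r - 1) \<otimes>\<^bsub>HB r\<^esub> Tgen r r})"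

definition xB :: "nat \<Rightarrow> nat \<Rightarrow> nat list \<Rightarrow> (nat list \<Rightarrow>\<^sub>0 int poly) set" where
  "xB n r l = finsum (HB r) (Tw r) (parabolic_B n r l)"

definition xD :: "nat \<Rightarrow> nat \<Rightarrow> D_index \<Rightarrow> (nat list \<Rightarrow>\<^sub>0 int poly) set" where
  "xD n r \<alpha> = finsum (HB r) (Tw r) (parabolic_D n r \<alpha>)"

section \<open>The Schur algebras\<close>

definition S_kappa ::
  "nat \<Rightarrow> nat \<Rightarrow> (int poly, (nat list \<Rightarrow> (nat list \<Rightarrow>\<^sub>0 int poly) set) \<Rightarrow>
     (nat list \<Rightarrow> (nat list \<Rightarrow>\<^sub>0 int poly) set)) module" where
  "S_kappa n r =
     direct_sum_End (HB r) (carrier (HD r)) (Lam (n + 1) r)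
       (\<lambda>l. xB n r l <#\<^bsub>HB r\<^esub> carrier (HB r))"

definition D_module :: "nat \<Rightarrow> nat \<Rightarrow> D_index \<Rightarrow> (nat list \<Rightarrow>\<^sub>0 int poly) set set" where
  "D_module n r \<alpha> = xD n r \<alpha> <#\<^bsub>HD r\<^esub> carrier (HD r)"

definition S_D ::
  "nat \<Rightarrow> nat \<Rightarrow> (int poly, (D_index \<Rightarrow> (nat list \<Rightarrow>\<^sub>0 int poly) set) \<Rightarrow>
     (D_index \<Rightarrow> (nat list \<Rightarrow>\<^sub>0 int poly) set)) module" where
  "S_D n r = direct_sum_End (HD r) (carrier (HD r)) (LamD n r) (D_module n r)"

text \<open>
  Laurent polynomials over the integers are the group ring of the additive group of integers;
  the indeterminate \<open>\<upsilon>\<close> is \<open>single 1 1\<close>.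
\<close>

type_synonym laurent = "int \<Rightarrow>\<^sub>0 int"

definition upsilon :: laurent where
  "upsilon = Poly_Mapping.single 1 1"

definition laurent_algebra :: "(int poly, laurent) module" where
  "laurent_algebra =
     \<lparr>carrier = UNIV, monoid.mult = (*), one = 1, ring.zero = 0, ring.add = (+),
      smult = (\<lambda>p z. poly (map_poly of_int p) (upsilon ^ 2) * z)\<rparr>"

type_synonym hecke_upsilon = "((nat list \<Rightarrow>\<^sub>0 int poly) set \<times> laurent \<Rightarrow>\<^sub>0 int) set"

definition HD_upsilon :: "nat \<Rightarrow> (laurent, hecke_upsilon) module" where
  "HD_upsilon r = base_change (HD r) laurent_algebra"

abbreviation HD_to_upsilon :: "nat \<Rightarrow> (nat list \<Rightarrow>\<^sub>0 int poly) set \<Rightarrow> hecke_upsilon" where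
  "HD_to_upsilon r h \<equiv> pure_tensor (HD r) laurent_algebra h 1"

definition S_kappa_upsilon ::
  "nat \<Rightarrow> nat \<Rightarrow> (laurent, (((nat list \<Rightarrow> (nat list \<Rightarrow>\<^sub>0 int poly) set) \<Rightarrow>
     (nat list \<Rightarrow> (nat list \<Rightarrow>\<^sub>0 int poly) set)) \<times> laurent \<Rightarrow>\<^sub>0 int) set) module" where
  "S_kappa_upsilon n r = base_change (S_kappa n r) laurent_algebra"

definition S_D_upsilon ::
  "nat \<Rightarrow> nat \<Rightarrow> (laurent, (D_index \<Rightarrow> hecke_upsilon) \<Rightarrow> (D_index \<Rightarrow> hecke_upsilon)) module" where
  "S_D_upsilon n r =
     direct_sum_End (HD_upsilon r) (carrier (HD_upsilon r)) (LamD n r)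
       (\<lambda>\<alpha>. HD_to_upsilon r (xD n r \<alpha>) <#\<^bsub>HD_upsilon r\<^esub> carrier (HD_upsilon r))"

end

theory Submission
  imports Defs
begin

text \<open>
  Words in the generators of \<open>H\<close> have a well-defined parity of the number of letters \<open>T\<^sub>r\<close>, so \<open>H\<close> is the
  direct sum of its subalgebra \<open>H\<^sub>D\<close> of type D and \<open>T\<^sub>r H\<^sub>D\<close>; directness is seen in the right regular action of \<open>H\<close> on functions on the
  Weyl group.  If \<open>\<lambda>\<^sub>n\<^sub>+\<^sub>1 \<noteq> 0\<close>, then \<open>s\<^sub>r\<close> lies in \<open>W\<^sub>\<lambda>\<close>, hence \<open>x\<^sub>\<lambda> = (1 + T\<^sub>r) x\<close> and \<open>x\<^sub>\<lambda> T\<^sub>r = x\<^sub>\<lambda>\<close>, where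
  \<open>x\<close> is the element of the dotted symbol, and \<open>y \<mapsto> (1 + T\<^sub>r) y\<close> is an isomorphism from \<open>x H\<^sub>D\<close> to
  \<open>x\<^sub>\<lambda> H\<close>.  If \<open>\<lambda>\<^sub>n\<^sub>+\<^sub>1 = 0\<close>, then \<open>x\<^sub>\<lambda>\<close> belongs to \<open>H\<^sub>D\<close>, and \<open>x\<^sub>\<lambda> H\<close> is the direct sum of \<open>x\<^sub>\<lambda> H\<^sub>D\<close> and
  \<open>x\<^sub>\<lambda> T\<^sub>r H\<^sub>D = T\<^sub>r (T\<^sub>r x\<^sub>\<lambda> T\<^sub>r) H\<^sub>D\<close>, which correspond to the signs plus and minus.  So the two direct sums
  are isomorphic over \<open>H\<^sub>D\<close>, and conjugation identifies their endomorphism algebras.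

  Over the Laurent polynomials, an endomorphism of the second direct sum is determined by the images of finitely
  many generators; these have a common denominator \<open>\<upsilon>\<^sup>2\<^sup>N\<close>, so that the endomorphism is
  \<open>\<upsilon>\<^sup>-\<^sup>2\<^sup>N (f + \<upsilon> f')\<close> for endomorphisms \<open>f\<close>, \<open>f'\<close> defined over \<open>\<int>[q]\<close>.  Hence the endomorphism algebra
  commutes with this base change.
\<close>

section \<open>Algebras given by records: quotients and subalgebras\<close>

section \<open>Algebras over a commutative ring\<close>

text \<open>Three obstacles shape the proof. \<open>Tw\<close> picks a reduced expression by choice,
  so nothing can be computed with it until Matsumoto's theorem shows that the choice is immaterial.
  \<open>HB\<close> is a quotient of a free algebra: its relations show that elements are equal, but
  telling elements apart takes a model on which all relations are checked, the action on coordinate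
  functions. This model serves twice, because the coordinates are also linear functionals over
  \<int>[q] that separate the elements of \<open>H\<close>. Finally, \<open>S_kappa_upsilon\<close>
  is a tensor product while \<open>S_D_upsilon\<close> is an endomorphism algebra formed after the
  base change, so the second isomorphism is not simply the first one tensored with the Laurent
  polynomials. Both sides are instead shown to be extensions of algebras over \<int>[q] with unique
  normal forms, a property that determines the extension up to isomorphism. Uniqueness is where the
  functionals enter: they pass from \<open>H\<close> to its subalgebra of type D by restriction and
  to endomorphism algebras by evaluation.\<close>

locale lin_module = abelian_group A for A :: "('a::comm_ring_1, 'b) module" (structure) +
  assumes smult_closed [simp, intro]: "x \<in> carrier A \<Longrightarrow> a \<odot> x \<in> carrier A"
    and smult_l_distr: "x \<in> carrier A \<Longrightarrow> (a + b) \<odot> x = a \<odot> x \<oplus> b \<odot> x"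
    and smult_r_distr: "x \<in> carrier A \<Longrightarrow> y \<in> carrier A \<Longrightarrow> a \<odot> (x \<oplus> y) = a \<odot> x \<oplus> a \<odot> y"
    and smult_assoc1: "x \<in> carrier A \<Longrightarrow> (a * b) \<odot> x = a \<odot> (b \<odot> x)"
    and smult_one [simp]: "x \<in> carrier A \<Longrightarrow> 1 \<odot> x = x"
begin

lemma smult_r_null [simp]: "a \<odot> \<zero> = \<zero>"
proof -
  have "a \<odot> \<zero> = a \<odot> \<zero> \<oplus> a \<odot> \<zero>"
    by (metis smult_r_distr l_zero zero_closed)
  then show ?thesis
    by (metis add.l_cancel_one' smult_closed zero_closed)
qed

lemma smult_l_null [simp]: "x \<in> carrier A \<Longrightarrow> 0 \<odot> x = \<zero>"
  by (metis add_0 add.l_cancel_one' smult_closed smult_l_distr)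

lemma smult_r_minus: "x \<in> carrier A \<Longrightarrow> a \<odot> (\<ominus> x) = \<ominus> (a \<odot> x)"
  by (metis add.inv_closed add.inv_equality l_neg smult_closed smult_r_distr smult_r_null)

lemma smult_l_minus: "x \<in> carrier A \<Longrightarrow> (- a) \<odot> x = \<ominus> (a \<odot> x)"
  by (metis add.inv_equality add.left_inverse smult_closed smult_l_distr smult_l_null)

lemma smult_commute: "x \<in> carrier A \<Longrightarrow> a \<odot> (b \<odot> x) = b \<odot> (a \<odot> x)"
  by (metis mult.commute smult_assoc1)

end

text \<open>The scalar laws are kept apart in \<open>lin_module\<close> because direct sums of right
  ideals, which carry no product, need them too.\<close>

locale assoc_algebra = ring A + lin_module A for A :: "('a::comm_ring_1, 'b) module" (structure) +
  assumes smult_mult_left: "x \<in> carrier A \<Longrightarrow> y \<in> carrier A \<Longrightarrow> (a \<odot> x) \<otimes> y = a \<odot> (x \<otimes> y)"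
    and smult_mult_right: "x \<in> carrier A \<Longrightarrow> y \<in> carrier A \<Longrightarrow> x \<otimes> (a \<odot> y) = a \<odot> (x \<otimes> y)"

lemma assoc_algebraI:
  fixes A :: "('a::comm_ring_1, 'b) module" (structure)
  assumes "ring A"
    and "\<And>x a. x \<in> carrier A \<Longrightarrow> a \<odot> x \<in> carrier A"
    and "\<And>x a b. x \<in> carrier A \<Longrightarrow> (a + b) \<odot> x = a \<odot> x \<oplus> b \<odot> x"
    and "\<And>x y a. x \<in> carrier A \<Longrightarrow> y \<in> carrier A \<Longrightarrow> a \<odot> (x \<oplus> y) = a \<odot> x \<oplus> a \<odot> y"
    and "\<And>x a b. x \<in> carrier A \<Longrightarrow> (a * b) \<odot> x = a \<odot> (b \<odot> x)"
    and "\<And>x. x \<in> carrier A \<Longrightarrow> 1 \<odot> x = x"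
    and "\<And>x y a. x \<in> carrier A \<Longrightarrow> y \<in> carrier A \<Longrightarrow> (a \<odot> x) \<otimes> y = a \<odot> (x \<otimes> y)"
    and "\<And>x y a. x \<in> carrier A \<Longrightarrow> y \<in> carrier A \<Longrightarrow> x \<otimes> (a \<odot> y) = a \<odot> (x \<otimes> y)"
  shows "assoc_algebra A"
  using assms ring.is_abelian_group
  by (intro assoc_algebra.intro lin_module.intro lin_module_axioms.intro assoc_algebra_axioms.intro)

context assoc_algebra
begin

lemma smult_eq_mult: "x \<in> carrier A \<Longrightarrow> a \<odot> x = (a \<odot> \<one>) \<otimes> x"
  by (simp add: smult_mult_left)

end

lemma poly_mapping_sum_singles: "(\<Sum>x\<in>Poly_Mapping.keys f. Poly_Mapping.single x (Poly_Mapping.lookup f x)) = f"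
  by (rule poly_mapping_eqI)
    (auto simp: lookup_sum lookup_single when_def in_keys_iff sum.delta)

text \<open>\<open>quotient_algebra\<close> and \<open>base_change\<close> extend a ring record by a
  scalar multiplication, which changes its type; the ring axioms are carried over field by
  field.\<close>

lemma ring_cong:
  assumes "ring R" "carrier S = carrier R" "monoid.mult S = monoid.mult R" "one S = one R"
    "ring.zero S = ring.zero R" "ring.add S = ring.add R"
  shows "ring S"
proof -
  interpret R: ring R by fact
  show ?thesis
    using R.a_assoc R.a_comm R.m_assoc R.l_distr R.r_distr R.add.l_inv_ex
    by (intro ringI abelian_groupI monoidI) (auto simp: assms(2-))
qed

lemma quotient_algebra_simps [simp]:
  "carrier (quotient_algebra A I) = carrier (A Quot I)"
  "monoid.mult (quotient_algebra A I) = monoid.mult (A Quot I)"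
  "one (quotient_algebra A I) = one (A Quot I)"
  "ring.zero (quotient_algebra A I) = ring.zero (A Quot I)"
  "ring.add (quotient_algebra A I) = ring.add (A Quot I)"
  by (simp_all add: quotient_algebra_def ring.extend_def)

lemma (in assoc_algebra) quotient_algebra_hom:
  assumes "ideal I A"
  shows "(+>) I \<in> ring_hom A (quotient_algebra A I)"
    and "(+>) I ` carrier A = carrier (quotient_algebra A I)"
    and "x \<in> carrier A \<Longrightarrow> I +> (a \<odot> x) = a \<odot>\<^bsub>quotient_algebra A I\<^esub> (I +> x)"
    and "x \<in> carrier A \<Longrightarrow> I +> x = \<zero>\<^bsub>quotient_algebra A I\<^esub> \<longleftrightarrow> x \<in> I"
proof -
  interpret I: ideal I A by fact
  have hom: "(+>) I \<in> ring_hom A (A Quot I)" by (rule I.rcos_ring_hom)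
  then show "(+>) I \<in> ring_hom A (quotient_algebra A I)" by (simp add: ring_hom_def)
  show "(+>) I ` carrier A = carrier (quotient_algebra A I)"
    by (auto simp: FactRing_def A_RCOSETS_def RCOSETS_def a_r_coset_def)
  show "x \<in> carrier A \<Longrightarrow> I +> (a \<odot> x) = a \<odot>\<^bsub>quotient_algebra A I\<^esub> (I +> x)"
    using ring_hom_mult[OF hom, of "a \<odot> \<one>" x]
    by (simp add: quotient_algebra_def ring.extend_def smult_mult_left)
  show "x \<in> carrier A \<Longrightarrow> I +> x = \<zero>\<^bsub>quotient_algebra A I\<^esub> \<longleftrightarrow> x \<in> I"
    by (simp add: FactRing_def) (metis I.a_rcos_const I.a_rcos_self)
qed

lemma (in assoc_algebra) quotient_assoc_algebra:
  assumes "ideal I A"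
  shows "assoc_algebra (quotient_algebra A I)"
proof -
  interpret I: ideal I A by fact
  interpret Q: ring "A Quot I" by (rule I.quotient_is_ring)
  define Q where "Q = quotient_algebra A I"
  have flds: "carrier Q = carrier (A Quot I)" "monoid.mult Q = monoid.mult (A Quot I)"
     "one Q = one (A Quot I)" "ring.zero Q = ring.zero (A Quot I)" "ring.add Q = ring.add (A Quot I)"
     "\<And>a Y. smult Q a Y = (I +>\<^bsub>A\<^esub> (a \<odot>\<^bsub>A\<^esub> \<one>\<^bsub>A\<^esub>)) \<otimes>\<^bsub>A Quot I\<^esub> Y"
    by (simp_all add: Q_def quotient_algebra_def ring.extend_def)
  have "smult Q 1 Y = Y" if "Y \<in> carrier (A Quot I)" for Y
    using that Q.l_one[of Y] by (simp add: flds FactRing_def)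
  note one_Q = this
  have hom: "(+>) I \<in> ring_hom A (A Quot I)" by (rule I.rcos_ring_hom)
  note hc = ring_hom_closed[OF hom] and hm = ring_hom_mult[OF hom, symmetric]
   and ha = ring_hom_add[OF hom, symmetric] and h1 = ring_hom_one[OF hom, symmetric]
  have surj: "\<exists>x\<in>carrier A. Y = I +> x" if "Y \<in> carrier (A Quot I)" for Y
    using that by (auto simp: FactRing_def A_RCOSETS_def RCOSETS_def a_r_coset_def)
  have "ring Q"
    by (rule ring_cong[OF Q.ring_axioms]) (simp_all add: flds)
  then show "assoc_algebra (quotient_algebra A I)"
    unfolding Q_def[symmetric]
  proof (rule assoc_algebraI, goal_cases)
    case (1 x a) then show ?case by (simp add: flds hc)
  next
    case (2 x a b) then show ?case by (simp add: flds hc smult_l_distr ha[symmetric] Q.l_distr)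
  next
    case (3 x y a) then show ?case by (simp add: flds hc Q.r_distr)
  next
    case (4 x a b) then show ?case
      by (simp add: flds hc Q.m_assoc[symmetric] hm smult_mult_left smult_assoc1)
  next
    case (5 x) then show ?case using one_Q by (simp add: flds(1))
  next
    case (6 x y a) then show ?case by (simp add: flds hc Q.m_assoc)
  next
    \<comment> \<open>The scalar has to move past \<open>x\<close>, which no ring law of the
      quotient gives; on representatives it is a law of the algebra.\<close>
    case (7 x y a)
    then obtain u v where "u \<in> carrier A" "v \<in> carrier A" "x = I +> u" "y = I +> v"
      using surj unfolding flds by metis
    then show ?case by (simp add: flds hm smult_mult_left smult_mult_right)
  qed
qed

text \<open>A subring that contains the scalars is closed under them, since
  \<open>a \<odot> x\<close> is the product of \<open>a \<odot> \<one>\<close> and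
  \<open>x\<close>.\<close>

lemma (in assoc_algebra) subring_assoc_algebra:
  assumes "subring K A" and "\<And>a. a \<odot> \<one> \<in> K"
  shows "assoc_algebra (A\<lparr>carrier := K\<rparr>)"
proof -
  interpret K: ring "A\<lparr>carrier := K\<rparr>"
    using assms(1) subring_iff subringE(1) by blast
  have sub: "x \<in> K \<Longrightarrow> x \<in> carrier A" for x
    using subringE(1)[OF assms(1)] by auto
  show ?thesis
  proof (rule assoc_algebraI[OF K.ring_axioms], goal_cases)
    case (1 x a)
    then show ?case
      using smult_eq_mult[OF sub, of x a] subringE(6)[OF assms(1)] assms(2) by simp
  qed (use sub in \<open>simp_all add: smult_l_distr smult_r_distr smult_assoc1 smult_mult_left smult_mult_right\<close>)
qed

context assoc_algebra
begin

lemma carrier_subalgebra_gen: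
  "carrier (subalgebra_gen A Y) = generate_ring A (Y \<union> range (\<lambda>a. a \<odot> \<one>))"
  by (simp add: subalgebra_gen_def)

lemma subring_subalgebra_gen:
  assumes "Y \<subseteq> carrier A"
  shows "subring (carrier (subalgebra_gen A Y)) A"
  unfolding carrier_subalgebra_gen
  by (rule generate_ring_is_subring) (use assms in auto)

lemma scalar_in_subalgebra_gen: "a \<odot> \<one> \<in> carrier (subalgebra_gen A Y)"
  unfolding carrier_subalgebra_gen by (rule generate_ring.incl) auto

lemma subalgebra_gen_assoc_algebra:
  assumes "Y \<subseteq> carrier A"
  shows "assoc_algebra (subalgebra_gen A Y)"
  using subring_assoc_algebra[OF subring_subalgebra_gen[OF assms] scalar_in_subalgebra_gen]
  by (simp add: subalgebra_gen_def)

end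

section \<open>Monoid algebras, which cover both the free algebras and the free groups underlying
  tensor products\<close>

section \<open>Monoid algebras\<close>

locale monoid_algebra_of = G: monoid G
  for G :: "('g, 'm) monoid_scheme" +
  fixes A :: "('a::comm_ring_1, 'g \<Rightarrow>\<^sub>0 'a) module"
  defines "A \<equiv> monoid_algebra G"
begin

text \<open>The supports of a sum and of its summands differ; over common finite index sets
  distributivity becomes termwise.\<close>

lemma monoid_algebra_mult_superset:
  assumes "finite S" "finite U" "Poly_Mapping.keys f \<subseteq> S" "Poly_Mapping.keys g \<subseteq> U"
  shows "f \<otimes>\<^bsub>A\<^esub> g = (\<Sum>x\<in>S. \<Sum>y\<in>U. Poly_Mapping.single (x \<otimes>\<^bsub>G\<^esub> y)
                  (Poly_Mapping.lookup f x * Poly_Mapping.lookup g y))"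
proof -
  have "(\<Sum>y\<in>Poly_Mapping.keys g. Poly_Mapping.single (x \<otimes>\<^bsub>G\<^esub> y)
                  (Poly_Mapping.lookup f x * Poly_Mapping.lookup g y)) =
     (\<Sum>y\<in>U. Poly_Mapping.single (x \<otimes>\<^bsub>G\<^esub> y)
                  (Poly_Mapping.lookup f x * Poly_Mapping.lookup g y))" for x
    by (rule sum.mono_neutral_left) (use assms in \<open>auto simp: in_keys_iff\<close>)
  then have "f \<otimes>\<^bsub>A\<^esub> g = (\<Sum>x\<in>Poly_Mapping.keys f. \<Sum>y\<in>U. Poly_Mapping.single (x \<otimes>\<^bsub>G\<^esub> y)
                  (Poly_Mapping.lookup f x * Poly_Mapping.lookup g y))"
    by (simp add: A_def monoid_algebra_def)
  also have "\<dots> = (\<Sum>x\<in>S. \<Sum>y\<in>U. Poly_Mapping.single (x \<otimes>\<^bsub>G\<^esub> y)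
                  (Poly_Mapping.lookup f x * Poly_Mapping.lookup g y))"
    by (rule sum.mono_neutral_left) (use assms in \<open>auto simp: in_keys_iff\<close>)
  finally show ?thesis .
qed

lemma monoid_algebra_mult_single:
  "Poly_Mapping.single x a \<otimes>\<^bsub>A\<^esub> Poly_Mapping.single y b = Poly_Mapping.single (x \<otimes>\<^bsub>G\<^esub> y) (a * b)"
  by (subst monoid_algebra_mult_superset[of "{x}" "{y}"]) auto

lemma monoid_algebra_l_distr: "(f + g) \<otimes>\<^bsub>A\<^esub> h = f \<otimes>\<^bsub>A\<^esub> h + g \<otimes>\<^bsub>A\<^esub> h"
proof -
  let ?S = "Poly_Mapping.keys f \<union> Poly_Mapping.keys g" and ?U = "Poly_Mapping.keys h"
  show ?thesis
    by (subst (1 2 3) monoid_algebra_mult_superset[of ?S ?U])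
      (simp_all add: keys_add lookup_add distrib_right single_add sum.distrib)
qed

lemma monoid_algebra_r_distr: "h \<otimes>\<^bsub>A\<^esub> (f + g) = h \<otimes>\<^bsub>A\<^esub> f + h \<otimes>\<^bsub>A\<^esub> g"
proof -
  let ?S = "Poly_Mapping.keys f \<union> Poly_Mapping.keys g" and ?U = "Poly_Mapping.keys h"
  show ?thesis
    by (subst (1 2 3) monoid_algebra_mult_superset[of ?U ?S])
      (simp_all add: keys_add lookup_add distrib_left single_add sum.distrib)
qed

lemma monoid_algebra_zero_mult: "0 \<otimes>\<^bsub>A\<^esub> h = 0" "h \<otimes>\<^bsub>A\<^esub> 0 = 0"
  by (simp_all add: A_def monoid_algebra_def)

lemma monoid_algebra_induct [consumes 1, case_names single add]:
  assumes "f \<in> carrier A"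
    and single: "\<And>x a. x \<in> carrier G \<Longrightarrow> Q (Poly_Mapping.single x a)"
    and add: "\<And>f g. f \<in> carrier A \<Longrightarrow> g \<in> carrier A \<Longrightarrow> Q f \<Longrightarrow> Q g \<Longrightarrow> Q (f + g)"
  shows "Q f"
proof -
  have c: "carrier A = {f. Poly_Mapping.keys f \<subseteq> carrier G}"
    by (simp add: A_def monoid_algebra_def)
  have "Q (\<Sum>x\<in>S. Poly_Mapping.single x (Poly_Mapping.lookup f x)) \<and>
      (\<Sum>x\<in>S. Poly_Mapping.single x (Poly_Mapping.lookup f x)) \<in> carrier A"
    if "finite S" "S \<subseteq> carrier G" for S
    using that
  proof (induction S)
    case empty
    \<comment> \<open>The zero function is a monomial with coefficient 0.\<close>
    then show ?case using single[of "\<one>\<^bsub>G\<^esub>" 0] by (simp add: c)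
  next
    case (insert x S)
    let ?s = "Poly_Mapping.single x (Poly_Mapping.lookup f x)"
    have "?s \<in> carrier A" using insert.prems by (simp add: c)
    then show ?case
      using insert add[of ?s] single[of x] keys_add[of ?s "\<Sum>x\<in>S. Poly_Mapping.single x (Poly_Mapping.lookup f x)"]
      by (auto simp: c)
  qed
  from this[of "Poly_Mapping.keys f"] show ?thesis
    using assms(1) by (simp add: poly_mapping_sum_singles c)
qed

text \<open>The convolution formula makes sense for all finitely supported functions, so both sides
  of an identity are additive on the whole type, and it suffices to compare them on monomials from
  the support.\<close>

lemma additive_eq_on_singles:
  fixes \<phi> \<psi> :: "('g \<Rightarrow>\<^sub>0 'a) \<Rightarrow> 'c::ab_group_add"
  assumes "\<And>f g. \<phi> (f + g) = \<phi> f + \<phi> g" "\<And>f g. \<psi> (f + g) = \<psi> f + \<psi> g"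
    and "\<And>x a. x \<in> Poly_Mapping.keys f \<Longrightarrow> \<phi> (Poly_Mapping.single x a) = \<psi> (Poly_Mapping.single x a)"
  shows "\<phi> f = \<psi> f"
proof -
  have z: "\<phi> 0 = 0" "\<psi> 0 = 0" using assms(1)[of 0 0] assms(2)[of 0 0] by auto
  have "\<phi> (\<Sum>i\<in>I. s i) = (\<Sum>i\<in>I. \<phi> (s i))" "\<psi> (\<Sum>i\<in>I. s i) = (\<Sum>i\<in>I. \<psi> (s i))"
    for s and I :: "'g set"
    by (induction I rule: infinite_finite_induct) (auto simp: assms z)
  then show ?thesis using assms(3)
    by (subst (1 2) poly_mapping_sum_singles[of f, symmetric]) simp
qed

text \<open>One reduction to monomials per factor; then associativity of the monoid
  finishes.\<close>

lemma monoid_algebra_assoc: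
  assumes "f \<in> carrier A" "g \<in> carrier A" "h \<in> carrier A"
  shows "(f \<otimes>\<^bsub>A\<^esub> g) \<otimes>\<^bsub>A\<^esub> h = f \<otimes>\<^bsub>A\<^esub> (g \<otimes>\<^bsub>A\<^esub> h)"
proof -
  have k: "Poly_Mapping.keys f \<subseteq> carrier G" "Poly_Mapping.keys g \<subseteq> carrier G" "Poly_Mapping.keys h \<subseteq> carrier G"
    using assms by (auto simp: A_def monoid_algebra_def)
  show ?thesis
    apply (rule additive_eq_on_singles[of "\<lambda>f. (f \<otimes>\<^bsub>A\<^esub> g) \<otimes>\<^bsub>A\<^esub> h" "\<lambda>f. f \<otimes>\<^bsub>A\<^esub> (g \<otimes>\<^bsub>A\<^esub> h)"])
      apply (simp_all add: monoid_algebra_l_distr)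
    apply (rule additive_eq_on_singles[of "\<lambda>g. (_ \<otimes>\<^bsub>A\<^esub> g) \<otimes>\<^bsub>A\<^esub> h" "\<lambda>g. _ \<otimes>\<^bsub>A\<^esub> (g \<otimes>\<^bsub>A\<^esub> h)"])
      apply (simp_all add: monoid_algebra_l_distr monoid_algebra_r_distr)
    apply (rule additive_eq_on_singles[of "\<lambda>h. _ \<otimes>\<^bsub>A\<^esub> h" "\<lambda>h. _ \<otimes>\<^bsub>A\<^esub> (_ \<otimes>\<^bsub>A\<^esub> h)"])
      apply (simp_all add: monoid_algebra_l_distr monoid_algebra_r_distr)
    using k by (auto simp: monoid_algebra_mult_single mult.assoc intro!: arg_cong2[of _ _ _ _ Poly_Mapping.single] G.m_assoc)
qed

lemma monoid_algebra_mult_closed: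
  assumes "f \<in> carrier A" "g \<in> carrier A"
  shows "f \<otimes>\<^bsub>A\<^esub> g \<in> carrier A"
proof -
  have *: "Poly_Mapping.keys (\<Sum>i\<in>I. s i) \<subseteq> carrier G"
    if "\<And>i. i \<in> I \<Longrightarrow> Poly_Mapping.keys (s i) \<subseteq> carrier G" for I :: "'g set" and s :: "'g \<Rightarrow> 'g \<Rightarrow>\<^sub>0 'a"
    using that
    by (induction I rule: infinite_finite_induct) (use keys_add in \<open>fastforce+\<close>)
  show ?thesis
    using assms G.m_closed unfolding A_def monoid_algebra_def
    by simp (intro *, auto split: if_splits)
qed

lemma monoid_algebra_smult_lookup:
  "Poly_Mapping.lookup (a \<odot>\<^bsub>A\<^esub> f) x = a * Poly_Mapping.lookup f x"
  by (simp add: A_def monoid_algebra_def map.rep_eq when_def)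

lemma monoid_algebra_smult_single:
  "a \<odot>\<^bsub>A\<^esub> Poly_Mapping.single x b = Poly_Mapping.single x (a * b)"
  by (simp add: A_def monoid_algebra_def)

lemma monoid_algebra_smult_distr: "a \<odot>\<^bsub>A\<^esub> (f + g) = a \<odot>\<^bsub>A\<^esub> f + a \<odot>\<^bsub>A\<^esub> g"
  by (rule poly_mapping_eqI) (simp add: monoid_algebra_smult_lookup lookup_add ring_distribs)

lemma assoc_algebra_monoid_algebra: "assoc_algebra A"
proof -
  have c: "carrier A = {f. Poly_Mapping.keys f \<subseteq> carrier G}" and ad: "ring.add A = (+)" and z: "ring.zero A = 0"
    and o: "monoid.one A = Poly_Mapping.single \<one>\<^bsub>G\<^esub> 1"
    by (simp_all add: A_def monoid_algebra_def)
  have one_l: "\<one>\<^bsub>A\<^esub> \<otimes>\<^bsub>A\<^esub> f = f" and one_r: "f \<otimes>\<^bsub>A\<^esub> \<one>\<^bsub>A\<^esub> = f" if "f \<in> carrier A" for f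
    using that
    by (auto intro!: additive_eq_on_singles[of _ "\<lambda>f. f" f] simp: monoid_algebra_l_distr monoid_algebra_r_distr o c
       monoid_algebra_mult_single)
  have sm: "(a + b) \<odot>\<^bsub>A\<^esub> f = a \<odot>\<^bsub>A\<^esub> f + b \<odot>\<^bsub>A\<^esub> f" "(a * b) \<odot>\<^bsub>A\<^esub> f = a \<odot>\<^bsub>A\<^esub> (b \<odot>\<^bsub>A\<^esub> f)"
    "1 \<odot>\<^bsub>A\<^esub> f = f" for a b f
    by (rule poly_mapping_eqI, simp add: monoid_algebra_smult_lookup lookup_add ring_distribs mult.assoc)+
  have ad_closed: "x \<in> carrier A \<Longrightarrow> y \<in> carrier A \<Longrightarrow> x + y \<in> carrier A" for x y
    using keys_add[of x y] by (auto simp: c)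
  have "abelian_group A"
  proof (rule abelian_groupI)
    fix x assume "x \<in> carrier A"
    then show "\<exists>y\<in>carrier A. y \<oplus>\<^bsub>A\<^esub> x = \<zero>\<^bsub>A\<^esub>"
      by (intro bexI[of _ "-x"]) (auto simp: c ad z in_keys_iff)
  qed (simp_all add: ad z ad_closed add.assoc add.commute, simp add: c)
  moreover have "monoid A"
    by (rule monoidI) (auto simp: monoid_algebra_mult_closed one_l one_r monoid_algebra_assoc, simp add: c o)
  ultimately have "ring A"
    by (rule ringI) (simp_all add: ad monoid_algebra_l_distr monoid_algebra_r_distr)
  then show ?thesis
  proof (rule assoc_algebraI)
    fix x y and a b :: 'a
    show "x \<in> carrier A \<Longrightarrow> a \<odot>\<^bsub>A\<^esub> x \<in> carrier A"
      unfolding c mem_Collect_eq subset_iff in_keys_iff monoid_algebra_smult_lookup by (metis mult_zero_right)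
    show "a \<odot>\<^bsub>A\<^esub> x \<otimes>\<^bsub>A\<^esub> y = a \<odot>\<^bsub>A\<^esub> (x \<otimes>\<^bsub>A\<^esub> y)"
      apply (rule additive_eq_on_singles[of "\<lambda>x. a \<odot>\<^bsub>A\<^esub> x \<otimes>\<^bsub>A\<^esub> y" "\<lambda>x. a \<odot>\<^bsub>A\<^esub> (x \<otimes>\<^bsub>A\<^esub> y)"])
        apply (simp_all add: monoid_algebra_l_distr monoid_algebra_smult_distr monoid_algebra_smult_single)
      apply (rule additive_eq_on_singles[of "\<lambda>y. _ \<otimes>\<^bsub>A\<^esub> y" "\<lambda>y. a \<odot>\<^bsub>A\<^esub> (_ \<otimes>\<^bsub>A\<^esub> y)"])
        apply (simp_all add: monoid_algebra_r_distr monoid_algebra_smult_distr monoid_algebra_smult_single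
            monoid_algebra_mult_single mult.assoc)
      done
    show "x \<otimes>\<^bsub>A\<^esub> (a \<odot>\<^bsub>A\<^esub> y) = a \<odot>\<^bsub>A\<^esub> (x \<otimes>\<^bsub>A\<^esub> y)"
      apply (rule additive_eq_on_singles[of "\<lambda>x. x \<otimes>\<^bsub>A\<^esub> (a \<odot>\<^bsub>A\<^esub> y)" "\<lambda>x. a \<odot>\<^bsub>A\<^esub> (x \<otimes>\<^bsub>A\<^esub> y)"])
        apply (simp_all add: monoid_algebra_l_distr monoid_algebra_smult_distr monoid_algebra_smult_single)
      apply (rule additive_eq_on_singles[of "\<lambda>y. _ \<otimes>\<^bsub>A\<^esub> (a \<odot>\<^bsub>A\<^esub> y)" "\<lambda>y. a \<odot>\<^bsub>A\<^esub> (_ \<otimes>\<^bsub>A\<^esub> y)"])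
        apply (simp_all add: monoid_algebra_r_distr monoid_algebra_smult_distr monoid_algebra_smult_single
            monoid_algebra_mult_single mult.left_commute)
      done
  qed (simp_all add: ad sm monoid_algebra_smult_distr)
qed

lemma monoid_algebra_minus: "f \<in> carrier A \<Longrightarrow> \<ominus>\<^bsub>A\<^esub> f = - f"
proof -
  assume f: "f \<in> carrier A"
  interpret A: assoc_algebra A by (rule assoc_algebra_monoid_algebra)
  have "Poly_Mapping.keys (- f) = Poly_Mapping.keys f"
    unfolding set_eq_subset subset_iff in_keys_iff by simp
  then have "- f \<in> carrier A" using f by (simp add: A_def monoid_algebra_def)
  moreover have "- f \<oplus>\<^bsub>A\<^esub> f = \<zero>\<^bsub>A\<^esub>" by (simp add: A_def monoid_algebra_def)
  ultimately show ?thesis using f by (intro A.minus_equality)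
qed

lemma monoid_algebra_diff:
  assumes "f \<in> carrier A" "g \<in> carrier A"
  shows "f - g \<in> carrier A" "f \<ominus>\<^bsub>A\<^esub> g = f - g"
proof -
  interpret A: assoc_algebra A by (rule assoc_algebra_monoid_algebra)
  show *: "f \<ominus>\<^bsub>A\<^esub> g = f - g"
    unfolding a_minus_def monoid_algebra_minus[OF assms(2)] by (simp add: A_def monoid_algebra_def)
  show "f - g \<in> carrier A" using A.minus_closed[OF assms] unfolding * .
qed

lemma monoid_algebra_l_diff: "(f - g) \<otimes>\<^bsub>A\<^esub> h = f \<otimes>\<^bsub>A\<^esub> h - g \<otimes>\<^bsub>A\<^esub> h"
  using monoid_algebra_l_distr[of "f - g" g h] by (simp add: eq_diff_eq)

lemma monoid_algebra_r_diff: "h \<otimes>\<^bsub>A\<^esub> (f - g) = h \<otimes>\<^bsub>A\<^esub> f - h \<otimes>\<^bsub>A\<^esub> g"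
  using monoid_algebra_r_distr[of h "f - g" g] by (simp add: eq_diff_eq)

end

section \<open>The Coxeter group of type B: descents, exchange and reduced expressions\<close>

section \<open>Reduced expressions in the Weyl group of type B\<close>

text \<open>The variable \<open>m\<close> stands for \<open>2*r - i\<close>, so that the case
  distinctions compare positions without natural subtraction.\<close>

lemma cox_less:
  assumes "i \<in> {1..<r}" "m = 2*r - i"
  shows "cox r i k = (if k = i then i + 1 else if k = i + 1 then i
     else if k = m then m + 1 else if k = m + 1 then m else k)"
proof -
  have "i + 1 < m" "2*r + 1 - i = m + 1" using assms by auto
  then show ?thesis using assms(1) unfolding cox_def assms(2)[symmetric] by (simp add: transpose_def)
qed

lemma cox_last: "cox r r k = (if k = r then r + 1 else if k = r + 1 then r else k)"
  by (auto simp: cox_def transpose_def)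

lemma cox_cox [simp]:
  assumes "i \<in> {1..r}" shows "cox r i (cox r i k) = k"
proof (cases "i = r")
  case False
  define m where "m = 2*r - i"
  have "i \<in> {1..<r}" "i + 1 < m" using assms False by (auto simp: m_def)
  then show ?thesis by (simp add: cox_less[OF _ m_def])
qed (simp add: cox_last)

lemma cox_comp_cox [simp]: "i \<in> {1..r} \<Longrightarrow> cox r i \<circ> cox r i = id"
  by (auto simp: fun_eq_iff)

lemma comp_cox_cox [simp]: "i \<in> {1..r} \<Longrightarrow> w \<circ> cox r i \<circ> cox r i = w"
  by (auto simp: fun_eq_iff)

lemma cox_neighbours [simp]:
  assumes "i \<in> {1..r}" shows "cox r i i = i + 1" "cox r i (i + 1) = i" "cox r i (Suc i) = i"
  using assms by (cases "i = r"; simp add: cox_less[OF _ refl] cox_last)+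

lemma cox_permutes: "i \<in> {1..r} \<Longrightarrow> cox r i permutes {1..2*r}"
  unfolding cox_def by (auto intro!: permutes_compose permutes_swap_id)

lemma WB_permutes: "w \<in> WB r \<Longrightarrow> w permutes {1..2*r}"
  by (simp add: WB_def)

lemma WB_inj: "w \<in> WB r \<Longrightarrow> w i = w j \<longleftrightarrow> i = j"
  by (metis WB_permutes permutes_inj injD)

lemma WB_mirror: "w \<in> WB r \<Longrightarrow> i \<in> {1..2*r} \<Longrightarrow> w (2*r + 1 - i) = 2*r + 1 - w i"
  unfolding WB_def by fastforce

lemma WB_range: "w \<in> WB r \<Longrightarrow> i \<in> {1..2*r} \<Longrightarrow> w i \<in> {1..2*r}"
  by (metis WB_permutes permutes_in_image)

lemma cox_mirror:
  assumes "i \<in> {1..r}" "k \<in> {1..2*r}" shows "cox r i (2*r + 1 - k) = 2*r + 1 - cox r i k"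
proof -
  define k' where "k' = 2*r + 1 - k"
  define m where "m = 2*r - i"
  have k: "k + k' = 2*r + 1" using assms(2) by (auto simp: k'_def)
  have m: "i + m = 2*r" using assms(1) by (auto simp: m_def)
  show ?thesis
    unfolding k'_def[symmetric]
  proof (cases "i = r")
    case True
    then show "cox r i k' = 2*r + 1 - cox r i k" using k by (auto simp: cox_last)
  next
    case False
    then have i: "i \<in> {1..<r}" using assms(1) by auto
    have "k' = i \<longleftrightarrow> k = m + 1" "k' = i + 1 \<longleftrightarrow> k = m" "k' = m \<longleftrightarrow> k = i + 1" "k' = m + 1 \<longleftrightarrow> k = i"
      using k m by linarith+
    moreover have "i + 1 < m" using i m by simp
    moreover have "k' = 2*r + 1 - k" "2*r + 1 - i = m + 1" "2*r + 1 - (i + 1) = m" "2*r + 1 - m = i + 1"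
      "2*r + 1 - (m + 1) = i"
      using k m by linarith+
    ultimately show "cox r i k' = 2*r + 1 - cox r i k"
      unfolding cox_less[OF i m_def] by (simp del: diff_Suc_Suc)
  qed
qed

lemma WB_I:
  assumes "w permutes {1..2*r}" "\<And>i. i \<in> {1..2*r} \<Longrightarrow> w (2*r + 1 - i) = 2*r + 1 - w i"
  shows "w \<in> WB r"
proof -
  have "w i + w (2*r + 1 - i) = 2*r + 1" if "i \<in> {1..2*r}" for i
    using assms(2)[OF that] permutes_in_image[OF assms(1), of i] that by simp
  then show ?thesis using assms(1) by (simp add: WB_def)
qed

lemma WB_comp:
  assumes "v \<in> WB r" "w \<in> WB r" shows "v \<circ> w \<in> WB r"
proof (rule WB_I)
  show "(v \<circ> w) (2*r + 1 - i) = 2*r + 1 - (v \<circ> w) i" if "i \<in> {1..2*r}" for i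
    using WB_mirror[OF assms(2) that] WB_mirror[OF assms(1) WB_range[OF assms(2) that]] by simp
qed (intro permutes_compose WB_permutes assms)

lemma id_WB: "id \<in> WB r"
  by (rule WB_I) (simp_all add: permutes_id)

lemma cox_WB: "i \<in> {1..r} \<Longrightarrow> cox r i \<in> WB r"
  by (intro WB_I cox_permutes cox_mirror)

lemma finite_WB: "finite (WB r)"
  by (rule finite_subset[OF _ finite_permutations[of "{1..2*r}"]]) (auto simp: WB_def)

lemma cox_prod_simps [simp]:
  "cox_prod r [] = id" "cox_prod r (i # is) = cox r i \<circ> cox_prod r is"
  by (simp_all add: cox_prod_def)

lemma cox_prod_append [simp]: "cox_prod r (is @ js) = cox_prod r is \<circ> cox_prod r js"
  by (induction "is") (auto simp: fun_eq_iff)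

text \<open>The elements that possess an expression, hence a reduced one, in the generators: the set
  on which \<open>Tw\<close> can be computed. The parabolic subgroups lie in it.\<close>

definition cox_group :: "nat \<Rightarrow> (nat \<Rightarrow> nat) set" where
  "cox_group r = cox_prod r ` lists {1..r}"

lemma cox_prod_WB: "is \<in> lists {1..r} \<Longrightarrow> cox_prod r is \<in> WB r"
  by (induction "is") (simp_all add: id_WB WB_comp cox_WB)

lemma cox_group_WB: "w \<in> cox_group r \<Longrightarrow> w \<in> WB r"
  unfolding cox_group_def by (elim imageE) (simp only: cox_prod_WB)

lemma finite_cox_group: "finite (cox_group r)"
  by (rule finite_subset[OF _ finite_WB]) (rule subsetI, rule cox_group_WB)

lemma id_cox_group [simp]: "id \<in> cox_group r"
  unfolding cox_group_def by (rule image_eqI[of _ _ "[]"]) auto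

lemma cox_group_comp: "v \<in> cox_group r \<Longrightarrow> w \<in> cox_group r \<Longrightarrow> v \<circ> w \<in> cox_group r"
  unfolding cox_group_def by (elim imageE) (simp add: image_iff flip: cox_prod_append, metis append_in_lists_conv)

lemma cox_cox_group: "i \<in> {1..r} \<Longrightarrow> cox r i \<in> cox_group r"
  unfolding cox_group_def by (rule image_eqI[of _ _ "[i]"]) auto

lemma comp_cox_in_cox_group [simp]: "i \<in> {1..r} \<Longrightarrow> w \<circ> cox r i \<in> cox_group r \<longleftrightarrow> w \<in> cox_group r"
  using cox_group_comp[OF _ cox_cox_group, of w r i] cox_group_comp[OF _ cox_cox_group, of "w \<circ> cox r i" r i] by auto

lemma comp_cox_WB [simp]: "i \<in> {1..r} \<Longrightarrow> w \<circ> cox r i \<in> WB r \<longleftrightarrow> w \<in> WB r"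
  using WB_comp[OF _ cox_WB, of w r i] WB_comp[OF _ cox_WB, of "w \<circ> cox r i" r i] by auto

text \<open>Left multiplication by \<open>s\<^sub>j\<close> reverses the order of two values only if
  it exchanges them. So \<open>u\<close> maps the positions \<open>i\<close>, \<open>i + 1\<close>
  to a pair swapped by \<open>s\<^sub>j\<close>, by symmetry also the mirror positions, and hence
  \<open>u s\<^sub>i u\<^sup>-\<^sup>1 = s\<^sub>j\<close>.\<close>

lemma cox_intertwine:
  assumes "u \<in> WB r" "i \<in> {1..r}" "j \<in> {1..r}" "u i < u (i + 1)" "cox r j (u i) > cox r j (u (i + 1))"
  shows "cox r j \<circ> u = u \<circ> cox r i"
proof -
  have m: "u (2*r + 1 - i) = 2*r + 1 - u i" "u (2*r - i) = 2*r + 1 - u (i + 1)"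
    using WB_mirror[OF assms(1), of i] WB_mirror[OF assms(1), of "i + 1"] assms(2) by simp_all
  have rg: "u i \<in> {1..2*r}" "u (i + 1) \<in> {1..2*r}"
    using WB_range[OF assms(1)] assms(2) by auto
  \<comment> \<open>Position \<open>r\<close> is the one whose right neighbour is its own mirror
    image; this singles out the generator that is one transposition instead of two.\<close>
  have ends: "i = r \<longleftrightarrow> u i + u (i + 1) = 2*r + 1"
  proof
    show "i = r \<Longrightarrow> u i + u (i + 1) = 2*r + 1"
      using m rg by (auto simp: Suc_diff_le mult_2)
    assume "u i + u (i + 1) = 2*r + 1"
    then have "u (2*r + 1 - i) = u (i + 1)" using m by auto
    then have "2*r + 1 - i = i + 1" using WB_inj[OF assms(1)] by blast
    then show "i = r" using assms(2) by auto
  qed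
  define m n where "m = 2*r - i" and "n = 2*r - j"
  have mn: "i + m = 2*r" "j + n = 2*r" "2*r - i = m" "2*r + 1 - i = m + 1"
    using assms(2,3) by (auto simp: m_def n_def)
  have pos: "(u i = j \<and> u (i + 1) = j + 1) \<or> (j < r \<and> u i = n \<and> u (i + 1) = n + 1)"
  proof (cases "j = r")
    case True
    then show ?thesis using assms(4,5) by (auto simp: cox_last split: if_splits)
  next
    case False
    then have j: "j \<in> {1..<r}" using assms(3) by auto
    then show ?thesis using assms(4,5) unfolding cox_less[OF j n_def] by (simp split: if_splits)
  qed
  have um: "u m + u (i + 1) = 2*r + 1" "u (m + 1) + u i = 2*r + 1"
    using m rg unfolding mn(3,4) by auto
  have ij: "i = r \<longleftrightarrow> j = r"
    unfolding ends using pos mn(2) by auto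
  show ?thesis
  proof
    fix k
    show "(cox r j \<circ> u) k = (u \<circ> cox r i) k"
    proof (cases "j = r")
      case True
      then have "u r = r" "u (r + 1) = r + 1" "i = r" using pos ij by auto
      then show ?thesis using True WB_inj[OF assms(1), of k r] WB_inj[OF assms(1), of k "r + 1"]
        by (auto simp: cox_last)
    next
      case False
      then have ij': "i \<in> {1..<r}" "j \<in> {1..<r}" using ij assms(2,3) by auto
      have d: "j + 1 < n" "i + 1 < m" using mn ij' by auto
      have "u i = j \<and> u (i + 1) = j + 1 \<and> u m = n \<and> u (m + 1) = n + 1 \<or>
        u i = n \<and> u (i + 1) = n + 1 \<and> u m = j \<and> u (m + 1) = j + 1"
        using pos um mn by linarith
      then show ?thesis
        unfolding comp_apply cox_less[OF ij'(1) m_def] cox_less[OF ij'(2) n_def]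
        using d WB_inj[OF assms(1), of k i] WB_inj[OF assms(1), of k "i + 1"]
          WB_inj[OF assms(1), of k m] WB_inj[OF assms(1), of k "m + 1"]
        by (elim disjE conjE) simp_all
    qed
  qed
qed

text \<open>The empty word keeps \<open>i\<close>, \<open>i + 1\<close> in order and the whole word
  does not, so, reading from the right, some letter reverses them. By \<open>cox_intertwine\<close>
  that letter equals \<open>s\<^sub>i\<close> moved to the far right, where it cancels.\<close>

lemma exchange:
  assumes "is \<in> lists {1..r}" "i \<in> {1..r}" "cox_prod r is i > cox_prod r is (i + 1)"
  shows "\<exists>js\<in>lists {1..r}. Suc (length js) = length is \<and> cox_prod r js = cox_prod r is \<circ> cox r i"
  using assms(1,3)
proof (induction "is")
  case Nil then show ?case by simp
next
  case (Cons j "is")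
  then have j: "j \<in> {1..r}" "is \<in> lists {1..r}" by auto
  let ?u = "cox_prod r is"
  show ?case
  proof (cases "?u i > ?u (i + 1)")
    case True
    then obtain js where "js \<in> lists {1..r}" "Suc (length js) = length is" "cox_prod r js = ?u \<circ> cox r i"
      using Cons.IH j(2) True by blast
    then show ?thesis using j by (intro bexI[of _ "j # js"]) auto
  next
    case False
    moreover have "?u i \<noteq> ?u (i + 1)"
      using WB_inj[OF cox_prod_WB[OF j(2)]] by simp
    ultimately have "cox r j \<circ> ?u = ?u \<circ> cox r i"
      using Cons j assms(2) by (intro cox_intertwine[OF cox_prod_WB]) auto
    then show ?thesis using j assms(2) by (intro bexI[of _ "is"]) (auto simp: comp_assoc)
  qed
qed

lemma ex_reduced_expr:
  assumes "w \<in> cox_group r" shows "\<exists>is. reduced_expr r w is"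
proof -
  obtain js where "js \<in> lists {1..r} \<and> cox_prod r js = w"
    using assms by (auto simp: cox_group_def)
  from ex_has_least_nat[of "\<lambda>js. js \<in> lists {1..r} \<and> cox_prod r js = w", OF this, of length]
  show ?thesis unfolding reduced_expr_def by blast
qed

lemma reduced_expr_cox_group: "reduced_expr r w is \<Longrightarrow> w \<in> cox_group r"
  by (auto simp: reduced_expr_def cox_group_def)

lemma reduced_expr_WB: "reduced_expr r w is \<Longrightarrow> w \<in> WB r"
  by (intro cox_group_WB reduced_expr_cox_group)

lemma reduced_expr_length_eq:
  assumes "reduced_expr r w is" "js \<in> lists {1..r}" "cox_prod r js = w" "length js \<le> length is"
  shows "reduced_expr r w js"
  using assms unfolding reduced_expr_def by fastforce

lemma reduced_expr_unique_length:
  "reduced_expr r w is \<Longrightarrow> reduced_expr r w js \<Longrightarrow> length is = length js"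
  unfolding reduced_expr_def by (blast intro: le_antisym)

text \<open>Exchange deletes a letter from the given word; putting \<open>i\<close> behind the rest
  restores \<open>w\<close> without making the word longer.\<close>

lemma reduced_expr_descent:
  assumes "reduced_expr r w is" "i \<in> {1..r}" "w i > w (i + 1)"
  shows "\<exists>js. reduced_expr r (w \<circ> cox r i) js \<and> reduced_expr r w (js @ [i])"
proof -
  have "is": "is \<in> lists {1..r}" "cox_prod r is = w"
    and min: "\<And>js. js \<in> lists {1..r} \<Longrightarrow> cox_prod r js = w \<Longrightarrow> length is \<le> length js"
    using assms(1) by (auto simp: reduced_expr_def)
  obtain js where js: "js \<in> lists {1..r}" "Suc (length js) = length is" "cox_prod r js = w \<circ> cox r i"
    using exchange[of "is" r i] "is" assms by auto
  have "reduced_expr r (w \<circ> cox r i) js"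
    unfolding reduced_expr_def
  proof (intro conjI ballI impI)
    fix ks assume "ks \<in> lists {1..r}" "cox_prod r ks = w \<circ> cox r i"
    then show "length js \<le> length ks"
      using min[of "ks @ [i]"] js(2) assms(2) by simp
  qed (use js in auto)
  moreover have "reduced_expr r w (js @ [i])"
    by (rule reduced_expr_length_eq[OF assms(1)]) (use js assms(2) in auto)
  ultimately show ?thesis by blast
qed

lemma reduced_expr_snoc:
  assumes "reduced_expr r w (js @ [i])"
  shows "i \<in> {1..r}" "w i > w (i + 1)" "reduced_expr r (w \<circ> cox r i) js"
proof -
  have js: "js \<in> lists {1..r}" "i \<in> {1..r}" "cox_prod r js \<circ> cox r i = w"
    and min: "\<And>ks. ks \<in> lists {1..r} \<Longrightarrow> cox_prod r ks = w \<Longrightarrow> Suc (length js) \<le> length ks"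
    using assms by (auto simp: reduced_expr_def)
  have u: "cox_prod r js = w \<circ> cox r i" using js(2,3) by auto
  show "i \<in> {1..r}" by fact
  show "w i > w (i + 1)"
  proof (rule ccontr)
    assume "\<not> w i > w (i + 1)"
    moreover have "w i \<noteq> w (i + 1)" using WB_inj[OF reduced_expr_WB[OF assms]] by simp
    \<comment> \<open>If \<open>w\<close> kept \<open>i\<close>, \<open>i + 1\<close> in order, the
      word \<open>js\<close> for \<open>w s\<^sub>i\<close> would not, and exchange would produce a
      word for \<open>w\<close> that is shorter than \<open>js\<close>.\<close>
    ultimately have "cox_prod r js i > cox_prod r js (i + 1)"
      unfolding u using js(2) by simp
    from exchange[OF js(1,2) this] obtain ks where
      "ks \<in> lists {1..r}" "Suc (length ks) = length js" "cox_prod r ks = w"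
      using js by auto
    then show False using min[of ks] by simp
  qed
  show "reduced_expr r (w \<circ> cox r i) js"
    unfolding reduced_expr_def
  proof (intro conjI ballI impI)
    fix ks assume "ks \<in> lists {1..r}" "cox_prod r ks = w \<circ> cox r i"
    then show "length js \<le> length ks"
      using min[of "ks @ [i]"] js(2) by simp
  qed (use js u in auto)
qed

text \<open>For \<open>w s\<^sub>i\<close> the index \<open>i\<close> is a descent, so it has a
  reduced expression ending in \<open>i\<close>; comparing lengths shows that the given word
  extended by \<open>i\<close> is as short.\<close>

lemma reduced_expr_ascent:
  assumes "reduced_expr r w is" "i \<in> {1..r}" "w i < w (i + 1)"
  shows "reduced_expr r (w \<circ> cox r i) (is @ [i])"
proof -
  have "w \<circ> cox r i \<in> cox_group r"
    using reduced_expr_cox_group[OF assms(1)] assms(2) by simp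
  then obtain ks where ks: "reduced_expr r (w \<circ> cox r i) ks"
    using ex_reduced_expr by blast
  then obtain js where js: "reduced_expr r w js" "reduced_expr r (w \<circ> cox r i) (js @ [i])"
    using reduced_expr_descent[OF ks assms(2)] assms by auto
  have "length is = length js" using reduced_expr_unique_length[OF assms(1) js(1)] .
  then show ?thesis
    using reduced_expr_length_eq[OF js(2), of "is @ [i]"] assms by (auto simp: reduced_expr_def)
qed

lemma cox_braid_commute:
  assumes "i \<in> {1..r}" "j \<in> {1..r}" "i + 2 \<le> j"
  shows "cox r i \<circ> cox r j = cox r j \<circ> cox r i"
proof -
  define m n where "m = 2*r - i" and "n = 2*r - j"
  have mn: "i + m = 2*r" "j + n = 2*r" "i \<in> {1..<r}" using assms by (auto simp: m_def n_def)
  show ?thesis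
  proof (cases "j = r")
    case True
    then show ?thesis using assms mn by (simp add: fun_eq_iff cox_less[OF mn(3) m_def] cox_last)
  next
    case False
    then have "j \<in> {1..<r}" using assms by auto
    then show ?thesis using assms mn by (simp add: fun_eq_iff cox_less[OF mn(3) m_def] cox_less[OF _ n_def])
  qed
qed

lemma cox_braid_A:
  assumes "1 \<le> i" "i + 1 < r"
  shows "cox r i \<circ> (cox r (i + 1) \<circ> cox r i) = cox r (i + 1) \<circ> (cox r i \<circ> cox r (i + 1))"
proof -
  define n where "n = 2*r - (i + 1)"
  have "n + 1 = 2*r - i" "i \<in> {1..<r}" "i + 1 \<in> {1..<r}" "i + 2 < n" using assms by (auto simp: n_def)
  note c1 = cox_less[OF this(2,1)] and c2 = cox_less[OF this(3) n_def]
  show ?thesis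
  proof
    fix k
    show "(cox r i \<circ> (cox r (i + 1) \<circ> cox r i)) k = (cox r (i + 1) \<circ> (cox r i \<circ> cox r (i + 1))) k"
      using \<open>i + 2 < n\<close> unfolding comp_apply c1 c2 by simp
  qed
qed

lemma cox_braid_B:
  assumes "2 \<le> r"
  shows "cox r r \<circ> (cox r (r - 1) \<circ> (cox r r \<circ> cox r (r - 1))) = cox r (r - 1) \<circ> (cox r r \<circ> (cox r (r - 1) \<circ> cox r r))"
proof -
  obtain l where l: "r = l + 1" "1 \<le> l" using assms by (metis Suc_eq_plus1 Suc_le_D one_add_one plus_1_eq_Suc Suc_le_mono)
  have c: "cox (l + 1) l k = (if k = l then l + 1 else if k = l + 1 then l
     else if k = l + 2 then l + 2 + 1 else if k = l + 2 + 1 then l + 2 else k)" for k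
    by (rule cox_less) (use l in auto)
  show ?thesis unfolding l by (simp add: fun_eq_iff c[simplified] cox_last)
qed

section \<open>Matsumoto's theorem\<close>

text \<open>The list is in reverse: its first element is the last letter of a reduced expression of \<open>w\<close>.\<close>

fun desc_word :: "nat \<Rightarrow> (nat \<Rightarrow> nat) \<Rightarrow> nat list \<Rightarrow> bool" where
  "desc_word r w [] = True"
| "desc_word r w (i # is) \<longleftrightarrow> i \<in> {1..r} \<and> w i > w (i + 1) \<and> desc_word r (w \<circ> cox r i) is"

text \<open>Strip the letters off at successive descents, take any reduced expression of the rest,
  and put the letters back: each is then an ascent.\<close>

lemma reduced_expr_desc_word:
  "w \<in> cox_group r \<Longrightarrow> desc_word r w is \<Longrightarrow> \<exists>v. reduced_expr r w (v @ rev is)"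
proof (induction "is" arbitrary: w)
  case Nil then show ?case using ex_reduced_expr by auto
next
  case (Cons i "is")
  then have i: "i \<in> {1..r}" "w \<circ> cox r i \<in> cox_group r" "desc_word r (w \<circ> cox r i) is"
    by simp_all
  then obtain v where v: "reduced_expr r (w \<circ> cox r i) (v @ rev is)" using Cons.IH by blast
  have "reduced_expr r (w \<circ> cox r i \<circ> cox r i) ((v @ rev is) @ [i])"
    by (rule reduced_expr_ascent[OF v]) (use Cons.prems in auto)
  then show ?case using Cons.prems by auto
qed

text \<open>Invariance under braid moves is asked at the end of a word only, and \<open>snoc\<close>
  propagates it to the right. Two reduced expressions ending in \<open>i\<close> and
  \<open>j\<close> are linked through reduced expressions that end in the two sides of the braid
  relation of \<open>i\<close> and \<open>j\<close>; words with equal last letter are covered by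
  induction on the length.\<close>

theorem matsumoto:
  fixes P :: "nat list \<Rightarrow> 'b"
  assumes snoc: "\<And>js js' i. js \<in> lists {1..r} \<Longrightarrow> js' \<in> lists {1..r} \<Longrightarrow> i \<in> {1..r} \<Longrightarrow> P js = P js' \<Longrightarrow> P (js @ [i]) = P (js' @ [i])"
    and comm: "\<And>v i j. v \<in> lists {1..r} \<Longrightarrow> i \<in> {1..r} \<Longrightarrow> j \<in> {1..r} \<Longrightarrow> i + 2 \<le> j \<Longrightarrow> P (v @ [i, j]) = P (v @ [j, i])"
    and braidA: "\<And>v i. v \<in> lists {1..r} \<Longrightarrow> 1 \<le> i \<Longrightarrow> i + 1 < r \<Longrightarrow> P (v @ [i, i + 1, i]) = P (v @ [i + 1, i, i + 1])"
    and braidB: "\<And>v. v \<in> lists {1..r} \<Longrightarrow> 2 \<le> r \<Longrightarrow> P (v @ [r - 1, r, r - 1, r]) = P (v @ [r, r - 1, r, r - 1])"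
    and "reduced_expr r w p" "reduced_expr r w q"
  shows "P p = P q"
  using assms(5,6)
proof (induction "length p" arbitrary: w p q)
  case 0
  then show ?case using reduced_expr_unique_length[OF 0(2,3)] by simp
next
  case (Suc m)
  obtain p' i where p: "p = p' @ [i]" using Suc(2) by (metis length_Suc_conv_rev)
  obtain q' j where q: "q = q' @ [j]"
    using Suc(2) reduced_expr_unique_length[OF Suc(3,4)] by (metis length_Suc_conv_rev)
  have lp: "length p' = m" using Suc(2) p by simp
  have lq: "length q' = m" using Suc(2) q reduced_expr_unique_length[OF Suc(3,4)] by simp
  note ri = reduced_expr_snoc[OF Suc(3)[unfolded p]] and rj = reduced_expr_snoc[OF Suc(4)[unfolded q]]
  have wB: "w \<in> WB r" and wG: "w \<in> cox_group r"
    using reduced_expr_WB[OF Suc(3)] reduced_expr_cox_group[OF Suc(3)] by auto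
  have words: "p' \<in> lists {1..r}" "q' \<in> lists {1..r}"
    using ri(3) rj(3) by (auto simp: reduced_expr_def)
  have IH: "P (u @ [k]) = P (u' @ [k])"
    if "reduced_expr r w (u @ [k])" "reduced_expr r w (u' @ [k])" "length u = m" for u u' k
  proof (rule snoc)
    show "P u = P u'"
      using Suc(1)[of u "w \<circ> cox r k" u'] reduced_expr_snoc(3) that by auto
  qed (use that in \<open>auto simp: reduced_expr_def\<close>)
  \<comment> \<open>\<open>x @ [k]\<close> and \<open>y @ [l]\<close> will be the two sides of a
    braid relation. The letters of the first are successive descents of \<open>w\<close>, so some
    reduced expression of \<open>w\<close> ends in it; exchanging the sides gives one that ends in
    \<open>l\<close>.\<close>
  have key: "P (a @ [k]) = P (b @ [l])"
    if "reduced_expr r w (a @ [k])" "reduced_expr r w (b @ [l])" "length a = m" "length b = m"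
      and xy: "desc_word r w (k # rev x)" "cox_prod r (x @ [k]) = cox_prod r (y @ [l])" "length x = length y"
        "y @ [l] \<in> lists {1..r}"
        "\<And>v. v \<in> lists {1..r} \<Longrightarrow> P (v @ x @ [k]) = P (v @ y @ [l])"
    for a b k l x y
  proof -
    obtain v where v: "reduced_expr r w (v @ x @ [k])"
      using reduced_expr_desc_word[OF wG xy(1)] by auto
    have v': "reduced_expr r w (v @ y @ [l])"
      by (rule reduced_expr_length_eq[OF v])
        (use v xy(2-4) in \<open>auto simp: reduced_expr_def comp_assoc\<close>)
    have "P (a @ [k]) = P ((v @ x) @ [k])"
      by (rule IH) (use that v in auto)
    also have "\<dots> = P ((v @ y) @ [l])"
      using xy(5)[of v] v by (auto simp: reduced_expr_def)
    also have "\<dots> = P (b @ [l])"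
      by (rule IH[symmetric]) (use that v' in auto)
    finally show ?thesis .
  qed
  have sym: "P (a @ [k]) = P (b @ [l])"
    if red: "reduced_expr r w (a @ [k])" "reduced_expr r w (b @ [l])" "length a = m" "length b = m"
      and "k < l" for a b k l
  proof -
    note rk = reduced_expr_snoc[OF red(1)] and rl = reduced_expr_snoc[OF red(2)]
    \<comment> \<open>The three kinds of pairs: commuting generators, neighbours on a simple edge,
      and the double edge of type B.\<close>
    consider "k + 2 \<le> l" | "l = k + 1" "l < r" | "k = r - 1" "l = r" "2 \<le> r"
      using \<open>k < l\<close> rk(1) rl(1) by force
    then show ?thesis
    proof cases
      case 1
      then have fix_l: "cox r k l = l" "cox r k (l + 1) = l + 1"
        using rk(1) rl(1) by (auto simp: cox_less[OF _ refl])
      show ?thesis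
        by (rule key[OF red, of "[l]" "[k]"])
          (use 1 rk rl fix_l cox_braid_commute[of k r l] comm[of _ k l] in \<open>auto simp: comp_assoc\<close>)
    next
      case 2
      then have c: "cox r k (k + 2) = k + 2" "cox r (k + 1) k = k"
         "cox r (k + 1) (k + 2) = k + 1" "cox r (k + 1) (k + 1) = k + 2"
        using rk(1) by (auto simp: cox_less[OF _ refl])
      show ?thesis
        by (rule key[OF red, of "[k, k + 1]" "[k + 1, k]"])
          (use 2 rk rl c cox_braid_A[of k r] braidA[of _ k] in \<open>auto simp: comp_assoc\<close>)
    next
      case 3
      then have c: "cox r (r - 1) (r + 1) = r + 2" "cox r r (r - 1) = r - 1" "cox r (r - 1) r = r - 1"
         "cox r (r - 1) (r - 1) = r" "cox r r (r + 1) = r" "cox r r r = r + 1" "cox r r (r + 2) = r + 2"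
         "cox r (r - 1) (r + 2) = r + 1"
        by (auto simp: cox_less[OF _ refl] cox_last)
      have m: "w (r + 2) = 2*r + 1 - w (r - 1)" "w (r + 1) = 2*r + 1 - w r"
      proof -
        have "2*r + 1 - (r - 1) = r + 2" "2*r + 1 - r = r + 1" "r - 1 \<in> {1..2*r}" "r \<in> {1..2*r}"
          using 3(3) by auto
        then show "w (r + 2) = 2*r + 1 - w (r - 1)" "w (r + 1) = 2*r + 1 - w r"
          using WB_mirror[OF wB, of "r - 1"] WB_mirror[OF wB, of r] by simp_all
      qed
      have "r - 1 \<in> {1..2*r}" using 3(3) by auto
      note rg = WB_range[OF wB this]
      have d: "w (r - 1) > w r" "w r > w (r + 1)" using rk(2) rl(2) 3 by auto
      \<comment> \<open>The mirror symmetry turns the descent at \<open>r - 1\<close> into one at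
        \<open>r + 1\<close>. So the values at \<open>r - 1\<close>, \<open>r\<close>,
        \<open>r + 1\<close>, \<open>r + 2\<close> decrease, which makes all four letters of the
        braid word descents.\<close>
      then have "w (r + 1) > w (r + 2)" using m rg unfolding atLeastAtMost_iff by linarith
      then have d': "w (r - 1) > w (r + 2)" "w r > w (r + 2)" using d by linarith+
      have e: "r - 1 + 1 = r" "r - 1 \<in> {1..r}" "r \<in> {1..r}" using 3(3) by auto
      have "desc_word r w [r - 1, r, r - 1, r]"
        by (simp only: desc_word.simps comp_apply e c d d' simp_thms)
      then show ?thesis
        unfolding 3(1,2)
        by (intro key[OF red[unfolded 3(1,2)], of "[r, r - 1, r]" "[r - 1, r, r - 1]"])
          (use 3 cox_braid_B[of r] braidB in \<open>auto simp: comp_assoc\<close>)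
    qed
  qed
  show ?case
  proof (cases i j rule: linorder_cases)
    case less then show ?thesis using sym[OF _ _ lp lq less] Suc(3,4) p q by auto
  next
    case equal
    then show ?thesis using IH[of p' i q'] Suc(3,4) p q lp by simp
  next
    case greater
    then show ?thesis using sym[OF _ _ lq lp greater] Suc(3,4) p q by auto
  qed
qed

text \<open>The generators with \<open>i < r\<close> permute the first half \<open>{1..r}\<close>,
  so they move the set counted in \<open>WD\<close> without changing its size.\<close>

lemma WD_comp_cox:
  assumes "w \<in> WB r" "i \<in> {1..<r}"
  shows "w \<circ> cox r i \<in> WD r \<longleftrightarrow> w \<in> WD r"
proof -
  have i: "i \<in> {1..r}" using assms(2) by auto
  have st: "cox r i k \<in> {1..r} \<longleftrightarrow> k \<in> {1..r}" for k
    using assms(2) unfolding cox_less[OF assms(2) refl] by auto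
  have "{k \<in> {1..r}. (w \<circ> cox r i) k > r} = cox r i ` {k \<in> {1..r}. w k > r}"
  proof (intro Set.set_eqI iffI)
    fix k assume "k \<in> {k \<in> {1..r}. (w \<circ> cox r i) k > r}"
    then show "k \<in> cox r i ` {k \<in> {1..r}. w k > r}"
      using st[of k] i by (intro image_eqI[of _ _ "cox r i k"]) auto
  next
    fix k assume "k \<in> cox r i ` {k \<in> {1..r}. w k > r}"
    then obtain l where "k = cox r i l" "l \<in> {1..r}" "w l > r" by blast
    then show "k \<in> {k \<in> {1..r}. (w \<circ> cox r i) k > r}"
      using st[of l] i by simp
  qed
  moreover have "inj_on (cox r i) S" for S
    by (rule inj_on_inverseI[of _ "cox r i"]) (use i in simp)
  ultimately show ?thesis
    using assms i by (simp add: WD_def card_image del: comp_apply)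
qed

text \<open>Among the positions counted only \<open>r\<close> is affected: its value becomes
  \<open>w (r + 1) = 2*r + 1 - w r\<close>, which lies in the other half, so the count changes by
  one.\<close>

lemma WD_comp_cox_last:
  assumes "w \<in> WB r" "1 \<le> r"
  shows "w \<circ> cox r r \<in> WD r \<longleftrightarrow> w \<notin> WD r"
proof -
  define N where "N = {k \<in> {1..<r}. w k > r}"
  have r: "r \<in> {1..2*r}" "2*r + 1 - r = r + 1" "r \<in> {1..r}" using assms(2) by auto
  have m: "w (r + 1) = 2*r + 1 - w r" "w r \<in> {1..2*r}"
    using WB_mirror[OF assms(1) r(1)] WB_range[OF assms(1) r(1)] r(2) by simp_all
  have fin: "finite N" "r \<notin> N" by (simp_all add: N_def)
  have "{k \<in> {1..r}. w k > r} = (if w r > r then insert r N else N)"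
    using assms(2) by (auto simp: N_def le_less)
  moreover have "{k \<in> {1..r}. (w \<circ> cox r r) k > r} = (if w r > r then N else insert r N)"
  proof -
    have "w (r + 1) > r \<longleftrightarrow> \<not> w r > r" using m by auto
    then have "(w \<circ> cox r r) k > r \<longleftrightarrow> (if k = r then \<not> w r > r else w k > r)" if "k \<in> {1..r}" for k
      using that by (simp add: cox_last)
    then have "{k \<in> {1..r}. (w \<circ> cox r r) k > r} =
        {k \<in> {1..r}. if k = r then \<not> w r > r else w k > r}" by blast
    also have "\<dots> = (if w r > r then N else insert r N)"
      using assms(2) by (auto simp: N_def le_less)
    finally show ?thesis .
  qed
  moreover have "w \<circ> cox r r \<in> WB r" using assms(1) r(3) by simp
  ultimately show ?thesis
    using assms(1) fin by (simp add: WD_def del: comp_apply)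
qed

text \<open>Each letter \<open>r\<close> changes the parity and the other letters keep it. Through
  this the group of type D is matched with the subalgebra spanned by even words.\<close>

lemma cox_prod_WD:
  "is \<in> lists {1..r} \<Longrightarrow> cox_prod r is \<in> WD r \<longleftrightarrow> even (count_list is r)"
proof (induction "is" rule: rev_induct)
  case Nil
  have "{i \<in> {1..r}. id i > r} = {}" by auto
  then have "id \<in> WD r"
    unfolding WD_def mem_Collect_eq by (simp only: id_WB card.empty even_zero simp_thms)
  then show ?case by (simp only: cox_prod_simps count_list.simps even_zero)
next
  case (snoc i "is")
  then have "is": "is \<in> lists {1..r}" "i \<in> {1..r}" by auto
  show ?case
  proof (cases "i = r")
    case True
    then show ?thesis
      using WD_comp_cox_last[OF cox_prod_WB[OF "is"(1)]] snoc.IH[OF "is"(1)] "is"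
      by (simp add: comp_assoc del: o_apply)
  next
    case False
    then have "i \<in> {1..<r}" using "is" by auto
    then show ?thesis
      using WD_comp_cox[OF cox_prod_WB[OF "is"(1)]] snoc.IH[OF "is"(1)] False by (simp add: comp_assoc del: o_apply)
  qed
qed

declare One_nat_def [simp del]

lemma cox_prod_rev:
  assumes "is \<in> lists {1..r}" shows "cox_prod r (rev is) = inv_into UNIV (cox_prod r is)"
proof -
  have "cox_prod r (rev is) \<circ> cox_prod r is = id"
    using assms
  proof (induction "is")
    case (Cons i "is")
    then have "cox_prod r (rev (i # is)) \<circ> cox_prod r (i # is) = cox_prod r (rev is) \<circ> (cox r i \<circ> cox r i) \<circ> cox_prod r is"
      by (simp only: rev.simps cox_prod_append cox_prod_simps comp_assoc id_comp comp_id)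
    also have "cox r i \<circ> cox r i = id" using Cons.hyps(1) by (rule cox_comp_cox)
    finally show ?case using Cons by simp
  qed simp
  moreover have "bij (cox_prod r is)"
    by (rule permutes_bij[OF WB_permutes[OF cox_prod_WB[OF assms]]])
  ultimately show ?thesis
    by (metis bij_is_surj comp_assoc comp_id id_comp inv_unique_comp surj_iff)
qed

lemma rev_in_lists [simp]: "rev is \<in> lists S \<longleftrightarrow> is \<in> lists S"
  by (simp add: in_lists_conv_set)

lemma reduced_expr_rev:
  assumes "reduced_expr r w is" shows "reduced_expr r (inv_into UNIV w) (rev is)"
proof -
  have "is": "is \<in> lists {1..r}" "cox_prod r is = w"
    using assms by (auto simp: reduced_expr_def)
  have bij: "bij w" by (rule permutes_bij[OF WB_permutes[OF reduced_expr_WB[OF assms]]])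
  show ?thesis
    unfolding reduced_expr_def
  proof (intro conjI ballI impI)
    fix js assume js: "js \<in> lists {1..r}" "cox_prod r js = inv_into UNIV w"
    then have "cox_prod r (rev js) = w" using cox_prod_rev[OF js(1)] bij by (simp add: inv_inv_eq)
    then show "length (rev is) \<le> length js"
      using assms js(1) unfolding reduced_expr_def by (metis length_rev rev_in_lists)
  qed (use "is" in \<open>simp_all only: rev_in_lists cox_prod_rev\<close>)
qed

text \<open>Descents control the last letter. Passing to the inverse element, whose reduced
  expressions are the reversed ones, turns this into control of the first letter.\<close>

lemma reduced_expr_Cons:
  assumes "w \<in> cox_group r" "i \<in> {1..r}"
  obtains "is" where "reduced_expr r w is" "reduced_expr r (cox r i \<circ> w) (i # is)"
    | "is" where "reduced_expr r (cox r i \<circ> w) is" "reduced_expr r w (i # is)"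
proof -
  obtain js where js: "reduced_expr r w js" using ex_reduced_expr[OF assms(1)] by blast
  have bij: "bij w" by (rule permutes_bij[OF WB_permutes[OF cox_group_WB[OF assms(1)]]])
  have bijc: "bij (cox r i)" by (rule permutes_bij[OF cox_permutes[OF assms(2)]])
  have r: "reduced_expr r (inv_into UNIV w) (rev js)" by (rule reduced_expr_rev[OF js])
  have inv_cox: "inv_into UNIV (cox r i) = cox r i" using assms(2) by (intro inv_unique_comp) simp_all
  have back_inv: "inv_into UNIV (inv_into UNIV w) = w" "inv_into UNIV (inv_into UNIV w \<circ> cox r i) = cox r i \<circ> w"
    using bij bijc by (simp_all add: inv_inv_eq o_inv_distrib bij_imp_bij_inv inv_cox)
  have "inv_into UNIV w i \<noteq> inv_into UNIV w (i + 1)" using WB_inj[OF reduced_expr_WB[OF r]] by simp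
  then consider "inv_into UNIV w i < inv_into UNIV w (i + 1)" | "inv_into UNIV w i > inv_into UNIV w (i + 1)" by linarith
  then show thesis
  proof cases
    case 1
    from reduced_expr_rev[OF reduced_expr_ascent[OF r assms(2) 1]]
    have "reduced_expr r (cox r i \<circ> w) (i # js)"
      by (simp only: back_inv rev_append rev.simps rev_rev_ident append.simps)
    then show thesis using js that(1) by blast
  next
    case 2
    from reduced_expr_descent[OF r assms(2) 2] obtain ks where
      "reduced_expr r (inv_into UNIV w \<circ> cox r i) ks" "reduced_expr r (inv_into UNIV w) (ks @ [i])" by blast
    from this[THEN reduced_expr_rev] show thesis
      using that(2)[of "rev ks"] by (simp only: back_inv rev_append rev.simps append.simps)
  qed
qed

section \<open>The Hecke algebra of type B and its elements \<open>Tw\<close>\<close>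

section \<open>The Hecke algebra of type B\<close>

lemma free_algebra_monoid: "monoid \<lparr>carrier = lists Y, monoid.mult = (@), one = []\<rparr>"
  by (rule monoidI) auto

interpretation free_algebra: monoid_algebra_of "\<lparr>carrier = lists Y, monoid.mult = (@), one = []\<rparr>" "free_algebra Y" for Y
  by (simp_all add: monoid_algebra_of_def free_algebra_monoid free_algebra_def)

lemma free_algebra_simps:
  "carrier (free_algebra Y) = {f. Poly_Mapping.keys f \<subseteq> lists Y}"
  "one (free_algebra Y) = Poly_Mapping.single [] 1"
  "ring.zero (free_algebra Y) = 0"
  "ring.add (free_algebra Y) = (+)"
  by (simp_all add: free_algebra_def monoid_algebra_def)

locale hecke_B =
  fixes r :: nat
  assumes rank: "2 \<le> r"
begin

abbreviation F :: "(int poly, nat list \<Rightarrow>\<^sub>0 int poly) module" where "F \<equiv> free_algebra {1..r}"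
abbreviation H :: "(int poly, (nat list \<Rightarrow>\<^sub>0 int poly) set) module" where "H \<equiv> HB r"
abbreviation T :: "nat \<Rightarrow> (nat list \<Rightarrow>\<^sub>0 int poly) set" where "T \<equiv> Tgen r"
abbreviation cls :: "(nat list \<Rightarrow>\<^sub>0 int poly) \<Rightarrow> (nat list \<Rightarrow>\<^sub>0 int poly) set" where
  "cls f \<equiv> hecke_ideal r +>\<^bsub>F\<^esub> f"

definition T_word :: "nat list \<Rightarrow> (nat list \<Rightarrow>\<^sub>0 int poly) set" where
  "T_word is = foldr (\<lambda>i h. T i \<otimes>\<^bsub>H\<^esub> h) is \<one>\<^bsub>H\<^esub>"

sublocale F: assoc_algebra F
  by (rule free_algebra.assoc_algebra_monoid_algebra)

lemma F_minus: "f \<in> carrier F \<Longrightarrow> \<ominus>\<^bsub>F\<^esub> f = - f"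
  by (rule free_algebra.monoid_algebra_minus)

lemma single_carrier: "is \<in> lists {1..r} \<Longrightarrow> Poly_Mapping.single is a \<in> carrier F"
  by (simp add: free_algebra_simps)

lemma diff_carrier: "f \<in> carrier F \<Longrightarrow> g \<in> carrier F \<Longrightarrow> f - g \<in> carrier F"
  by (rule free_algebra.monoid_algebra_diff)

lemma hecke_rels_carrier: "hecke_rels r \<subseteq> carrier F"
  unfolding hecke_rels_def Let_def using rank
  by (auto intro!: diff_carrier single_carrier)

lemma ideal_hecke: "ideal (hecke_ideal r) F"
  unfolding hecke_ideal_def by (rule F.genideal_ideal[OF hecke_rels_carrier])

lemma hecke_rels_ideal: "hecke_rels r \<subseteq> hecke_ideal r"
  unfolding hecke_ideal_def by (rule F.genideal_self[OF hecke_rels_carrier])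

sublocale H: assoc_algebra H
  unfolding HB_def by (rule F.quotient_assoc_algebra[OF ideal_hecke])

lemma cls_closed [simp, intro]: "f \<in> carrier F \<Longrightarrow> cls f \<in> carrier H"
  using F.quotient_algebra_hom(2)[OF ideal_hecke] unfolding HB_def by blast

lemma cls_surj: "h \<in> carrier H \<Longrightarrow> \<exists>f\<in>carrier F. h = cls f"
  using F.quotient_algebra_hom(2)[OF ideal_hecke] unfolding HB_def by blast

lemma cls_mult: "f \<in> carrier F \<Longrightarrow> g \<in> carrier F \<Longrightarrow> cls (f \<otimes>\<^bsub>F\<^esub> g) = cls f \<otimes>\<^bsub>H\<^esub> cls g"
  using ring_hom_mult[OF F.quotient_algebra_hom(1)[OF ideal_hecke]] unfolding HB_def by blast

lemma cls_add: "f \<in> carrier F \<Longrightarrow> g \<in> carrier F \<Longrightarrow> cls (f + g) = cls f \<oplus>\<^bsub>H\<^esub> cls g"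
  using ring_hom_add[OF F.quotient_algebra_hom(1)[OF ideal_hecke], of f g]
  unfolding HB_def free_algebra_simps by blast

lemma cls_one: "cls (Poly_Mapping.single [] 1) = \<one>\<^bsub>H\<^esub>"
  using ring_hom_one[OF F.quotient_algebra_hom(1)[OF ideal_hecke]]
  unfolding HB_def free_algebra_simps .

lemma cls_smult: "f \<in> carrier F \<Longrightarrow> cls (a \<odot>\<^bsub>F\<^esub> f) = a \<odot>\<^bsub>H\<^esub> cls f"
  using F.quotient_algebra_hom(3)[OF ideal_hecke] unfolding HB_def by blast

lemma cls_eq_zero: "f \<in> carrier F \<Longrightarrow> cls f = \<zero>\<^bsub>H\<^esub> \<longleftrightarrow> f \<in> hecke_ideal r"
  using F.quotient_algebra_hom(4)[OF ideal_hecke] unfolding HB_def by blast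

lemma cls_eq: 
  assumes "f \<in> carrier F" "g \<in> carrier F" "f - g \<in> hecke_ideal r" shows "cls f = cls g"
proof -
  have "cls f = cls ((f - g) + g)" by simp
  also have "\<dots> = cls (f - g) \<oplus>\<^bsub>H\<^esub> cls g" using assms by (intro cls_add diff_carrier)
  also have "cls (f - g) = \<zero>\<^bsub>H\<^esub>" using assms by (simp add: cls_eq_zero diff_carrier)
  finally show ?thesis using assms by simp
qed

lemma T_closed [simp, intro]: "i \<in> {1..r} \<Longrightarrow> T i \<in> carrier H"
  unfolding Tgen_def by (intro cls_closed single_carrier) auto

lemma T_word_cls: "is \<in> lists {1..r} \<Longrightarrow> T_word is = cls (Poly_Mapping.single is 1)"
proof (induction "is")
  case Nil then show ?case by (simp add: T_word_def cls_one)
next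
  case (Cons i "is")
  then have i: "[i] \<in> lists {1..r}" "is \<in> lists {1..r}" by auto
  have "T_word (i # is) = T i \<otimes>\<^bsub>H\<^esub> T_word is" by (simp add: T_word_def)
  also have "\<dots> = cls (Poly_Mapping.single [i] 1) \<otimes>\<^bsub>H\<^esub> cls (Poly_Mapping.single is 1)"
    using Cons.IH[OF i(2)] by (simp add: Tgen_def)
  also have "\<dots> = cls (Poly_Mapping.single [i] 1 \<otimes>\<^bsub>F\<^esub> Poly_Mapping.single is 1)"
    by (rule cls_mult[symmetric]; intro single_carrier i)
  finally show ?case by (simp add: free_algebra.monoid_algebra_mult_single)
qed

lemma cls_single: "is \<in> lists {1..r} \<Longrightarrow> cls (Poly_Mapping.single is a) = a \<odot>\<^bsub>H\<^esub> T_word is"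
  using cls_smult[of "Poly_Mapping.single is 1" a]
  by (simp add: T_word_cls single_carrier free_algebra.monoid_algebra_smult_single)

lemma T_word_closed [simp, intro]: "is \<in> lists {1..r} \<Longrightarrow> T_word is \<in> carrier H"
  unfolding T_word_cls by (intro cls_closed single_carrier)

lemma T_word_Nil [simp]: "T_word [] = \<one>\<^bsub>H\<^esub>"
  by (simp add: T_word_def)

lemma T_word_Cons: "T_word (i # is) = T i \<otimes>\<^bsub>H\<^esub> T_word is"
  by (simp add: T_word_def)

lemma T_word_append:
  "is \<in> lists {1..r} \<Longrightarrow> js \<in> lists {1..r} \<Longrightarrow> T_word (is @ js) = T_word is \<otimes>\<^bsub>H\<^esub> T_word js"
proof (induction "is")
  case Nil then show ?case using T_word_closed[of js] by simp
next
  case (Cons i "is")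
  then have "T i \<in> carrier H" "T_word is \<in> carrier H" "T_word js \<in> carrier H" by (auto simp del: T_closed)
  then show ?case using Cons by (simp add: T_word_Cons H.m_assoc)
qed

lemma T_word_singleton: "i \<in> {1..r} \<Longrightarrow> T_word [i] = T i"
  by (simp add: T_word_Cons del: atLeastAtMost_iff)

lemma T_word_snoc: "is \<in> lists {1..r} \<Longrightarrow> i \<in> {1..r} \<Longrightarrow> T_word (is @ [i]) = T_word is \<otimes>\<^bsub>H\<^esub> T i"
  using T_word_append[of "is" "[i]"] T_word_singleton[of i] by simp

lemma T_word_eqI:
  "is \<in> lists {1..r} \<Longrightarrow> js \<in> lists {1..r} \<Longrightarrow>
    Poly_Mapping.single is 1 - Poly_Mapping.single js 1 \<in> hecke_rels r \<Longrightarrow> T_word is = T_word js"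
  unfolding T_word_cls using hecke_rels_ideal by (intro cls_eq single_carrier) auto

lemma T_commute:
  assumes "i \<in> {1..r}" "j \<in> {1..r}" "i + 2 \<le> j"
  shows "T_word [i, j] = T_word [j, i]"
proof (rule T_word_eqI)
  show "Poly_Mapping.single [i, j] 1 - Poly_Mapping.single [j, i] 1 \<in> hecke_rels r"
    unfolding hecke_rels_def Let_def using assms by (intro UnI1) force
qed (use assms in auto)

lemma T_braid_A:
  assumes "1 \<le> j" "j + 1 < r"
  shows "T_word [j, j + 1, j] = T_word [j + 1, j, j + 1]"
proof (rule T_word_eqI)
  show "Poly_Mapping.single [j, j + 1, j] 1 - Poly_Mapping.single [j + 1, j, j + 1] 1 \<in> hecke_rels r"
    unfolding hecke_rels_def Let_def using assms by (rule_tac UnI1, rule_tac UnI1, rule_tac UnI1, rule_tac UnI2) force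
qed (use assms in auto)

lemma T_braid_B: "T_word [r - 1, r, r - 1, r] = T_word [r, r - 1, r, r - 1]"
proof (rule T_word_eqI)
  show "Poly_Mapping.single [r - 1, r, r - 1, r] 1 - Poly_Mapping.single [r, r - 1, r, r - 1] 1 \<in> hecke_rels r"
    unfolding hecke_rels_def Let_def by blast
qed (use rank in auto)

lemma T_last_square: "T r \<otimes>\<^bsub>H\<^esub> T r = \<one>\<^bsub>H\<^esub>"
proof -
  have "T_word [r, r] = T_word []"
  proof (rule T_word_eqI)
    show "Poly_Mapping.single [r, r] 1 - Poly_Mapping.single [] 1 \<in> hecke_rels r"
      unfolding hecke_rels_def Let_def by blast
  qed (use rank in auto)
  then show ?thesis using rank T_word_singleton[of r] by (simp add: T_word_Cons)
qed

lemma T_square: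
  assumes "i \<in> {1..<r}"
  shows "T i \<otimes>\<^bsub>H\<^esub> T i = (qq - 1) \<odot>\<^bsub>H\<^esub> T i \<oplus>\<^bsub>H\<^esub> qq \<odot>\<^bsub>H\<^esub> \<one>\<^bsub>H\<^esub>"
proof -
  have i: "[i] \<in> lists {1..r}" "[i, i] \<in> lists {1..r}" "[] \<in> lists {1..r}" using assms by auto
  have "Poly_Mapping.single [i, i] 1 - (Poly_Mapping.single [i] (qq - 1) + Poly_Mapping.single [] qq) \<in> hecke_rels r"
    unfolding hecke_rels_def Let_def diff_diff_eq using assms by (rule_tac UnI1, rule_tac UnI2) force
  then have "cls (Poly_Mapping.single [i, i] 1) = cls (Poly_Mapping.single [i] (qq - 1) + Poly_Mapping.single [] qq)"
    using hecke_rels_ideal i single_carrier[OF i(1)] single_carrier[OF i(3)] F.add.m_closed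
    by (intro cls_eq single_carrier) (auto simp: free_algebra_simps(4))
  also have "\<dots> = (qq - 1) \<odot>\<^bsub>H\<^esub> T_word [i] \<oplus>\<^bsub>H\<^esub> qq \<odot>\<^bsub>H\<^esub> T_word []"
    using i by (simp add: cls_add single_carrier cls_single)
  finally have "T_word [i, i] = \<dots>" using i(2) by (simp add: T_word_cls)
  then show ?thesis using assms T_word_singleton[of i] by (simp add: T_word_Cons)
qed

text \<open>Matsumoto's theorem for \<open>P = T_word\<close>: the braid relations between the
  \<open>T i\<close> are relations of the algebra.\<close>

lemma Tw_eq_T_word:
  assumes "reduced_expr r w is" shows "Tw r w = T_word is"
proof -
  have some: "reduced_expr r w (SOME is. reduced_expr r w is)" using assms by (rule someI)
  have "T_word (SOME is. reduced_expr r w is) = T_word is"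
  proof (rule matsumoto[OF _ _ _ _ some assms], goal_cases)
    case (1 js js' i) then show ?case by (simp add: T_word_snoc)
  next
    case (2 v i j) then show ?case
      using T_word_append[of v "[i, j]"] T_word_append[of v "[j, i]"] T_commute[of i j] by simp
  next
    case (3 v i) then show ?case
      using T_word_append[of v "[i, i + 1, i]"] T_word_append[of v "[i + 1, i, i + 1]"] T_braid_A[of i] by simp
  next
    case (4 v)
    then have "[r - 1, r, r - 1, r] \<in> lists {1..r}" "[r, r - 1, r, r - 1] \<in> lists {1..r}" by auto
    then show ?case
      using T_word_append[OF 4(1)] T_braid_B by metis
  qed
  then show ?thesis by (simp add: Tw_def T_word_def)
qed

lemma Tw_closed [simp, intro]: "w \<in> cox_group r \<Longrightarrow> Tw r w \<in> carrier H"
  using ex_reduced_expr[of w r] Tw_eq_T_word[of w] unfolding reduced_expr_def by (metis T_word_closed)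

lemma Tw_id: "Tw r id = \<one>\<^bsub>H\<^esub>"
proof -
  have "reduced_expr r id []" by (simp add: reduced_expr_def)
  then show ?thesis using Tw_eq_T_word by fastforce
qed

lemma Tw_ascent:
  assumes "w \<in> cox_group r" "i \<in> {1..r}" "w i < w (i + 1)"
  shows "Tw r w \<otimes>\<^bsub>H\<^esub> T i = Tw r (w \<circ> cox r i)"
proof -
  obtain "is" where "is": "reduced_expr r w is" using ex_reduced_expr[OF assms(1)] by blast
  then have "is \<in> lists {1..r}" by (simp add: reduced_expr_def)
  then show ?thesis
    using Tw_eq_T_word[OF "is"] Tw_eq_T_word[OF reduced_expr_ascent[OF "is" assms(2,3)]] T_word_snoc assms(2) by simp
qed

lemma Tw_descent_eq:
  assumes "w \<in> cox_group r" "i \<in> {1..r}" "w i > w (i + 1)"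
  shows "Tw r w = Tw r (w \<circ> cox r i) \<otimes>\<^bsub>H\<^esub> T i"
  using Tw_ascent[of "w \<circ> cox r i" i] assms by simp

lemma Tw_descent:
  assumes "w \<in> cox_group r" "i \<in> {1..<r}" "w i > w (i + 1)"
  shows "Tw r w \<otimes>\<^bsub>H\<^esub> T i = (qq - 1) \<odot>\<^bsub>H\<^esub> Tw r w \<oplus>\<^bsub>H\<^esub> qq \<odot>\<^bsub>H\<^esub> Tw r (w \<circ> cox r i)"
proof -
  have i: "i \<in> {1..r}" using assms(2) by auto
  let ?u = "Tw r (w \<circ> cox r i)"
  have c: "?u \<in> carrier H" "T i \<in> carrier H" "Tw r w \<in> carrier H" using assms(1) i by auto
  have e: "Tw r w = ?u \<otimes>\<^bsub>H\<^esub> T i" by (rule Tw_descent_eq[OF assms(1) i assms(3)])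
  have "Tw r w \<otimes>\<^bsub>H\<^esub> T i = ?u \<otimes>\<^bsub>H\<^esub> (T i \<otimes>\<^bsub>H\<^esub> T i)"
    unfolding e using c by (simp add: H.m_assoc)
  also have "\<dots> = (qq - 1) \<odot>\<^bsub>H\<^esub> Tw r w \<oplus>\<^bsub>H\<^esub> qq \<odot>\<^bsub>H\<^esub> ?u"
    unfolding T_square[OF assms(2)] e using c by (simp add: H.r_distr H.smult_mult_right)
  finally show ?thesis .
qed

lemma last_gen: "r \<in> {1..r}" using rank by simp

text \<open>As \<open>T\<^sub>r\<close> squares to one, the formula for ascents holds for descents
  too. The parameter 1 is what makes multiplication by \<open>T\<^sub>r\<close> permute the elements
  \<open>Tw\<close>.\<close>

lemma Tw_mult_last:
  assumes "w \<in> cox_group r"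
  shows "Tw r w \<otimes>\<^bsub>H\<^esub> T r = Tw r (w \<circ> cox r r)"
proof -
  have "w r \<noteq> w (r + 1)" using WB_inj[OF cox_group_WB[OF assms]] by simp
  then consider "w r < w (r + 1)" | "w r > w (r + 1)" by linarith
  then show ?thesis
  proof cases
    case 1 then show ?thesis by (rule Tw_ascent[OF assms last_gen])
  next
    case 2
    have "Tw r (w \<circ> cox r r) \<in> carrier H" using assms last_gen by (intro Tw_closed) simp
    then show ?thesis
      unfolding Tw_descent_eq[OF assms last_gen 2] using last_gen T_last_square by (simp add: H.m_assoc)
  qed
qed

lemma last_mult_Tw:
  assumes "w \<in> cox_group r"
  shows "T r \<otimes>\<^bsub>H\<^esub> Tw r w = Tw r (cox r r \<circ> w)"
  using assms last_gen
proof (cases rule: reduced_expr_Cons)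
  case (1 "is")
  then show ?thesis by (simp add: Tw_eq_T_word[OF 1(1)] Tw_eq_T_word[OF 1(2)] T_word_Cons)
next
  case (2 "is")
  then have "T_word is \<in> carrier H" by (auto simp: reduced_expr_def)
  then show ?thesis using last_gen
    by (simp add: Tw_eq_T_word[OF 2(1)] Tw_eq_T_word[OF 2(2)] T_word_Cons T_last_square flip: H.m_assoc)
qed

end

section \<open>A faithful model of the Hecke algebra: coordinates and the right regular
  action\<close>

context hecke_B
begin

text \<open>The right regular action of \<open>H\<close> in coordinates: a function \<open>v\<close> stands for \<open>\<Sum>w. v w T\<^sub>w\<close>.\<close>

definition act_gen :: "nat \<Rightarrow> ((nat \<Rightarrow> nat) \<Rightarrow> int poly) \<Rightarrow> (nat \<Rightarrow> nat) \<Rightarrow> int poly" where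
  "act_gen i v w =
     (if w \<notin> cox_group r then 0
      else if i = r then v (w \<circ> cox r r)
      else if w i < w (i + 1) then qq * v (w \<circ> cox r i)
      else v (w \<circ> cox r i) + (qq - 1) * v w)"

definition act_word :: "nat list \<Rightarrow> ((nat \<Rightarrow> nat) \<Rightarrow> int poly) \<Rightarrow> (nat \<Rightarrow> nat) \<Rightarrow> int poly" where
  "act_word is v = fold act_gen is v"

definition act :: "(nat list \<Rightarrow>\<^sub>0 int poly) \<Rightarrow> ((nat \<Rightarrow> nat) \<Rightarrow> int poly) \<Rightarrow> (nat \<Rightarrow> nat) \<Rightarrow> int poly" where
  "act f v w = (\<Sum>is\<in>Poly_Mapping.keys f. Poly_Mapping.lookup f is * act_word is v w)"

text \<open>\<open>act_gen\<close> cuts functions off outside the group, so the quadratic relations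
  can hold only for functions that vanish there.\<close>

definition supported :: "((nat \<Rightarrow> nat) \<Rightarrow> int poly) \<Rightarrow> bool" where
  "supported v \<longleftrightarrow> (\<forall>w. w \<notin> cox_group r \<longrightarrow> v w = 0)"

lemma act_word_Nil [simp]: "act_word [] v = v"
  by (simp add: act_word_def)

lemma act_word_Cons [simp]: "act_word (i # is) v = act_word is (act_gen i v)"
  by (simp add: act_word_def)

lemma act_word_append: "act_word (is @ js) v = act_word js (act_word is v)"
  by (simp add: act_word_def)

lemma act_gen_outside: "w \<notin> cox_group r \<Longrightarrow> act_gen i v w = 0"
  by (simp add: act_gen_def)

lemma act_gen_less:
  "i \<in> {1..<r} \<Longrightarrow> w \<in> cox_group r \<Longrightarrow>
     act_gen i v w = (if w i < w (i + 1) then qq * v (w \<circ> cox r i) else v (w \<circ> cox r i) + (qq - 1) * v w)"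
  by (simp add: act_gen_def)

lemma act_gen_last: "w \<in> cox_group r \<Longrightarrow> act_gen r v w = v (w \<circ> cox r r)"
  by (simp add: act_gen_def)

lemma act_gen_add: "act_gen i (\<lambda>w. v w + u w) = (\<lambda>w. act_gen i v w + act_gen i u w)"
  by (auto simp: act_gen_def fun_eq_iff distrib_left)

lemma act_gen_scale: "act_gen i (\<lambda>w. a * v w) = (\<lambda>w. a * act_gen i v w)"
  by (auto simp: act_gen_def fun_eq_iff distrib_left mult.left_commute)

lemma act_word_add: "act_word is (\<lambda>w. v w + u w) = (\<lambda>w. act_word is v w + act_word is u w)"
  by (induction "is" arbitrary: v u) (simp_all add: act_gen_add)

lemma act_word_scale: "act_word is (\<lambda>w. a * v w) = (\<lambda>w. a * act_word is v w)"
  by (induction "is" arbitrary: v) (simp_all add: act_gen_scale)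

lemma act_arg_add: "act f (\<lambda>w. v w + u w) = (\<lambda>w. act f v w + act f u w)"
  by (simp add: act_def fun_eq_iff act_word_add distrib_left sum.distrib)

lemma act_arg_scale: "act f (\<lambda>w. a * v w) = (\<lambda>w. a * act f v w)"
  by (simp add: act_def fun_eq_iff act_word_scale sum_distrib_left mult.left_commute)

lemma act_superset:
  "finite S \<Longrightarrow> Poly_Mapping.keys f \<subseteq> S \<Longrightarrow> act f v w = (\<Sum>is\<in>S. Poly_Mapping.lookup f is * act_word is v w)"
  unfolding act_def by (rule sum.mono_neutral_left) (auto simp: in_keys_iff simp del: lookup_not_eq_zero_eq_in_keys)

lemma act_add: "act (f + g) v = (\<lambda>w. act f v w + act g v w)"
proof
  fix w
  let ?S = "Poly_Mapping.keys f \<union> Poly_Mapping.keys g"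
  show "act (f + g) v w = act f v w + act g v w"
    by (subst (1 2 3) act_superset[of ?S]) (simp_all add: keys_add lookup_add distrib_right sum.distrib)
qed

lemma act_single: "act (Poly_Mapping.single is a) v = (\<lambda>w. a * act_word is v w)"
  by (rule ext, subst act_superset[of "{is}"]) auto

lemma act_zero: "act 0 v = (\<lambda>w. 0)"
  by (simp add: act_def fun_eq_iff)

lemma act_uminus: "act (- f) v = (\<lambda>w. - act f v w)"
proof
  fix w
  have "act (f + - f) v w = 0" by (simp add: act_zero)
  then have "act f v w + act (- f) v w = 0" by (simp only: act_add)
  then show "act (- f) v w = - act f v w" by (simp add: eq_neg_iff_add_eq_0 add.commute)
qed

lemma act_diff: "act (f - g) v = (\<lambda>w. act f v w - act g v w)"
  using act_add[of f "- g" v] by (simp add: act_uminus)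

text \<open>This is a right action: the left factor acts first, as in the \<open>fold\<close> over a
  word.\<close>

lemma act_mult:
  assumes "f \<in> carrier F" "g \<in> carrier F"
  shows "act (f \<otimes>\<^bsub>F\<^esub> g) v = act g (act f v)"
  using assms(1)
proof (induction f rule: free_algebra.monoid_algebra_induct)
  case (single "is" a)
  show ?case
    using assms(2)
  proof (induction g rule: free_algebra.monoid_algebra_induct)
    case (single js b)
    show ?case
      by (simp add: free_algebra.monoid_algebra_mult_single act_single act_word_append act_word_scale mult_ac)
  next
    case (add g h)
    then show ?case by (simp add: free_algebra.monoid_algebra_r_distr act_add)
  qed
next
  case (add f h)
  then show ?case by (simp add: free_algebra.monoid_algebra_l_distr act_add act_arg_add)
qed

lemma supported_act_gen: "supported (act_gen i v)"
  by (simp add: supported_def act_gen_outside)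

lemma supported_act_word: "supported v \<Longrightarrow> supported (act_word is v)"
  by (induction "is" arbitrary: v) (simp_all add: supported_act_gen)

lemma supported_act: "supported v \<Longrightarrow> supported (act f v)"
  using supported_act_word[of v] unfolding supported_def act_def by (auto intro!: sum.neutral)

lemma comp_cox_group: "i \<in> {1..r} \<Longrightarrow> w \<in> cox_group r \<Longrightarrow> w \<circ> cox r i \<in> cox_group r"
  by simp

text \<open>Composing with one of the two generators leaves the values compared by the other
  unchanged, so the two case distinctions are independent of each other.\<close>

lemma act_commute:
  assumes "i \<in> {1..r}" "j \<in> {1..r}" "i + 2 \<le> j"
  shows "act_word [i, j] v = act_word [j, i] v"
proof
  fix w
  have i: "i \<in> {1..<r}" using assms by auto
  show "act_word [i, j] v w = act_word [j, i] v w"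
  proof (cases "w \<in> cox_group r")
    case True
    define u1 u2 where "u1 = w \<circ> cox r i" and "u2 = w \<circ> cox r j"
    have G: "u1 \<in> cox_group r" "u2 \<in> cox_group r" unfolding u1_def u2_def using True assms by (auto intro: comp_cox_group)
    have u12: "u2 \<circ> cox r i = u1 \<circ> cox r j"
      unfolding u1_def u2_def comp_assoc cox_braid_commute[OF assms] ..
    have c: "cox r i j = j" "cox r i (j + 1) = j + 1"
      using i assms by (auto simp: cox_less[OF _ refl])
    have "cox r j i = i" "cox r j (i + 1) = i + 1"
      using i assms by (cases "j = r"; auto simp: cox_less[OF _ refl] cox_last)+
    then have val: "u1 j = w j" "u1 (j + 1) = w (j + 1)" "u2 i = w i" "u2 (i + 1) = w (i + 1)"
      by (simp_all add: u1_def u2_def c)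
    note gi = act_gen_less[OF i] and defs = u1_def[symmetric] u2_def[symmetric]
    show ?thesis
    proof (cases "j = r")
      case r: True
      show ?thesis
        unfolding act_word_Cons act_word_Nil r
        unfolding act_gen_last[OF True] gi[OF True] act_gen_last[OF G(1)] act_gen_last[OF True]
          defs defs[unfolded r] gi[OF G(2)] act_gen_last[OF G(1)] val u12[unfolded r] ..
    next
      case False
      then have j: "j \<in> {1..<r}" using assms by auto
      note gj = act_gen_less[OF j]
      show ?thesis
        unfolding act_word_Cons act_word_Nil gi[OF True] gj[OF True] defs
          gi[OF G(2)] gj[OF G(1)] gi[OF True] gj[OF True] val u12 defs
        by (simp add: algebra_simps)
    qed
  qed (simp add: act_gen_outside)
qed

lemma act_braid_A:
  assumes "1 \<le> i" "i + 1 < r"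
  shows "act_word [i, i + 1, i] v = act_word [i + 1, i, i + 1] v"
proof
  fix w
  have i: "i \<in> {1..<r}" "i + 1 \<in> {1..<r}" "i \<in> {1..r}" "i + 1 \<in> {1..r}" using assms by auto
  show "act_word [i, i + 1, i] v w = act_word [i + 1, i, i + 1] v w"
  proof (cases "w \<in> cox_group r")
    case True
    define u1 where "u1 = w \<circ> cox r i"
    define u2 where "u2 = w \<circ> cox r (i + 1)"
    define u12 where "u12 = u1 \<circ> cox r (i + 1)"
    define u21 where "u21 = u2 \<circ> cox r i"
    define u121 where "u121 = u12 \<circ> cox r i"
    have G: "u1 \<in> cox_group r" "u2 \<in> cox_group r" "u12 \<in> cox_group r" "u21 \<in> cox_group r"
      unfolding u1_def u2_def u12_def u21_def using True i by (auto intro!: comp_cox_group)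
    have e: "w \<circ> cox r i = u1" "w \<circ> cox r (i + 1) = u2" "u1 \<circ> cox r (i + 1) = u12" "u2 \<circ> cox r i = u21"
      "u12 \<circ> cox r i = u121" "u1 \<circ> cox r i = w" "u2 \<circ> cox r (i + 1) = w" "u12 \<circ> cox r (i + 1) = u1" "u21 \<circ> cox r i = u2"
      unfolding u121_def u12_def u21_def u1_def u2_def using i by (simp_all only: comp_cox_cox)
    have e': "u21 \<circ> cox r (i + 1) = u121"
      unfolding u121_def u12_def u21_def u1_def u2_def comp_assoc cox_braid_A[OF assms] ..
    have c: "cox r i (i + 2) = i + 2" "cox r i i = i + 1" "cox r i (i + 1) = i"
       "cox r (i + 1) i = i" "cox r (i + 1) (i + 1) = i + 2" "cox r (i + 1) (i + 2) = i + 1"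
      using assms by (auto simp: cox_less[OF _ refl])
    \<comment> \<open>All coefficients depend only on the relative order of these three values; by
      \<open>ne\<close> they are distinct, and the final case distinction runs through the
      orders.\<close>
    define a b d where "a = w i" and "b = w (i + 1)" and "d = w (i + 2)"
    have val: "w i = a" "w (i + 1) = b" "w (i + 2) = d" "u1 i = b" "u1 (i + 1) = a" "u1 (i + 2) = d"
      "u2 i = a" "u2 (i + 1) = d" "u2 (i + 2) = b" "u12 i = b" "u12 (i + 1) = d" "u12 (i + 2) = a"
      "u21 i = d" "u21 (i + 1) = a" "u21 (i + 2) = b"
      unfolding u12_def u21_def u1_def u2_def a_def b_def d_def comp_apply c by (rule refl)+
    have ne: "a \<noteq> b" "b \<noteq> d" "a \<noteq> d"
      unfolding a_def b_def d_def using WB_inj[OF cox_group_WB[OF True]] by simp_all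
    have two: "i + 1 + 1 = i + 2" by simp
    define j k where "j = i + 1" and "k = i + 2"
    note jk = j_def[symmetric] k_def[symmetric]
    note g = act_gen_less[OF i(1), unfolded jk] act_gen_less[OF i(2), unfolded two, unfolded jk]
    note e = e[unfolded jk] and e' = e'[unfolded jk] and val = val[unfolded jk]
    show ?thesis
      unfolding act_word_Cons act_word_Nil jk
      using ne by (cases "a < b"; cases "b < d"; cases "a < d")
        (simp_all add: g True G e e' val algebra_simps del: comp_cox_cox o_apply)
  qed (simp add: act_gen_outside)
qed

lemma act_braid_B: "act_word [r - 1, r, r - 1, r] v = act_word [r, r - 1, r, r - 1] v"
proof
  fix w
  define l where "l = r - 1"
  have l: "l \<in> {1..<r}" "l \<in> {1..r}" "r \<in> {1..r}" "l + 1 = r" using rank by (auto simp: l_def)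
  show "act_word [r - 1, r, r - 1, r] v w = act_word [r, r - 1, r, r - 1] v w"
    unfolding l_def[symmetric]
  proof (cases "w \<in> cox_group r")
    case True
    define s t where "s = cox r l" and "t = cox r r"
    have G: "u \<circ> s \<in> cox_group r" "u \<circ> t \<in> cox_group r" if "u \<in> cox_group r" for u
      unfolding s_def t_def using that l by (auto intro!: comp_cox_group)
    have c: "s l = l + 1" "s (l + 1) = l" "s (l + 2) = l + 3" "s (l + 3) = l + 2"
      "t l = l" "t (l + 1) = l + 2" "t (l + 2) = l + 1" "t (l + 3) = l + 3"
      unfolding s_def t_def using l rank by (auto simp: cox_less[OF _ refl] cox_last)
    have wB: "w \<in> WB r" by (rule cox_group_WB[OF True])
    have m: "w (l + 2) = 2*r + 1 - w (l + 1)" "w (l + 3) = 2*r + 1 - w l"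
      "w l \<in> {1..2*r}" "w (l + 1) \<in> {1..2*r}"
    proof -
      have e: "2*r + 1 - l = l + 3" "2*r + 1 - (l + 1) = l + 2" "l \<in> {1..2*r}" "l + 1 \<in> {1..2*r}"
        using l by auto
      show "w (l + 2) = 2*r + 1 - w (l + 1)" "w (l + 3) = 2*r + 1 - w l"
      "w l \<in> {1..2*r}" "w (l + 1) \<in> {1..2*r}"
        using WB_mirror[OF wB e(3)] WB_mirror[OF wB e(4)] WB_range[OF wB e(3)] WB_range[OF wB e(4)]
        unfolding e by blast+
    qed
    \<comment> \<open>The two sides of the relation compare four pairs among the values at
      \<open>l\<close>, \<open>l + 1\<close>, \<open>l + 2\<close>, \<open>l + 3\<close>; the mirror
      symmetry identifies these comparisons two by two.\<close>
    have lt: "w (l + 2) < w (l + 3) \<longleftrightarrow> w l < w (l + 1)" "w (l + 1) < w (l + 3) \<longleftrightarrow> w l < w (l + 2)"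
      using m by auto
    have gs: "act_gen l x u = (if u l < u (l + 1) then qq * x (u \<circ> s) else x (u \<circ> s) + (qq - 1) * x u)"
      and gt: "act_gen r x u = x (u \<circ> t)" if "u \<in> cox_group r" for u x
      using act_gen_less[OF l(1) that] act_gen_last[OF that] unfolding s_def t_def by auto
    have tt: "t \<circ> t = id" "\<And>u. u \<circ> t \<circ> t = u" unfolding t_def using l by (auto simp: comp_assoc simp del: o_apply)
    have braid: "w \<circ> t \<circ> s \<circ> t \<circ> s = w \<circ> s \<circ> t \<circ> s \<circ> t"
      using cox_braid_B[OF rank] unfolding s_def t_def l_def[symmetric] comp_assoc by simp
    show "act_word [l, r, l, r] v w = act_word [r, l, r, l] v w"
      unfolding act_word_Cons act_word_Nil
      by (simp only: gs gt True G tt comp_apply c lt braid)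
        (simp add: algebra_simps)
  qed (simp add: act_gen_outside)
qed

lemma act_square:
  assumes "i \<in> {1..<r}" "supported v"
  shows "act_word [i, i] v = (\<lambda>w. (qq - 1) * act_word [i] v w + qq * v w)"
proof
  fix w
  have i: "i \<in> {1..r}" using assms(1) by auto
  show "act_word [i, i] v w = (qq - 1) * act_word [i] v w + qq * v w"
  proof (cases "w \<in> cox_group r")
    case True
    have u: "w \<circ> cox r i \<in> cox_group r" using True i by simp
    have "w i \<noteq> w (i + 1)" using WB_inj[OF cox_group_WB[OF True]] by simp
    then show ?thesis
      using i by (simp add: act_gen_less[OF assms(1) True] act_gen_less[OF assms(1) u] ring_distribs)
  qed (use assms(2) in \<open>simp add: act_gen_outside supported_def\<close>)
qed

lemma act_last_square: "supported v \<Longrightarrow> act_word [r, r] v = v"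
  using last_gen by (auto simp: fun_eq_iff act_gen_def supported_def)

lemma hecke_rels_act:
  assumes "f \<in> hecke_rels r" "supported v"
  shows "act f v = (\<lambda>w. 0)"
proof -
  have eq: "act (Poly_Mapping.single is 1 - Poly_Mapping.single js 1) v = (\<lambda>w. 0)"
    if "act_word is v = act_word js v" for "is" js
    using that by (simp add: act_diff act_single)
  from assms(1) consider
    (a) i j where "f = Poly_Mapping.single [i, j] 1 - Poly_Mapping.single [j, i] 1"
        "i \<in> {1..r}" "j \<in> {1..r}" "\<bar>int i - int j\<bar> \<ge> 2"
    | (b) j where "f = Poly_Mapping.single [j, j+1, j] 1 - Poly_Mapping.single [j+1, j, j+1] 1" "1 \<le> j" "j < r - 1"
    | (c) "f = Poly_Mapping.single [r-1, r, r-1, r] 1 - Poly_Mapping.single [r, r-1, r, r-1] 1"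
    | (d) i where "f = Poly_Mapping.single [i, i] 1 - Poly_Mapping.single [i] (qq - 1) - Poly_Mapping.single [] qq"
        "1 \<le> i" "i < r"
    | (e) "f = Poly_Mapping.single [r, r] 1 - Poly_Mapping.single [] 1"
    unfolding hecke_rels_def Let_def by blast
  then show ?thesis
  proof cases
    case a
    then have "i + 2 \<le> j \<or> j + 2 \<le> i" by auto
    then show ?thesis
      unfolding a(1) by (intro eq) (use act_commute[OF a(2,3)] act_commute[OF a(3,2)] in metis)
  next
    case b then show ?thesis unfolding b(1) by (intro eq act_braid_A) auto
  next
    case c then show ?thesis unfolding c(1) by (intro eq act_braid_B)
  next
    case d
    then have "i \<in> {1..<r}" by simp
    from act_square[OF this assms(2)] show ?thesis
      unfolding d(1) act_diff act_single by (simp add: fun_eq_iff del: act_word_Cons)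
  next
    case e
    from act_last_square[OF assms(2)] show ?thesis unfolding e(1) by (intro eq) simp
  qed
qed

lemma hecke_ideal_act:
  assumes "f \<in> hecke_ideal r" "supported v"
  shows "act f v = (\<lambda>w. 0)"
proof -
  \<comment> \<open>Quantifying over all supported functions makes this a two-sided ideal: in a
    product the left factor acts first, and it maps supported functions to supported ones.\<close>
  define J where "J = {f \<in> carrier F. \<forall>v. supported v \<longrightarrow> act f v = (\<lambda>w. 0)}"
  have z: "act f (\<lambda>w. 0) = (\<lambda>w. 0)" for f
    using act_arg_scale[of f 0 "\<lambda>w. 0"] by simp
  have "ideal J F"
  proof (rule idealI)
    show "subgroup J (add_monoid F)"
    proof (rule F.add.subgroupI)
      show "J \<noteq> {}" using F.zero_closed by (auto simp: J_def free_algebra_simps(3) act_zero)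
      fix a b assume "a \<in> J" "b \<in> J"
      then show "a \<oplus>\<^bsub>F\<^esub> b \<in> J" using F.a_closed[of a b] by (simp add: J_def free_algebra_simps(4) act_add)
      show "\<ominus>\<^bsub>F\<^esub> a \<in> J" using \<open>a \<in> J\<close> F.a_inv_closed[of a] by (simp add: J_def F_minus act_uminus)
    qed (auto simp: J_def)
  qed (auto simp: J_def act_mult supported_act z F.ring_axioms)
  moreover have "hecke_rels r \<subseteq> J"
    using hecke_rels_carrier hecke_rels_act by (auto simp: J_def)
  ultimately have "hecke_ideal r \<subseteq> J"
    unfolding hecke_ideal_def by (rule F.genideal_minimal)
  then show ?thesis using assms by (auto simp: J_def)
qed

definition hecke_act :: "((nat \<Rightarrow> nat) \<Rightarrow> int poly) \<Rightarrow> (nat list \<Rightarrow>\<^sub>0 int poly) set \<Rightarrow> (nat \<Rightarrow> nat) \<Rightarrow> int poly" where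
  "hecke_act v h = act (SOME f. f \<in> carrier F \<and> h = cls f) v"

text \<open>Elements of \<open>H\<close> are cosets; two representatives differ by an element of the
  ideal, which acts as zero on supported functions.\<close>

lemma hecke_act_cls:
  assumes "f \<in> carrier F" "supported v"
  shows "hecke_act v (cls f) = act f v"
proof -
  define g where "g = (SOME g. g \<in> carrier F \<and> cls f = cls g)"
  have g: "g \<in> carrier F" "cls f = cls g"
    using someI[of "\<lambda>g. g \<in> carrier F \<and> cls f = cls g" f] assms by (auto simp: g_def)
  have "cls f = cls (f - g) \<oplus>\<^bsub>H\<^esub> cls g"
    using cls_add[of "f - g" g] assms g by (simp add: diff_carrier)
  then have "cls (f - g) = \<zero>\<^bsub>H\<^esub>"
    using g assms diff_carrier[of f g] H.add.r_cancel_one'[of "cls g" "cls (f - g)"] by auto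
  then have "f - g \<in> hecke_ideal r" using assms g by (simp add: cls_eq_zero diff_carrier)
  then have "act (f - g) v = (\<lambda>w. 0)" using assms by (intro hecke_ideal_act)
  then show ?thesis by (simp add: hecke_act_def g_def[symmetric] act_diff fun_eq_iff)
qed

lemma hecke_act_mult:
  "supported v \<Longrightarrow> h \<in> carrier H \<Longrightarrow> k \<in> carrier H \<Longrightarrow> hecke_act v (h \<otimes>\<^bsub>H\<^esub> k) = hecke_act (hecke_act v h) k"
  by (auto dest!: cls_surj simp: hecke_act_cls act_mult supported_act F.m_closed simp flip: cls_mult)

lemma hecke_act_add:
  assumes "supported v" "h \<in> carrier H" "k \<in> carrier H"
  shows "hecke_act v (h \<oplus>\<^bsub>H\<^esub> k) = (\<lambda>w. hecke_act v h w + hecke_act v k w)"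
proof -
  obtain f g where "f \<in> carrier F" "g \<in> carrier F" "h = cls f" "k = cls g"
    using assms cls_surj by metis
  then show ?thesis
    using assms F.a_closed[of f g] by (simp add: hecke_act_cls act_add free_algebra_simps(4) flip: cls_add)
qed

lemma hecke_act_smult:
  assumes "supported v" "h \<in> carrier H"
  shows "hecke_act v (a \<odot>\<^bsub>H\<^esub> h) = (\<lambda>w. a * hecke_act v h w)"
proof -
  obtain f where f: "f \<in> carrier F" "h = cls f" using assms cls_surj by metis
  have "act (a \<odot>\<^bsub>F\<^esub> f) v = (\<lambda>w. a * act f v w)"
    using f(1)
  proof (induction f rule: free_algebra.monoid_algebra_induct)
    case (single "is" b)
    then show ?case by (simp add: free_algebra.monoid_algebra_smult_single act_single mult.assoc)
  next
    case (add f g)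
    then show ?case by (simp add: free_algebra.monoid_algebra_smult_distr act_add distrib_left)
  qed
  then show ?thesis using f assms by (simp add: hecke_act_cls flip: cls_smult)
qed

lemma hecke_act_T_word: "supported v \<Longrightarrow> is \<in> lists {1..r} \<Longrightarrow> hecke_act v (T_word is) = act_word is v"
  by (simp add: T_word_cls hecke_act_cls single_carrier act_single)

lemma hecke_act_T: "supported v \<Longrightarrow> i \<in> {1..r} \<Longrightarrow> hecke_act v (T i) = act_gen i v"
  using hecke_act_T_word[of v "[i]"] by (simp add: T_word_singleton)

lemma hecke_act_one: "supported v \<Longrightarrow> hecke_act v \<one>\<^bsub>H\<^esub> = v"
  using hecke_act_T_word[of v "[]"] by simp

definition T_comb :: "((nat \<Rightarrow> nat) \<Rightarrow> int poly) \<Rightarrow> (nat list \<Rightarrow>\<^sub>0 int poly) set" where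
  "T_comb v = finsum H (\<lambda>w. v w \<odot>\<^bsub>H\<^esub> Tw r w) (cox_group r)"

lemma T_comb_closed [simp, intro]: "T_comb v \<in> carrier H"
  unfolding T_comb_def by (intro H.finsum_closed) auto

lemma T_comb_add: "T_comb (\<lambda>w. v w + u w) = T_comb v \<oplus>\<^bsub>H\<^esub> T_comb u"
proof -
  have "T_comb (\<lambda>w. v w + u w) = finsum H (\<lambda>w. v w \<odot>\<^bsub>H\<^esub> Tw r w \<oplus>\<^bsub>H\<^esub> u w \<odot>\<^bsub>H\<^esub> Tw r w) (cox_group r)"
    unfolding T_comb_def by (rule H.finsum_cong') (auto simp: H.smult_l_distr)
  also have "\<dots> = T_comb v \<oplus>\<^bsub>H\<^esub> T_comb u"
    unfolding T_comb_def by (rule H.finsum_addf) auto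
  finally show ?thesis .
qed

lemma T_comb_scale: "T_comb (\<lambda>w. a * v w) = a \<odot>\<^bsub>H\<^esub> T_comb v"
proof -
  have "a \<odot>\<^bsub>H\<^esub> T_comb v = finsum H (\<lambda>w. (a \<odot>\<^bsub>H\<^esub> \<one>\<^bsub>H\<^esub>) \<otimes>\<^bsub>H\<^esub> (v w \<odot>\<^bsub>H\<^esub> Tw r w)) (cox_group r)"
    unfolding T_comb_def
    by (subst H.smult_eq_mult, simp_all add: H.finsum_closed Pi_def, rule H.finsum_rdistr) (auto simp: finite_cox_group)
  also have "\<dots> = T_comb (\<lambda>w. a * v w)"
    unfolding T_comb_def by (rule H.finsum_cong') (auto simp: H.smult_mult_left H.smult_assoc1)
  finally show ?thesis ..
qed

lemma T_comb_zero: "T_comb (\<lambda>w. 0) = \<zero>\<^bsub>H\<^esub>"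
  using T_comb_scale[of 0 "\<lambda>w. 0"] by simp

text \<open>Expand each \<open>Tw r w\<close> times \<open>T i\<close> in \<open>Tw r w\<close> and
  \<open>Tw r (w \<circ> cox r i)\<close>, and collect equal terms by reindexing. This links the
  coordinate model back to the algebra.\<close>

lemma T_comb_act_gen:
  assumes i: "i \<in> {1..r}"
  shows "T_comb (act_gen i v) = T_comb v \<otimes>\<^bsub>H\<^esub> T i"
proof -
  let ?s = "\<lambda>w. w \<circ> cox r i"
  \<comment> \<open>The coefficients of \<open>T\<^sub>w\<close> and of
    \<open>Tw r (w \<circ> cox r i)\<close> in \<open>T\<^sub>w T\<^sub>i\<close>; for
    \<open>i = r\<close>, where the parameter is 1, they are 0 and 1 at ascents and descents
    alike.\<close>
  define c d where "c w = (if i < r \<and> w i > w (i + 1) then qq - 1 else 0)"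
    and "d w = (if i < r \<and> w i > w (i + 1) then qq else 1)" for w :: "nat \<Rightarrow> nat"
  have Tw_T: "Tw r w \<otimes>\<^bsub>H\<^esub> T i = c w \<odot>\<^bsub>H\<^esub> Tw r w \<oplus>\<^bsub>H\<^esub> d w \<odot>\<^bsub>H\<^esub> Tw r (?s w)" if w: "w \<in> cox_group r" for w
  proof -
    have cl: "Tw r w \<in> carrier H" "Tw r (?s w) \<in> carrier H" using w i by (auto intro: Tw_closed comp_cox_group)
    have "w i \<noteq> w (i + 1)" using WB_inj[OF cox_group_WB[OF w]] by simp
    then consider "i = r" | "i < r" "w i < w (i + 1)" | "i < r" "w i > w (i + 1)" using i by fastforce
    then show ?thesis
    proof cases
      case 1 then show ?thesis using Tw_mult_last[OF w] cl by (simp add: c_def d_def del: o_apply)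
    next
      case 2 then show ?thesis using Tw_ascent[OF w i] cl by (simp add: c_def d_def del: o_apply)
    next
      case 3 then show ?thesis using Tw_descent[OF w, of i] i by (simp add: c_def d_def del: o_apply)
    qed
  qed
  have act: "act_gen i v w = v w * c w + v (?s w) * d (?s w)" if w: "w \<in> cox_group r" for w
  proof -
    have "w i \<noteq> w (i + 1)" using WB_inj[OF cox_group_WB[OF w]] by simp
    moreover have "?s w i = w (i + 1)" "?s w (i + 1) = w i" using i by simp_all
    ultimately show ?thesis
      using w i unfolding c_def d_def act_gen_def by (auto simp: mult.commute simp del: o_apply)
  qed
  have cl: "Tw r (?s w) \<in> carrier H" if "w \<in> cox_group r" for w
    using that i by (intro Tw_closed comp_cox_group)
  have inj: "inj_on ?s (cox_group r)"
    by (rule inj_on_inverseI[of _ ?s]) (use i in simp)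
  have img: "?s ` cox_group r = cox_group r"
  proof
    show "?s ` cox_group r \<subseteq> cox_group r" using i by (auto intro: comp_cox_group)
    show "cox_group r \<subseteq> ?s ` cox_group r"
    proof
      fix w assume "w \<in> cox_group r"
      then show "w \<in> ?s ` cox_group r"
        using i by (intro image_eqI[of _ _ "?s w"]) (simp_all only: comp_cox_cox comp_cox_in_cox_group)
    qed
  qed
  have "T_comb v \<otimes>\<^bsub>H\<^esub> T i = finsum H (\<lambda>w. (v w \<odot>\<^bsub>H\<^esub> Tw r w) \<otimes>\<^bsub>H\<^esub> T i) (cox_group r)"
    unfolding T_comb_def using i by (intro H.finsum_ldistr) (auto simp: finite_cox_group)
  also have "\<dots> = finsum H (\<lambda>w. (v w * c w) \<odot>\<^bsub>H\<^esub> Tw r w \<oplus>\<^bsub>H\<^esub> (v w * d w) \<odot>\<^bsub>H\<^esub> Tw r (?s w)) (cox_group r)"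
  proof (rule H.finsum_cong')
    fix w assume w: "w \<in> cox_group r"
    have "(v w \<odot>\<^bsub>H\<^esub> Tw r w) \<otimes>\<^bsub>H\<^esub> T i = v w \<odot>\<^bsub>H\<^esub> (Tw r w \<otimes>\<^bsub>H\<^esub> T i)"
      using w i by (intro H.smult_mult_left) auto
    then show "(v w \<odot>\<^bsub>H\<^esub> Tw r w) \<otimes>\<^bsub>H\<^esub> T i = (v w * c w) \<odot>\<^bsub>H\<^esub> Tw r w \<oplus>\<^bsub>H\<^esub> (v w * d w) \<odot>\<^bsub>H\<^esub> Tw r (?s w)"
      unfolding Tw_T[OF w] using w cl[OF w] by (simp add: H.smult_r_distr H.smult_assoc1 del: o_apply)
  qed (use cl in auto)
  also have "\<dots> = finsum H (\<lambda>w. (v w * c w) \<odot>\<^bsub>H\<^esub> Tw r w) (cox_group r) \<oplus>\<^bsub>H\<^esub>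
      finsum H (\<lambda>w. (v w * d w) \<odot>\<^bsub>H\<^esub> Tw r (?s w)) (cox_group r)"
    using cl by (intro H.finsum_addf) auto
  \<comment> \<open>Composition with \<open>cox r i\<close> is an involution of the group; it brings
    both sums to the terms \<open>Tw r w\<close>.\<close>
  also have "finsum H (\<lambda>w. (v w * d w) \<odot>\<^bsub>H\<^esub> Tw r (?s w)) (cox_group r) =
      finsum H (\<lambda>w. (v (?s w) * d (?s w)) \<odot>\<^bsub>H\<^esub> Tw r w) (cox_group r)"
  proof -
    have "finsum H (\<lambda>w. (v (?s w) * d (?s w)) \<odot>\<^bsub>H\<^esub> Tw r w) (?s ` cox_group r) =
       finsum H (\<lambda>w. (v (?s (?s w)) * d (?s (?s w))) \<odot>\<^bsub>H\<^esub> Tw r (?s w)) (cox_group r)"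
      by (rule H.finsum_reindex[OF _ inj]) (use cl in auto)
    then show ?thesis unfolding img comp_cox_cox[OF i] by simp
  qed
  also have "finsum H (\<lambda>w. (v w * c w) \<odot>\<^bsub>H\<^esub> Tw r w) (cox_group r) \<oplus>\<^bsub>H\<^esub>
      finsum H (\<lambda>w. (v (?s w) * d (?s w)) \<odot>\<^bsub>H\<^esub> Tw r w) (cox_group r) =
      finsum H (\<lambda>w. (v w * c w) \<odot>\<^bsub>H\<^esub> Tw r w \<oplus>\<^bsub>H\<^esub> (v (?s w) * d (?s w)) \<odot>\<^bsub>H\<^esub> Tw r w) (cox_group r)"
    by (rule H.finsum_addf[symmetric]) auto
  also have "\<dots> = T_comb (act_gen i v)"
    unfolding T_comb_def by (rule H.finsum_cong') (auto simp: act H.smult_l_distr simp del: o_apply)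
  finally show ?thesis ..
qed

lemma T_comb_act_word:
  "is \<in> lists {1..r} \<Longrightarrow> T_comb (act_word is v) = T_comb v \<otimes>\<^bsub>H\<^esub> T_word is"
proof (induction "is" arbitrary: v)
  case (Cons i "is")
  then have "i \<in> {1..r}" "is \<in> lists {1..r}" by auto
  then show ?case
    using Cons.IH[of "act_gen i v"] T_closed[of i] T_word_closed[of "is"]
    by (simp add: T_comb_act_gen T_word_Cons H.m_assoc del: atLeastAtMost_iff)
qed simp

lemma T_comb_act:
  "f \<in> carrier F \<Longrightarrow> T_comb (act f v) = T_comb v \<otimes>\<^bsub>H\<^esub> cls f"
proof (induction f rule: free_algebra.monoid_algebra_induct)
  case (single "is" a)
  then have "is \<in> lists {1..r}" by simp
  then show ?case
    by (simp add: act_single T_comb_scale T_comb_act_word cls_single H.smult_mult_right T_word_closed)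
next
  case (add f g)
  then show ?case by (simp add: act_add T_comb_add cls_add H.r_distr)
qed

definition unit_coord :: "(nat \<Rightarrow> nat) \<Rightarrow> int poly" where
  "unit_coord w = (if w = id then 1 else 0)"

lemma supported_unit_coord: "supported unit_coord"
  by (auto simp: supported_def unit_coord_def)

lemma T_comb_unit_coord: "T_comb unit_coord = \<one>\<^bsub>H\<^esub>"
proof -
  have "T_comb unit_coord = finsum H (\<lambda>w. if id = w then Tw r w else \<zero>\<^bsub>H\<^esub>) (cox_group r)"
    unfolding T_comb_def by (rule H.finsum_cong') (auto simp: unit_coord_def)
  also have "\<dots> = Tw r id"
    by (rule H.add.finprod_singleton) (auto simp: finite_cox_group)
  finally show ?thesis by (simp add: Tw_id)
qed

text \<open>Acting on the coordinates of the unit gives coordinates of \<open>h\<close>, and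
  \<open>T_comb\<close> recovers \<open>h\<close> from them. So coordinates tell the elements of
  \<open>H\<close> apart.\<close>

lemma hecke_act_unit_coord_inj:
  assumes "h \<in> carrier H" "hecke_act unit_coord h = (\<lambda>w. 0)"
  shows "h = \<zero>\<^bsub>H\<^esub>"
proof -
  obtain f where f: "f \<in> carrier F" "h = cls f" using assms cls_surj by metis
  then have "act f unit_coord = (\<lambda>w. 0)"
    using assms(2) hecke_act_cls supported_unit_coord by simp
  then show ?thesis
    using T_comb_act[OF f(1), of unit_coord] f by (simp add: T_comb_unit_coord T_comb_zero)
qed

end

section \<open>Endomorphism algebras of direct sums and their transport along isomorphisms\<close>

section \<open>Endomorphism algebras of direct sums\<close>

declare restrict_PiE [simp del] restrict_apply [simp del] restrict_apply' [simp]

lemma in_l_coset_iff: "y \<in> x <#\<^bsub>B\<^esub> S \<longleftrightarrow> (\<exists>h\<in>S. y = x \<otimes>\<^bsub>B\<^esub> h)"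
  by (auto simp: l_coset_def)

locale direct_sum = assoc_algebra B for B :: "('a::comm_ring_1, 'b) module" (structure) +
  fixes K :: "'b set" and I :: "'i set" and M :: "'i \<Rightarrow> 'b set"
  assumes K_subset: "K \<subseteq> carrier B" and K_scalar: "a \<odot> \<one> \<in> K"
    and M_subset: "i \<in> I \<Longrightarrow> M i \<subseteq> carrier B"
    and M_zero: "i \<in> I \<Longrightarrow> \<zero> \<in> M i"
    and M_add: "i \<in> I \<Longrightarrow> x \<in> M i \<Longrightarrow> y \<in> M i \<Longrightarrow> x \<oplus> y \<in> M i"
    and M_mult: "i \<in> I \<Longrightarrow> x \<in> M i \<Longrightarrow> h \<in> K \<Longrightarrow> x \<otimes> h \<in> M i"

text \<open>Two subrings occur because \<open>x\<^sub>\<lambda> H\<close> is generated over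
  \<open>H\<close> but regarded as a module over the smaller \<open>H\<^sub>D\<close>.\<close>

lemma (in assoc_algebra) direct_sum_principal:
  assumes "subring K A" "\<And>a. a \<odot> \<one> \<in> K" "\<And>i. i \<in> I \<Longrightarrow> x i \<in> carrier A"
    and "subring K' A" "K \<subseteq> K'"
  shows "direct_sum A K I (\<lambda>i. x i <# K')"
proof (intro direct_sum.intro direct_sum_axioms.intro assoc_algebra_axioms)
  note K = subringE[OF assms(1)] and K' = subringE[OF assms(4)]
  have in_A: "h \<in> carrier A" if "h \<in> K'" for h using K'(1) that by auto
  show "K \<subseteq> carrier A" by (rule K)
  show "a \<odot> \<one> \<in> K" for a by (rule assms)
  fix i assume i: "i \<in> I"
  note x = assms(3)[OF i]
  show "x i <# K' \<subseteq> carrier A"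
    using x in_A by (auto simp: in_l_coset_iff)
  show "\<zero> \<in> x i <# K'"
    unfolding in_l_coset_iff using x K'(2) by (intro bexI[of _ \<zero>]) auto
  fix y z assume yz: "y \<in> x i <# K'"
  show "y \<oplus> z \<in> x i <# K'" if "z \<in> x i <# K'"
  proof -
    obtain h k where hk: "h \<in> K'" "k \<in> K'" "y = x i \<otimes> h" "z = x i \<otimes> k"
      using yz \<open>z \<in> _\<close> unfolding in_l_coset_iff by blast
    then show ?thesis
      unfolding in_l_coset_iff using x K'(7) in_A by (intro bexI[of _ "h \<oplus> k"]) (auto simp: r_distr)
  qed
  show "y \<otimes> h \<in> x i <# K'" if "h \<in> K" for h
  proof -
    obtain k where k: "k \<in> K'" "y = x i \<otimes> k"
      using yz unfolding in_l_coset_iff by blast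
    then show ?thesis
      unfolding in_l_coset_iff using x K'(6) in_A assms(5) \<open>h \<in> K\<close>
      by (intro bexI[of _ "k \<otimes> h"]) (auto simp: m_assoc subset_iff)
  qed
qed

context direct_sum
begin

abbreviation D :: "('i \<Rightarrow> 'b) set" where "D \<equiv> Pi\<^sub>E I M"
abbreviation E :: "('a, ('i \<Rightarrow> 'b) \<Rightarrow> ('i \<Rightarrow> 'b)) module" where "E \<equiv> direct_sum_End B K I M"

lemma M_carrier: "i \<in> I \<Longrightarrow> x \<in> M i \<Longrightarrow> x \<in> carrier B"
  using M_subset by blast

lemma D_carrier: "x \<in> D \<Longrightarrow> i \<in> I \<Longrightarrow> x i \<in> carrier B"
  using M_carrier by (auto simp: PiE_iff)

lemma D_add: "x \<in> D \<Longrightarrow> y \<in> D \<Longrightarrow> (\<lambda>i\<in>I. x i \<oplus> y i) \<in> D"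
  by (auto simp: PiE_iff intro: M_add)

lemma D_mult: "x \<in> D \<Longrightarrow> h \<in> K \<Longrightarrow> (\<lambda>i\<in>I. x i \<otimes> h) \<in> D"
  by (auto simp: PiE_iff intro: M_mult)

lemma D_zero: "(\<lambda>i\<in>I. \<zero>) \<in> D"
  by (auto simp: PiE_iff intro: M_zero)

text \<open>The scalars lie in \<open>K\<close>, so maps that commute with \<open>K\<close> are
  automatically linear over the ground ring.\<close>

lemma smult_D_eq: "x \<in> D \<Longrightarrow> (\<lambda>i\<in>I. a \<odot> x i) = (\<lambda>i\<in>I. x i \<otimes> (a \<odot> \<one>))"
  by (rule restrict_ext) (simp add: D_carrier smult_mult_right)

lemma D_smult: "x \<in> D \<Longrightarrow> (\<lambda>i\<in>I. a \<odot> x i) \<in> D"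
  unfolding smult_D_eq by (intro D_mult K_scalar)

lemma D_eqI: "x \<in> D \<Longrightarrow> y \<in> D \<Longrightarrow> (\<And>i. i \<in> I \<Longrightarrow> x i = y i) \<Longrightarrow> x = y"
  by (rule PiE_ext)

lemma E_carrier:
  "f \<in> carrier E \<longleftrightarrow> f \<in> D \<rightarrow>\<^sub>E D \<and>
        (\<forall>x\<in>D. \<forall>y\<in>D. f (\<lambda>i\<in>I. x i \<oplus> y i) = (\<lambda>i\<in>I. f x i \<oplus> f y i)) \<and>
        (\<forall>x\<in>D. \<forall>h\<in>K. f (\<lambda>i\<in>I. x i \<otimes> h) = (\<lambda>i\<in>I. f x i \<otimes> h))"
  by (simp add: direct_sum_End_def Let_def)

lemma E_ops:
  "monoid.mult E f g = compose D f g"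
  "one E = (\<lambda>x\<in>D. x)"
  "ring.zero E = (\<lambda>x\<in>D. \<lambda>i\<in>I. \<zero>)"
  "ring.add E f g = (\<lambda>x\<in>D. \<lambda>i\<in>I. f x i \<oplus> g x i)"
  "smult E a f = (\<lambda>x\<in>D. \<lambda>i\<in>I. a \<odot> f x i)"
  by (simp_all add: direct_sum_End_def Let_def)

lemma E_closed: "f \<in> carrier E \<Longrightarrow> x \<in> D \<Longrightarrow> f x \<in> D"
  by (auto simp: E_carrier)

lemma E_add: "f \<in> carrier E \<Longrightarrow> x \<in> D \<Longrightarrow> y \<in> D \<Longrightarrow> f (\<lambda>i\<in>I. x i \<oplus> y i) = (\<lambda>i\<in>I. f x i \<oplus> f y i)"
  unfolding E_carrier by blast

lemma E_mult: "f \<in> carrier E \<Longrightarrow> x \<in> D \<Longrightarrow> h \<in> K \<Longrightarrow> f (\<lambda>i\<in>I. x i \<otimes> h) = (\<lambda>i\<in>I. f x i \<otimes> h)"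
  unfolding E_carrier by blast

lemma E_smult:
  assumes "f \<in> carrier E" "x \<in> D" shows "f (\<lambda>i\<in>I. a \<odot> x i) = (\<lambda>i\<in>I. a \<odot> f x i)"
  unfolding smult_D_eq[OF assms(2)] smult_D_eq[OF E_closed[OF assms]] by (rule E_mult[OF assms K_scalar])

lemma E_value: "f \<in> carrier E \<Longrightarrow> x \<in> D \<Longrightarrow> i \<in> I \<Longrightarrow> f x i \<in> carrier B"
  by (rule D_carrier[OF E_closed])

lemma E_eqI:
  assumes "f \<in> carrier E" "g \<in> carrier E" "\<And>x i. x \<in> D \<Longrightarrow> i \<in> I \<Longrightarrow> f x i = g x i"
  shows "f = g"
proof (rule extensionalityI[of _ D])
  show "f \<in> extensional D" "g \<in> extensional D" using assms(1,2) by (auto simp: E_carrier PiE_iff)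
  show "f x = g x" if "x \<in> D" for x 
    by (rule D_eqI[OF E_closed[OF assms(1) that] E_closed[OF assms(2) that] assms(3)[OF that]])
qed

lemma E_carrierI:
  assumes "f \<in> extensional D" "\<And>x. x \<in> D \<Longrightarrow> f x \<in> D"
    and "\<And>x y i. x \<in> D \<Longrightarrow> y \<in> D \<Longrightarrow> i \<in> I \<Longrightarrow> f (\<lambda>i\<in>I. x i \<oplus> y i) i = f x i \<oplus> f y i"
    and "\<And>x h i. x \<in> D \<Longrightarrow> h \<in> K \<Longrightarrow> i \<in> I \<Longrightarrow> f (\<lambda>i\<in>I. x i \<otimes> h) i = f x i \<otimes> h"
  shows "f \<in> carrier E"
  unfolding E_carrier
proof (intro conjI ballI)
  show "f \<in> D \<rightarrow>\<^sub>E D" using assms(1,2) by (auto simp: PiE_iff)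
  show "f (\<lambda>i\<in>I. x i \<oplus> y i) = (\<lambda>i\<in>I. f x i \<oplus> f y i)" if "x \<in> D" "y \<in> D" for x y
    by (rule D_eqI[OF assms(2)[OF D_add[OF that]] D_add[OF assms(2)[OF that(1)] assms(2)[OF that(2)]]])
      (use that assms(3) in simp)
  show "f (\<lambda>i\<in>I. x i \<otimes> h) = (\<lambda>i\<in>I. f x i \<otimes> h)" if "x \<in> D" "h \<in> K" for x h
    by (rule D_eqI[OF assms(2)[OF D_mult[OF that]] D_mult[OF assms(2)[OF that(1)] that(2)]])
      (use that assms(4) in simp)
qed

lemma E_zero_closed: "\<zero>\<^bsub>E\<^esub> \<in> carrier E"
  unfolding E_ops using K_subset
  by (intro E_carrierI) (simp_all add: D_zero D_add D_mult subsetD)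

lemma E_one_closed: "\<one>\<^bsub>E\<^esub> \<in> carrier E"
  unfolding E_ops by (intro E_carrierI) (simp_all add: D_add D_mult)

lemma E_add_closed:
  assumes "f \<in> carrier E" "g \<in> carrier E" shows "f \<oplus>\<^bsub>E\<^esub> g \<in> carrier E"
  unfolding E_ops
proof (intro E_carrierI)
  have c: "f x i \<in> carrier B" "g x i \<in> carrier B" if "x \<in> D" "i \<in> I" for x i
    using that assms by (simp_all add: E_value)
  have ac: "a \<oplus> b \<oplus> (c \<oplus> d) = a \<oplus> c \<oplus> (b \<oplus> d)"
    if "a \<in> carrier B" "b \<in> carrier B" "c \<in> carrier B" "d \<in> carrier B" for a b c d
    using that by (simp add: a_ac)
  show "(\<lambda>x\<in>D. \<lambda>i\<in>I. f x i \<oplus> g x i) x \<in> D" if "x \<in> D" for x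
    using that assms by (simp add: D_add E_closed)
  show "(\<lambda>x\<in>D. \<lambda>i\<in>I. f x i \<oplus> g x i) (\<lambda>i\<in>I. x i \<oplus> y i) i =
      (\<lambda>x\<in>D. \<lambda>i\<in>I. f x i \<oplus> g x i) x i \<oplus> (\<lambda>x\<in>D. \<lambda>i\<in>I. f x i \<oplus> g x i) y i"
    if "x \<in> D" "y \<in> D" "i \<in> I" for x y i
    using that assms by (simp add: D_add E_add c ac)
  show "(\<lambda>x\<in>D. \<lambda>i\<in>I. f x i \<oplus> g x i) (\<lambda>i\<in>I. x i \<otimes> h) i =
      (\<lambda>x\<in>D. \<lambda>i\<in>I. f x i \<oplus> g x i) x i \<otimes> h" if "x \<in> D" "h \<in> K" "i \<in> I" for x h i
    using that assms K_subset by (simp add: D_mult E_mult c l_distr subsetD)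
qed auto

lemma E_smult_closed:
  assumes "f \<in> carrier E" shows "a \<odot>\<^bsub>E\<^esub> f \<in> carrier E"
  unfolding E_ops
proof (intro E_carrierI)
  have c: "f x i \<in> carrier B" if "x \<in> D" "i \<in> I" for x i
    using that assms by (simp_all add: E_value)
  show "(\<lambda>x\<in>D. \<lambda>i\<in>I. a \<odot> f x i) x \<in> D" if "x \<in> D" for x
    using that assms by (simp add: D_smult E_closed)
  show "(\<lambda>x\<in>D. \<lambda>i\<in>I. a \<odot> f x i) (\<lambda>i\<in>I. x i \<oplus> y i) i =
      (\<lambda>x\<in>D. \<lambda>i\<in>I. a \<odot> f x i) x i \<oplus> (\<lambda>x\<in>D. \<lambda>i\<in>I. a \<odot> f x i) y i"
    if "x \<in> D" "y \<in> D" "i \<in> I" for x y i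
    using that assms by (simp add: D_add E_add c smult_r_distr)
  show "(\<lambda>x\<in>D. \<lambda>i\<in>I. a \<odot> f x i) (\<lambda>i\<in>I. x i \<otimes> h) i =
      (\<lambda>x\<in>D. \<lambda>i\<in>I. a \<odot> f x i) x i \<otimes> h" if "x \<in> D" "h \<in> K" "i \<in> I" for x h i
    using that assms K_subset by (simp add: D_mult E_mult c smult_mult_left subsetD)
qed auto

lemma E_mult_closed:
  assumes "f \<in> carrier E" "g \<in> carrier E" shows "f \<otimes>\<^bsub>E\<^esub> g \<in> carrier E"
  unfolding E_ops
proof (intro E_carrierI)
  show "compose D f g \<in> extensional D" by (rule compose_extensional)
  show "compose D f g x \<in> D" if "x \<in> D" for x
    using that assms by (simp add: compose_eq E_closed)
  show "compose D f g (\<lambda>i\<in>I. x i \<oplus> y i) i = compose D f g x i \<oplus> compose D f g y i"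
    if "x \<in> D" "y \<in> D" "i \<in> I" for x y i
    using that assms by (simp add: compose_eq D_add E_add E_closed)
  show "compose D f g (\<lambda>i\<in>I. x i \<otimes> h) i = compose D f g x i \<otimes> h" if "x \<in> D" "h \<in> K" "i \<in> I" for x h i
    using that assms by (simp add: compose_eq D_mult E_mult E_closed)
qed

lemma E_assoc_algebra: "assoc_algebra E"
proof -
  note cl = E_zero_closed E_one_closed E_add_closed E_smult_closed E_mult_closed
  note ops = E_ops compose_eq
  have "abelian_group E"
  proof (rule abelian_groupI)
    fix f assume f: "f \<in> carrier E"
    have "((-1) \<odot>\<^bsub>E\<^esub> f) \<oplus>\<^bsub>E\<^esub> f = \<zero>\<^bsub>E\<^esub>"
      using f by (intro E_eqI cl) (simp_all add: ops smult_l_minus E_value l_neg)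
    then show "\<exists>g\<in>carrier E. g \<oplus>\<^bsub>E\<^esub> f = \<zero>\<^bsub>E\<^esub>" using f cl by blast
  next
    fix f g h assume "f \<in> carrier E" "g \<in> carrier E" "h \<in> carrier E"
    then show "f \<oplus>\<^bsub>E\<^esub> g \<oplus>\<^bsub>E\<^esub> h = f \<oplus>\<^bsub>E\<^esub> (g \<oplus>\<^bsub>E\<^esub> h)"
      by (intro E_eqI cl) (simp_all add: ops E_value a_assoc)
  next
    fix f g assume "f \<in> carrier E" "g \<in> carrier E"
    then show "f \<oplus>\<^bsub>E\<^esub> g = g \<oplus>\<^bsub>E\<^esub> f"
      by (intro E_eqI cl) (simp_all add: ops E_value a_comm)
  next
    fix f assume "f \<in> carrier E"
    then show "\<zero>\<^bsub>E\<^esub> \<oplus>\<^bsub>E\<^esub> f = f"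
      by (intro E_eqI cl) (simp_all add: ops E_value)
  qed (auto intro: cl)
  moreover have "monoid E"
  proof (rule monoidI)
    fix f g h assume "f \<in> carrier E" "g \<in> carrier E" "h \<in> carrier E"
    then show "f \<otimes>\<^bsub>E\<^esub> g \<otimes>\<^bsub>E\<^esub> h = f \<otimes>\<^bsub>E\<^esub> (g \<otimes>\<^bsub>E\<^esub> h)"
      by (intro E_eqI cl) (simp_all add: ops E_closed)
  next
    fix f assume f: "f \<in> carrier E"
    show "\<one>\<^bsub>E\<^esub> \<otimes>\<^bsub>E\<^esub> f = f" "f \<otimes>\<^bsub>E\<^esub> \<one>\<^bsub>E\<^esub> = f"
      using f by (intro E_eqI cl; simp add: ops E_closed)+
  qed (auto intro: cl)
  ultimately have "ring E"
  proof (rule ringI)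
    fix f g h assume "f \<in> carrier E" "g \<in> carrier E" "h \<in> carrier E"
    then show "(f \<oplus>\<^bsub>E\<^esub> g) \<otimes>\<^bsub>E\<^esub> h = f \<otimes>\<^bsub>E\<^esub> h \<oplus>\<^bsub>E\<^esub> g \<otimes>\<^bsub>E\<^esub> h"
      "h \<otimes>\<^bsub>E\<^esub> (f \<oplus>\<^bsub>E\<^esub> g) = h \<otimes>\<^bsub>E\<^esub> f \<oplus>\<^bsub>E\<^esub> h \<otimes>\<^bsub>E\<^esub> g"
      by (intro E_eqI cl; simp add: ops E_closed E_add)+
  qed
  then show ?thesis
  proof (rule assoc_algebraI)
    fix f g and a b :: 'a assume f: "f \<in> carrier E"
    show "a \<odot>\<^bsub>E\<^esub> f \<in> carrier E" by (rule cl f)+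
    show "(a + b) \<odot>\<^bsub>E\<^esub> f = a \<odot>\<^bsub>E\<^esub> f \<oplus>\<^bsub>E\<^esub> b \<odot>\<^bsub>E\<^esub> f" "(a * b) \<odot>\<^bsub>E\<^esub> f = a \<odot>\<^bsub>E\<^esub> (b \<odot>\<^bsub>E\<^esub> f)"
      "1 \<odot>\<^bsub>E\<^esub> f = f"
      using f by (intro E_eqI cl; simp add: ops E_value smult_l_distr smult_assoc1)+
    assume g: "g \<in> carrier E"
    show "a \<odot>\<^bsub>E\<^esub> (f \<oplus>\<^bsub>E\<^esub> g) = a \<odot>\<^bsub>E\<^esub> f \<oplus>\<^bsub>E\<^esub> a \<odot>\<^bsub>E\<^esub> g" "(a \<odot>\<^bsub>E\<^esub> f) \<otimes>\<^bsub>E\<^esub> g = a \<odot>\<^bsub>E\<^esub> (f \<otimes>\<^bsub>E\<^esub> g)"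
      "f \<otimes>\<^bsub>E\<^esub> (a \<odot>\<^bsub>E\<^esub> g) = a \<odot>\<^bsub>E\<^esub> (f \<otimes>\<^bsub>E\<^esub> g)"
      using f g by (intro E_eqI cl; simp add: ops E_value smult_r_distr E_closed E_smult)+
  qed
qed

end

text \<open>The sums may live in different algebra records, here \<open>HB r\<close> and
  \<open>HD r\<close>; they share the acting set \<open>K\<close> and the scalars inside it.
  \<open>\<theta>\<close> leads from the second sum to the first, and \<open>conj_iso\<close> is
  \<open>f \<mapsto> \<theta>\<^sup>-\<^sup>1 f \<theta>\<close>.\<close>

locale direct_sum_equivalence =
  source: direct_sum B K I M + target: direct_sum B' K J N
  for B :: "('a::comm_ring_1, 'b) module" and K :: "'b set" and I :: "'i set" and M :: "'i \<Rightarrow> 'b set"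
    and B' :: "('a, 'b) module" and J :: "'j set" and N :: "'j \<Rightarrow> 'b set" +
  fixes \<theta> :: "('j \<Rightarrow> 'b) \<Rightarrow> ('i \<Rightarrow> 'b)"
  assumes \<theta>_bij: "bij_betw \<theta> (Pi\<^sub>E J N) (Pi\<^sub>E I M)"
    and \<theta>_add: "x \<in> Pi\<^sub>E J N \<Longrightarrow> y \<in> Pi\<^sub>E J N \<Longrightarrow>
       \<theta> (\<lambda>j\<in>J. x j \<oplus>\<^bsub>B'\<^esub> y j) = (\<lambda>i\<in>I. \<theta> x i \<oplus>\<^bsub>B\<^esub> \<theta> y i)"
    and \<theta>_mult: "x \<in> Pi\<^sub>E J N \<Longrightarrow> h \<in> K \<Longrightarrow> \<theta> (\<lambda>j\<in>J. x j \<otimes>\<^bsub>B'\<^esub> h) = (\<lambda>i\<in>I. \<theta> x i \<otimes>\<^bsub>B\<^esub> h)"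
    and scalar_eq: "a \<odot>\<^bsub>B'\<^esub> \<one>\<^bsub>B'\<^esub> = a \<odot>\<^bsub>B\<^esub> \<one>\<^bsub>B\<^esub>"
begin

definition conj_iso :: "(('i \<Rightarrow> 'b) \<Rightarrow> ('i \<Rightarrow> 'b)) \<Rightarrow> ('j \<Rightarrow> 'b) \<Rightarrow> ('j \<Rightarrow> 'b)" where
  "conj_iso f = (\<lambda>x\<in>target.D. inv_into target.D \<theta> (f (\<theta> x)))"

definition conj_back :: "(('j \<Rightarrow> 'b) \<Rightarrow> ('j \<Rightarrow> 'b)) \<Rightarrow> ('i \<Rightarrow> 'b) \<Rightarrow> ('i \<Rightarrow> 'b)" where
  "conj_back g = (\<lambda>y\<in>source.D. \<theta> (g (inv_into target.D \<theta> y)))"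

abbreviation "\<theta>' \<equiv> inv_into target.D \<theta>"

lemma \<theta>_closed: "x \<in> target.D \<Longrightarrow> \<theta> x \<in> source.D"
  using \<theta>_bij by (auto simp: bij_betw_def)

lemma \<theta>'_closed: "y \<in> source.D \<Longrightarrow> \<theta>' y \<in> target.D"
  using \<theta>_bij by (metis bij_betw_def inv_into_into)

lemma \<theta>_\<theta>': "y \<in> source.D \<Longrightarrow> \<theta> (\<theta>' y) = y"
  using \<theta>_bij by (metis bij_betw_def f_inv_into_f)

lemma \<theta>'_\<theta>: "x \<in> target.D \<Longrightarrow> \<theta>' (\<theta> x) = x"
  using \<theta>_bij by (metis bij_betw_def inv_into_f_f)

lemma \<theta>'_add:
  assumes "x \<in> source.D" "y \<in> source.D"
  shows "\<theta>' (\<lambda>i\<in>I. x i \<oplus>\<^bsub>B\<^esub> y i) = (\<lambda>j\<in>J. \<theta>' x j \<oplus>\<^bsub>B'\<^esub> \<theta>' y j)"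
proof -
  have "\<theta>' (\<theta> (\<lambda>j\<in>J. \<theta>' x j \<oplus>\<^bsub>B'\<^esub> \<theta>' y j)) = (\<lambda>j\<in>J. \<theta>' x j \<oplus>\<^bsub>B'\<^esub> \<theta>' y j)"
    using assms by (intro \<theta>'_\<theta> target.D_add \<theta>'_closed)
  then show ?thesis using assms by (simp add: \<theta>_add \<theta>'_closed \<theta>_\<theta>')
qed

lemma \<theta>'_mult:
  assumes "x \<in> source.D" "h \<in> K"
  shows "\<theta>' (\<lambda>i\<in>I. x i \<otimes>\<^bsub>B\<^esub> h) = (\<lambda>j\<in>J. \<theta>' x j \<otimes>\<^bsub>B'\<^esub> h)"
proof -
  have "\<theta>' (\<theta> (\<lambda>j\<in>J. \<theta>' x j \<otimes>\<^bsub>B'\<^esub> h)) = (\<lambda>j\<in>J. \<theta>' x j \<otimes>\<^bsub>B'\<^esub> h)"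
    using assms by (intro \<theta>'_\<theta> target.D_mult \<theta>'_closed)
  then show ?thesis using assms by (simp add: \<theta>_mult \<theta>'_closed \<theta>_\<theta>')
qed

lemma \<theta>'_smult:
  assumes "x \<in> source.D"
  shows "\<theta>' (\<lambda>i\<in>I. a \<odot>\<^bsub>B\<^esub> x i) = (\<lambda>j\<in>J. a \<odot>\<^bsub>B'\<^esub> \<theta>' x j)"
  unfolding source.smult_D_eq[OF assms] target.smult_D_eq[OF \<theta>'_closed[OF assms]]
  using \<theta>'_mult[OF assms source.K_scalar] by (simp add: scalar_eq)

lemma conj_iso_closed: "f \<in> carrier source.E \<Longrightarrow> conj_iso f \<in> carrier target.E"
  unfolding conj_iso_def
  by (intro target.E_carrierI)
    (simp_all add: \<theta>'_closed source.E_closed \<theta>_closed target.D_add \<theta>_add source.E_add \<theta>'_add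
      target.D_mult \<theta>_mult source.E_mult \<theta>'_mult)

lemma conj_back_closed: "g \<in> carrier target.E \<Longrightarrow> conj_back g \<in> carrier source.E"
  unfolding conj_back_def
  by (intro source.E_carrierI)
    (simp_all add: \<theta>'_closed target.E_closed \<theta>_closed source.D_add \<theta>_add target.E_add \<theta>'_add
      source.D_mult \<theta>_mult target.E_mult \<theta>'_mult)

theorem conj_iso: "conj_iso \<in> algebra_iso source.E target.E"
proof -
  have ext: "f \<in> extensional source.D" if "f \<in> carrier source.E" for f
    using that by (auto simp: source.E_carrier PiE_iff)
  have ext': "f \<in> extensional target.D" if "f \<in> carrier target.E" for f
    using that by (auto simp: target.E_carrier PiE_iff)
  have "conj_iso \<in> ring_hom source.E target.E"
  proof (rule ring_hom_memI)
    fix f g assume fg: "f \<in> carrier source.E" "g \<in> carrier source.E"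
    show "conj_iso (f \<otimes>\<^bsub>source.E\<^esub> g) = conj_iso f \<otimes>\<^bsub>target.E\<^esub> conj_iso g"
      using fg unfolding source.E_ops target.E_ops
      by (intro extensionalityI[of _ target.D])
        (simp_all add: conj_iso_def compose_eq \<theta>_closed \<theta>'_closed source.E_closed \<theta>_\<theta>' compose_extensional)
    show "conj_iso (f \<oplus>\<^bsub>source.E\<^esub> g) = conj_iso f \<oplus>\<^bsub>target.E\<^esub> conj_iso g"
      using fg unfolding source.E_ops target.E_ops conj_iso_def
      by (intro restrict_ext) (simp add: \<theta>_closed source.E_closed \<theta>'_add)
  next
    show "conj_iso \<one>\<^bsub>source.E\<^esub> = \<one>\<^bsub>target.E\<^esub>"
      unfolding source.E_ops target.E_ops conj_iso_def
      by (intro restrict_ext) (simp add: \<theta>_closed \<theta>'_\<theta>)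
  qed (rule conj_iso_closed)
  moreover have "bij_betw conj_iso (carrier source.E) (carrier target.E)"
  proof (rule bij_betw_byWitness[where f' = conj_back])
    show "\<forall>f\<in>carrier source.E. conj_back (conj_iso f) = f"
    proof
      fix f assume f: "f \<in> carrier source.E"
      show "conj_back (conj_iso f) = f"
        by (rule extensionalityI[OF _ ext[OF f]])
          (simp_all add: f conj_iso_def conj_back_def \<theta>'_closed \<theta>_\<theta>' source.E_closed)
    qed
    show "\<forall>g\<in>carrier target.E. conj_iso (conj_back g) = g"
    proof
      fix g assume g: "g \<in> carrier target.E"
      show "conj_iso (conj_back g) = g"
        by (rule extensionalityI[OF _ ext'[OF g]])
          (simp_all add: g conj_iso_def conj_back_def \<theta>_closed \<theta>'_\<theta> target.E_closed)
    qed
  qed (auto simp: conj_iso_closed conj_back_closed)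
  moreover have "conj_iso (a \<odot>\<^bsub>source.E\<^esub> f) = a \<odot>\<^bsub>target.E\<^esub> conj_iso f" if "f \<in> carrier source.E" for a f
    using that unfolding source.E_ops target.E_ops conj_iso_def
    by (intro restrict_ext) (simp add: \<theta>_closed source.E_closed \<theta>'_smult)
  ultimately show ?thesis by (auto simp: algebra_iso_def ring_iso_def)
qed

end

section \<open>The subalgebra of type D and the decomposition
  \<open>H = K \<oplus> T\<^sub>r K\<close>\<close>

section \<open>The Hecke algebra of type D\<close>

lemma cox_group_WD_comp:
  assumes "v \<in> cox_group r" "w \<in> cox_group r"
  shows "v \<circ> w \<in> WD r \<longleftrightarrow> (v \<in> WD r \<longleftrightarrow> w \<in> WD r)"
proof -
  obtain "is" js where "is": "is \<in> lists {1..r}" "v = cox_prod r is" and js: "js \<in> lists {1..r}" "w = cox_prod r js"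
    using assms unfolding cox_group_def by blast
  have "is @ js \<in> lists {1..r}" using "is" js by simp
  from cox_prod_WD[OF this] cox_prod_WD[OF "is"(1)] cox_prod_WD[OF js(1)] show ?thesis
    unfolding "is"(2) js(2) cox_prod_append by simp
qed

lemma cox_in_WD: "i \<in> {1..r} \<Longrightarrow> cox r i \<in> WD r \<longleftrightarrow> i \<noteq> r"
  using cox_prod_WD[of "[i]" r] by simp

context hecke_B
begin

abbreviation K :: "(nat list \<Rightarrow>\<^sub>0 int poly) set set" where "K \<equiv> carrier (HD r)"

lemma HD_gens: "T ` {1..<r} \<union> {T r \<otimes>\<^bsub>H\<^esub> T (r - 1) \<otimes>\<^bsub>H\<^esub> T r} \<subseteq> carrier H"
  using rank by auto

lemma HD_simps [simp]:
  "monoid.mult (HD r) = monoid.mult H" "ring.add (HD r) = ring.add H" "one (HD r) = one H"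
  "ring.zero (HD r) = ring.zero H" "smult (HD r) = smult H"
  by (simp_all add: HD_def subalgebra_gen_def)

sublocale HD: assoc_algebra "HD r"
  unfolding HD_def by (rule H.subalgebra_gen_assoc_algebra[OF HD_gens])

lemma K_subring: "subring K H"
  unfolding HD_def by (rule H.subring_subalgebra_gen[OF HD_gens])

lemma K_scalar: "a \<odot>\<^bsub>H\<^esub> \<one>\<^bsub>H\<^esub> \<in> K"
  unfolding HD_def by (rule H.scalar_in_subalgebra_gen)

lemma K_carrier [intro]: "h \<in> K \<Longrightarrow> h \<in> carrier H"
  using subringE(1)[OF K_subring] by blast

lemma K_mult [intro]: "h \<in> K \<Longrightarrow> k \<in> K \<Longrightarrow> h \<otimes>\<^bsub>H\<^esub> k \<in> K"
  using subringE(6)[OF K_subring] by blast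

lemma K_add [intro]: "h \<in> K \<Longrightarrow> k \<in> K \<Longrightarrow> h \<oplus>\<^bsub>H\<^esub> k \<in> K"
  using subringE(7)[OF K_subring] by blast

lemma K_one: "\<one>\<^bsub>H\<^esub> \<in> K" and K_zero: "\<zero>\<^bsub>H\<^esub> \<in> K"
  using subringE(2,3)[OF K_subring] by auto

lemma K_minus: "h \<in> K \<Longrightarrow> \<ominus>\<^bsub>H\<^esub> h \<in> K"
  using subringE(5)[OF K_subring] by blast

lemma K_smult [intro]: "h \<in> K \<Longrightarrow> a \<odot>\<^bsub>H\<^esub> h \<in> K"
  using K_mult[OF K_scalar] H.smult_eq_mult K_carrier by metis

lemma T_in_K: "i \<in> {1..<r} \<Longrightarrow> T i \<in> K"
  unfolding HD_def H.carrier_subalgebra_gen by (rule generate_ring.incl) auto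

lemma T_r: "T r \<in> carrier H"
  using last_gen by (rule T_closed)

lemma T_r_T_r: "h \<in> carrier H \<Longrightarrow> T r \<otimes>\<^bsub>H\<^esub> (T r \<otimes>\<^bsub>H\<^esub> h) = h"
  using T_r T_last_square by (simp flip: H.m_assoc)

text \<open>Conjugation by \<open>T\<^sub>r\<close> fixes \<open>T i\<close> for
  \<open>i < r - 1\<close> by the commutation relation, and it sends \<open>T (r - 1)\<close> to the
  extra generator of type D.\<close>

lemma T_conj_in_K:
  assumes "i \<in> {1..<r}" shows "T r \<otimes>\<^bsub>H\<^esub> T i \<otimes>\<^bsub>H\<^esub> T r \<in> K"
proof (cases "i = r - 1")
  case True
  then show ?thesis
    unfolding HD_def H.carrier_subalgebra_gen by (intro generate_ring.incl) auto
next
  case False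
  then have i: "i \<in> {1..r}" "i + 2 \<le> r" using assms by auto
  have "T i \<otimes>\<^bsub>H\<^esub> T r = T r \<otimes>\<^bsub>H\<^esub> T i"
    using T_commute[OF i(1) last_gen i(2)] T_r i(1) by (simp add: T_word_Cons del: atLeastAtMost_iff)
  then have "T r \<otimes>\<^bsub>H\<^esub> T i \<otimes>\<^bsub>H\<^esub> T r = T i"
    using i(1) T_r T_last_square T_closed[OF i(1)] by (metis H.m_assoc H.r_one)
  then show ?thesis using T_in_K[OF assms] by simp
qed

text \<open>A letter \<open>i < r\<close> passes a leading \<open>T\<^sub>r\<close> by inserting
  \<open>T\<^sub>r T\<^sub>r = 1\<close>: \<open>T\<^sub>r T\<^sub>i h = (T\<^sub>r T\<^sub>i
  T\<^sub>r) (T\<^sub>r h)\<close>, where the first bracket lies in \<open>K\<close>.\<close>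

lemma T_word_parity:
  "is \<in> lists {1..r} \<Longrightarrow>
    (even (count_list is r) \<longrightarrow> T_word is \<in> K) \<and> (odd (count_list is r) \<longrightarrow> T r \<otimes>\<^bsub>H\<^esub> T_word is \<in> K)"
proof (induction "is")
  case Nil then show ?case by (simp add: K_one)
next
  case (Cons i "is")
  then have i: "i \<in> {1..r}" and "is": "is \<in> lists {1..r}" by auto
  note c = T_word_closed[OF "is"] T_closed[OF i] T_r and IH = Cons.IH[OF "is"]
  show ?case
  proof (cases "i = r")
    case True
    then show ?thesis using IH c by (simp add: T_word_Cons T_r_T_r)
  next
    case False
    then have i: "i \<in> {1..<r}" using i by auto
    have "T r \<otimes>\<^bsub>H\<^esub> T_word (i # is) = (T r \<otimes>\<^bsub>H\<^esub> T i \<otimes>\<^bsub>H\<^esub> T r) \<otimes>\<^bsub>H\<^esub> (T r \<otimes>\<^bsub>H\<^esub> T_word is)"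
      using c by (simp add: T_word_Cons H.m_assoc T_r_T_r)
    then show ?thesis
      using IH False K_mult[OF T_in_K[OF i]] K_mult[OF T_conj_in_K[OF i]] by (auto simp: T_word_Cons)
  qed
qed

lemma Tw_in_K:
  assumes "w \<in> cox_group r" "w \<in> WD r" shows "Tw r w \<in> K"
proof -
  obtain "is" where "is": "reduced_expr r w is" using ex_reduced_expr[OF assms(1)] by blast
  then have "is \<in> lists {1..r}" "cox_prod r is = w" by (auto simp: reduced_expr_def)
  then show ?thesis
    using cox_prod_WD[of "is" r] T_word_parity[of "is"] assms Tw_eq_T_word[OF "is"] by auto
qed

lemma H_decomposition:
  assumes "h \<in> carrier H"
  shows "\<exists>a\<in>K. \<exists>b\<in>K. h = a \<oplus>\<^bsub>H\<^esub> T r \<otimes>\<^bsub>H\<^esub> b"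
proof -
  obtain f where f: "f \<in> carrier F" "h = cls f" using assms cls_surj by metis
  have "\<exists>a\<in>K. \<exists>b\<in>K. cls f = a \<oplus>\<^bsub>H\<^esub> T r \<otimes>\<^bsub>H\<^esub> b"
    using f(1)
  proof (induction f rule: free_algebra.monoid_algebra_induct)
    case (single "is" a)
    then have "is": "is \<in> lists {1..r}" by simp
    note c = T_word_closed[OF "is"]
    show ?case
    proof (cases "even (count_list is r)")
      case True
      then have "a \<odot>\<^bsub>H\<^esub> T_word is \<in> K" using T_word_parity[OF "is"] by auto
      then show ?thesis
        using c T_r K_zero by (intro bexI[of _ "a \<odot>\<^bsub>H\<^esub> T_word is"] bexI[of _ "\<zero>\<^bsub>H\<^esub>"]) (auto simp: cls_single[OF "is"])
    next
      case False
      then have "a \<odot>\<^bsub>H\<^esub> (T r \<otimes>\<^bsub>H\<^esub> T_word is) \<in> K" using T_word_parity[OF "is"] by auto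
      then show ?thesis
        using c T_r K_zero
        by (intro bexI[of _ "\<zero>\<^bsub>H\<^esub>"] bexI[of _ "a \<odot>\<^bsub>H\<^esub> (T r \<otimes>\<^bsub>H\<^esub> T_word is)"])
          (auto simp: cls_single[OF "is"] H.smult_mult_right T_r_T_r)
    qed
  next
    case (add f g)
    then obtain a b a' b' where ab: "a \<in> K" "b \<in> K" "a' \<in> K" "b' \<in> K"
      "cls f = a \<oplus>\<^bsub>H\<^esub> T r \<otimes>\<^bsub>H\<^esub> b" "cls g = a' \<oplus>\<^bsub>H\<^esub> T r \<otimes>\<^bsub>H\<^esub> b'" by blast
    note c = K_carrier[OF ab(1)] K_carrier[OF ab(2)] K_carrier[OF ab(3)] K_carrier[OF ab(4)]
    have "cls (f + g) = (a \<oplus>\<^bsub>H\<^esub> a') \<oplus>\<^bsub>H\<^esub> T r \<otimes>\<^bsub>H\<^esub> (b \<oplus>\<^bsub>H\<^esub> b')"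
      using add.hyps c T_r by (simp add: cls_add ab H.r_distr H.a_ac)
    then show ?case using ab by blast
  qed
  then show ?thesis using f by simp
qed

text \<open>Coordinate functions living on type D or on its complement in the group;
  \<open>p\<close> selects which.\<close>

definition parity_supported :: "bool \<Rightarrow> ((nat \<Rightarrow> nat) \<Rightarrow> int poly) \<Rightarrow> bool" where
  "parity_supported p v \<longleftrightarrow> (\<forall>w. v w \<noteq> 0 \<longrightarrow> w \<in> cox_group r \<and> (w \<in> WD r \<longleftrightarrow> p))"

lemma parity_supported_supported: "parity_supported p v \<Longrightarrow> supported v"
  by (auto simp: parity_supported_def supported_def)

lemma parity_supported_act_gen:
  assumes "parity_supported p v" "i \<in> {1..<r}" shows "parity_supported p (act_gen i v)"
  unfolding parity_supported_def
proof (intro allI impI)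
  fix w assume nz: "act_gen i v w \<noteq> 0"
  then have w: "w \<in> cox_group r" using act_gen_outside by blast
  with nz assms(2) have "v (w \<circ> cox r i) \<noteq> 0 \<or> v w \<noteq> 0" by (auto simp: act_gen_def split: if_splits)
  then have "(w \<in> WD r \<longleftrightarrow> p) \<or> (w \<circ> cox r i \<in> WD r \<longleftrightarrow> p)"
    using assms(1) unfolding parity_supported_def by blast
  then show "w \<in> cox_group r \<and> (w \<in> WD r \<longleftrightarrow> p)"
    using w WD_comp_cox[OF cox_group_WB[OF w] assms(2)] by simp
qed

lemma parity_supported_act_last:
  assumes "parity_supported p v" shows "parity_supported (\<not> p) (act_gen r v)"
  unfolding parity_supported_def
proof (intro allI impI)
  fix w assume nz: "act_gen r v w \<noteq> 0"
  then have w: "w \<in> cox_group r" using act_gen_outside by blast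
  with nz have "v (w \<circ> cox r r) \<noteq> 0" by (simp add: act_gen_last)
  then have "w \<circ> cox r r \<in> WD r \<longleftrightarrow> p"
    using assms(1) unfolding parity_supported_def by blast
  then show "w \<in> cox_group r \<and> (w \<in> WD r \<longleftrightarrow> \<not> p)"
    using w WD_comp_cox_last[OF cox_group_WB[OF w]] rank by auto
qed

lemma hecke_act_zero: "supported v \<Longrightarrow> hecke_act v \<zero>\<^bsub>H\<^esub> = (\<lambda>w. 0)"
  using hecke_act_smult[of v "\<zero>\<^bsub>H\<^esub>" 0] by simp

text \<open>The generators \<open>T i\<close> with \<open>i < r\<close> keep the parity and the
  extra generator changes it twice; sums, scalars and products preserve the property.\<close>

lemma parity_supported_hecke_act:
  assumes "h \<in> K" "parity_supported p v"
  shows "parity_supported p (hecke_act v h)"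
proof -
  have scale: "parity_supported p (\<lambda>w. a * v w)" if "parity_supported p v" for a v p
    using that by (auto simp: parity_supported_def)
  have "h \<in> generate_ring H (T ` {1..<r} \<union> {T r \<otimes>\<^bsub>H\<^esub> T (r - 1) \<otimes>\<^bsub>H\<^esub> T r} \<union> range (\<lambda>a. a \<odot>\<^bsub>H\<^esub> \<one>\<^bsub>H\<^esub>))"
    using assms(1) unfolding HD_def H.carrier_subalgebra_gen .
  then have "h \<in> carrier H \<and> (\<forall>v. parity_supported p v \<longrightarrow> parity_supported p (hecke_act v h))"
  proof (induction rule: generate_ring.induct)
    case one
    then show ?case by (auto simp: hecke_act_one parity_supported_supported)
  next
    case (incl h)
    then consider i where "i \<in> {1..<r}" "h = T i" | "h = T r \<otimes>\<^bsub>H\<^esub> T (r - 1) \<otimes>\<^bsub>H\<^esub> T r" | a where "h = a \<odot>\<^bsub>H\<^esub> \<one>\<^bsub>H\<^esub>"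
      by blast
    then show ?case
    proof cases
      case 1
      then have "i \<in> {1..r}" by auto
      then show ?thesis using 1 by (simp add: hecke_act_T parity_supported_supported parity_supported_act_gen)
    next
      case 2
      have l: "r - 1 \<in> {1..<r}" "r - 1 \<in> {1..r}" using rank by auto
      note c = T_closed[OF l(2)] T_r
      have "parity_supported p (act_gen r (act_gen (r - 1) (act_gen r v)))" if "parity_supported p v" for v
        using parity_supported_act_last[OF parity_supported_act_gen[OF parity_supported_act_last[OF that] l(1)]] by simp
      then show ?thesis
        unfolding 2 using c l(2) last_gen
        by (simp add: hecke_act_mult hecke_act_T parity_supported_supported supported_act_gen del: atLeastAtMost_iff)
    next
      case 3
      then show ?thesis
        by (simp add: hecke_act_smult hecke_act_one parity_supported_supported scale)
    qed
  next
    case (a_inv h)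
    have "\<ominus>\<^bsub>H\<^esub> h = (-1) \<odot>\<^bsub>H\<^esub> h" using a_inv.IH by (simp add: H.smult_l_minus)
    then show ?case using a_inv.IH scale[of p _ "-1"] by (simp add: hecke_act_smult parity_supported_supported)
  next
    case (eng_add h k)
    have "parity_supported p (\<lambda>w. v w + u w)" if "parity_supported p v" "parity_supported p u" for u v
      using that unfolding parity_supported_def by (metis add_0)
    then show ?case using eng_add.IH by (simp add: hecke_act_add parity_supported_supported)
  next
    case (eng_mult h k)
    then show ?case by (simp add: hecke_act_mult parity_supported_supported)
  qed
  then show ?thesis using assms(2) by blast
qed

text \<open>The coordinates of \<open>a\<close> live on type D and those of
  \<open>T\<^sub>r b\<close> on the complement, so if they cancel, both vanish. Multiplying by
  \<open>T\<^sub>r\<close> then gives \<open>b = 0\<close>.\<close>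

lemma H_decomposition_unique_zero:
  assumes "a \<in> K" "b \<in> K" "a \<oplus>\<^bsub>H\<^esub> T r \<otimes>\<^bsub>H\<^esub> b = \<zero>\<^bsub>H\<^esub>"
  shows "a = \<zero>\<^bsub>H\<^esub>" "b = \<zero>\<^bsub>H\<^esub>"
proof -
  note c = K_carrier[OF assms(1)] K_carrier[OF assms(2)] T_r
  note su = supported_unit_coord
  have u: "parity_supported True unit_coord"
    using cox_prod_WD[of "[]" r] by (auto simp: parity_supported_def unit_coord_def)
  have pa: "parity_supported True (hecke_act unit_coord a)"
    by (rule parity_supported_hecke_act[OF assms(1) u])
  have pb: "parity_supported False (hecke_act unit_coord (T r \<otimes>\<^bsub>H\<^esub> b))"
    using parity_supported_hecke_act[OF assms(2) parity_supported_act_last[OF u]] c su last_gen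
    by (simp add: hecke_act_mult hecke_act_T)
  have sum0: "hecke_act unit_coord a w + hecke_act unit_coord (T r \<otimes>\<^bsub>H\<^esub> b) w = 0" for w
    using fun_cong[OF hecke_act_add[OF su c(1) H.m_closed[OF c(3,2)]], of w]
    unfolding assms(3) hecke_act_zero[OF su] by simp
  then have z: "hecke_act unit_coord a w = 0 \<and> hecke_act unit_coord (T r \<otimes>\<^bsub>H\<^esub> b) w = 0" for w
  proof -
    have "hecke_act unit_coord a w = 0 \<or> hecke_act unit_coord (T r \<otimes>\<^bsub>H\<^esub> b) w = 0"
      using pa pb unfolding parity_supported_def by blast
    then show ?thesis using sum0[of w] by auto
  qed
  then show "a = \<zero>\<^bsub>H\<^esub>"
    by (intro hecke_act_unit_coord_inj c) (simp add: fun_eq_iff)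
  have "T r \<otimes>\<^bsub>H\<^esub> b = \<zero>\<^bsub>H\<^esub>"
    using z c by (intro hecke_act_unit_coord_inj) (simp_all add: fun_eq_iff)
  then show "b = \<zero>\<^bsub>H\<^esub>" using T_r_T_r[OF c(2)] c by simp
qed

lemma H_decomposition_unique:
  assumes "a \<in> K" "b \<in> K" "a' \<in> K" "b' \<in> K" "a \<oplus>\<^bsub>H\<^esub> T r \<otimes>\<^bsub>H\<^esub> b = a' \<oplus>\<^bsub>H\<^esub> T r \<otimes>\<^bsub>H\<^esub> b'"
  shows "a = a'" "b = b'"
proof -
  note c = assms(1-4)[THEN K_carrier] T_r
  have "(a \<oplus>\<^bsub>H\<^esub> \<ominus>\<^bsub>H\<^esub> a') \<oplus>\<^bsub>H\<^esub> T r \<otimes>\<^bsub>H\<^esub> (b \<oplus>\<^bsub>H\<^esub> \<ominus>\<^bsub>H\<^esub> b') =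
      (a \<oplus>\<^bsub>H\<^esub> T r \<otimes>\<^bsub>H\<^esub> b) \<oplus>\<^bsub>H\<^esub> \<ominus>\<^bsub>H\<^esub> (a' \<oplus>\<^bsub>H\<^esub> T r \<otimes>\<^bsub>H\<^esub> b')"
    using c by (simp add: H.r_distr H.minus_add H.r_minus H.a_ac)
  also have "\<dots> = \<zero>\<^bsub>H\<^esub>" using c by (simp add: assms(5) H.r_neg)
  finally have "a \<oplus>\<^bsub>H\<^esub> \<ominus>\<^bsub>H\<^esub> a' = \<zero>\<^bsub>H\<^esub>" "b \<oplus>\<^bsub>H\<^esub> \<ominus>\<^bsub>H\<^esub> b' = \<zero>\<^bsub>H\<^esub>"
    using H_decomposition_unique_zero[of "a \<oplus>\<^bsub>H\<^esub> \<ominus>\<^bsub>H\<^esub> a'" "b \<oplus>\<^bsub>H\<^esub> \<ominus>\<^bsub>H\<^esub> b'"] assms(1-4)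
    by (auto intro: K_minus)
  then show "a = a'" "b = b'" using c by (metis H.minus_equality H.minus_minus H.a_inv_closed)+
qed

end

section \<open>Parabolic subgroups and the isomorphism of the two direct sums\<close>

section \<open>Parabolic subgroups and the isomorphism over the polynomial ring\<close>

definition parabolic_gens :: "nat \<Rightarrow> nat \<Rightarrow> nat list \<Rightarrow> nat set" where
  "parabolic_gens n r l = {j \<in> {1..r}. j \<notin> {sum_list (take i l) | i. 1 \<le> i \<and> i \<le> n}}"

lemma parabolic_gens_subset: "j \<in> parabolic_gens n r l \<Longrightarrow> j \<in> {1..r}"
  by (simp add: parabolic_gens_def)

lemma Lam_sum: "l \<in> Lam (n + 1) r \<Longrightarrow> sum_list (take n l) + l ! n = r"
proof -
  assume "l \<in> Lam (n + 1) r"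
  then have "length l = n + 1" "sum_list l = r" by (auto simp: Lam_def)
  moreover from this have "l = take n l @ [l ! n]" by (metis Suc_eq_plus1 lessI order_refl take_Suc_conv_app_nth take_all)
  ultimately show ?thesis by (metis add_0_right sum_list.Cons sum_list.Nil sum_list_append)
qed

lemma sum_list_take_mono: "i \<le> j \<Longrightarrow> sum_list (take i l) \<le> sum_list (take j (l::nat list))"
  by (metis append_take_drop_id le_add1 min.absorb1 sum_list_append take_take)

text \<open>The excluded indices are the partial sums of the first \<open>n\<close> entries; they
  increase up to \<open>r - l ! n\<close>, which is itself one of them as
  \<open>n \<ge> 1\<close>.\<close>

lemma last_in_parabolic_gens:
  assumes "l \<in> Lam (n + 1) r" "1 \<le> n" "1 \<le> r"
  shows "r \<in> parabolic_gens n r l \<longleftrightarrow> l ! n \<noteq> 0"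
proof
  assume "r \<in> parabolic_gens n r l"
  then have "sum_list (take n l) \<noteq> r" using assms(2) by (auto simp: parabolic_gens_def)
  then show "l ! n \<noteq> 0" using Lam_sum[OF assms(1)] by auto
next
  assume "l ! n \<noteq> 0"
  then have "sum_list (take i l) \<noteq> r" if "i \<le> n" for i
    using Lam_sum[OF assms(1)] sum_list_take_mono[OF that, of l] by auto
  then show "r \<in> parabolic_gens n r l" using assms(3) by (auto simp: parabolic_gens_def)
qed

lemma parabolic_B_comp: "v \<in> parabolic_B n r l \<Longrightarrow> w \<in> parabolic_B n r l \<Longrightarrow> v \<circ> w \<in> parabolic_B n r l"
  unfolding parabolic_B_def using generate.eng[of v "sym_group (2*r)" _ w] by (simp add: sym_group_mult)

lemma parabolic_B_gen: "j \<in> parabolic_gens n r l \<Longrightarrow> cox r j \<in> parabolic_B n r l"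
  unfolding parabolic_B_def parabolic_gens_def by (rule generate.incl) blast

text \<open>The generators are involutions, so the case of inverses falls together with the case of
  generators.\<close>

lemma parabolic_B_induct [consumes 1, case_names one gen comp]:
  assumes "w \<in> parabolic_B n r l"
    and one: "Q id" and gen: "\<And>j. j \<in> parabolic_gens n r l \<Longrightarrow> Q (cox r j)"
    and comp: "\<And>v w. Q v \<Longrightarrow> Q w \<Longrightarrow> Q (v \<circ> w)"
  shows "Q w"
proof -
  have "w \<in> generate (sym_group (2*r)) (cox r ` parabolic_gens n r l)"
    using assms(1) unfolding parabolic_B_def parabolic_gens_def .
  then show ?thesis
  proof (induction rule: generate.induct)
    case one then show ?case using assms(2) by (simp only: sym_group_one)
  next
    case (incl h) then show ?case using gen by blast
  next
    case (inv h)
    then obtain j where j: "j \<in> parabolic_gens n r l" "h = cox r j" by blast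
    note j' = parabolic_gens_subset[OF j(1)]
    have "inv\<^bsub>sym_group (2*r)\<^esub> h = h"
      by (rule group.inv_equality[OF sym_group_is_group])
        (use j(2) j' cox_permutes[OF j'] in \<open>auto simp: sym_group_mult sym_group_one sym_group_carrier\<close>)
    then show ?case using gen[OF j(1)] j(2) by simp
  next
    case (eng v w) then show ?case using comp by (simp only: sym_group_mult)
  qed
qed

lemma parabolic_B_cox_group: "w \<in> parabolic_B n r l \<Longrightarrow> w \<in> cox_group r"
  by (induction rule: parabolic_B_induct)
    (rule id_cox_group, rule cox_cox_group[OF parabolic_gens_subset], assumption, rule cox_group_comp)

lemma finite_parabolic_B: "finite (parabolic_B n r l)"
  by (rule finite_subset[OF _ finite_cox_group]) (auto intro: parabolic_B_cox_group)

lemma parabolic_B_WD: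
  assumes "w \<in> parabolic_B n r l" "r \<notin> parabolic_gens n r l"
  shows "w \<in> WD r"
proof -
  have "w \<in> cox_group r \<and> w \<in> WD r"
    using assms(1)
  proof (induction rule: parabolic_B_induct)
    case one
    have "id \<in> WD r" using cox_prod_WD[of "[]" r] by simp
    then show ?case by (simp only: id_cox_group simp_thms)
  next
    case (gen j)
    then have j: "j \<in> {1..r}" "j \<noteq> r" using parabolic_gens_subset assms(2) by auto
    then show ?case using cox_in_WD[of j r] cox_cox_group[of j r] by blast
  next
    case (comp v w)
    then show ?case using cox_group_WD_comp[of v r w] cox_group_comp[of v r w] by blast
  qed
  then show ?thesis ..
qed

lemma finite_Lam: "finite (Lam m r)"
proof (rule finite_subset)
  show "Lam m r \<subseteq> {l. set l \<subseteq> {..r} \<and> length l = m}"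
    by (auto simp: Lam_def intro: member_le_sum_list)
  show "finite {l. set l \<subseteq> {..r} \<and> length l = m}"
    by (rule finite_lists_length_eq) simp
qed

text \<open>With \<open>upper\<close>: the symbols whose modules carry the two components of an
  element of \<open>x\<^sub>\<lambda> H\<close> in \<open>K \<oplus> T\<^sub>r K\<close>. For dotted
  symbols they coincide, so that one formula for \<open>theta\<close> covers both cases.\<close>

definition lower :: "nat \<Rightarrow> nat list \<Rightarrow> D_index" where
  "lower n l = (if l ! n \<noteq> 0 then Dot l else Plus l)"

definition upper :: "nat \<Rightarrow> nat list \<Rightarrow> D_index" where
  "upper n l = (if l ! n \<noteq> 0 then Dot l else Minus l)"

lemma LamD_eq: "LamD n r = lower n ` Lam (n + 1) r \<union> upper n ` Lam (n + 1) r"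
  unfolding LamD_def lower_def upper_def by (auto simp: image_iff)

lemma lower_in: "l \<in> Lam (n + 1) r \<Longrightarrow> lower n l \<in> LamD n r"
  and upper_in: "l \<in> Lam (n + 1) r \<Longrightarrow> upper n l \<in> LamD n r"
  unfolding LamD_eq by blast+

lemma finite_LamD: "finite (LamD n r)"
  unfolding LamD_eq by (simp add: finite_Lam)

locale hecke_modules = hecke_B +
  fixes n :: nat
  assumes n: "1 \<le> n"
begin

lemma xB_closed: "xB n r l \<in> carrier H"
  unfolding xB_def by (intro H.finsum_closed) (auto intro: parabolic_B_cox_group)

lemma Tw_parabolic: "w \<in> parabolic_B n r l \<Longrightarrow> Tw r w \<in> carrier H"
  by (intro Tw_closed parabolic_B_cox_group)

text \<open>Composition with \<open>s\<^sub>r\<close> permutes the parabolic subgroup, and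
  \<open>T\<^sub>r\<close> follows it on the elements \<open>Tw\<close> without
  coefficients.\<close>

lemma xB_mult_last:
  assumes "r \<in> parabolic_gens n r l" shows "xB n r l \<otimes>\<^bsub>H\<^esub> T r = xB n r l"
proof -
  let ?P = "parabolic_B n r l" and ?s = "\<lambda>w. w \<circ> cox r r"
  have sub: "?s w \<in> ?P" if "w \<in> ?P" for w
    by (rule parabolic_B_comp[OF that parabolic_B_gen[OF assms]])
  have img: "?s ` ?P = ?P"
  proof
    show "?P \<subseteq> ?s ` ?P"
    proof
      fix w assume "w \<in> ?P"
      then show "w \<in> ?s ` ?P"
        using sub last_gen by (intro image_eqI[of _ _ "?s w"]) (simp_all only: comp_cox_cox)
    qed
  qed (use sub in blast)
  have inj: "inj_on ?s ?P"
    by (rule inj_on_inverseI[of _ ?s]) (use last_gen in \<open>simp only: comp_cox_cox\<close>)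
  have "xB n r l \<otimes>\<^bsub>H\<^esub> T r = finsum H (\<lambda>w. Tw r w \<otimes>\<^bsub>H\<^esub> T r) ?P"
    unfolding xB_def using T_r by (intro H.finsum_ldistr finite_parabolic_B) (auto intro: Tw_parabolic[of _ l])
  also have "\<dots> = finsum H (\<lambda>w. Tw r (?s w)) ?P"
    by (rule H.finsum_cong') (auto simp: Tw_mult_last parabolic_B_cox_group sub Tw_parabolic[of _ l] simp del: o_apply)
  also have "\<dots> = finsum H (Tw r) (?s ` ?P)"
    by (rule H.finsum_reindex[OF _ inj, symmetric]) (auto simp: sub Tw_parabolic[of _ l] simp del: o_apply)
  finally show ?thesis by (simp add: xB_def img)
qed

lemma xD_Dot_in_K: "xD n r (Dot l) \<in> K"
  unfolding xD_def parabolic_D.simps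
proof -
  have "finsum H (Tw r) Q \<in> K" if "finite Q" "Q \<subseteq> cox_group r \<inter> WD r" for Q
    using that
  proof (induction Q)
    case empty then show ?case by (simp add: K_zero)
  next
    case (insert w Q)
    then have "finsum H (Tw r) (insert w Q) = Tw r w \<oplus>\<^bsub>H\<^esub> finsum H (Tw r) Q"
      by (intro H.finsum_insert) auto
    then show ?case using insert Tw_in_K[of w] by auto
  qed
  moreover have "finite (parabolic_B n r l \<inter> WD r)" by (simp add: finite_parabolic_B)
  moreover have "parabolic_B n r l \<inter> WD r \<subseteq> cox_group r \<inter> WD r" by (auto intro: parabolic_B_cox_group)
  ultimately show "finsum H (Tw r) (parabolic_B n r l \<inter> WD r) \<in> K" .
qed

text \<open>The parabolic subgroup is the disjoint union of its even part and
  \<open>s\<^sub>r\<close> times that part, as \<open>s\<^sub>r\<close> changes the parity;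
  \<open>T\<^sub>r\<close> carries one sum to the other.\<close>

lemma xB_Dot:
  assumes "r \<in> parabolic_gens n r l"
  shows "xB n r l = xD n r (Dot l) \<oplus>\<^bsub>H\<^esub> T r \<otimes>\<^bsub>H\<^esub> xD n r (Dot l)"
proof -
  let ?P = "parabolic_B n r l" and ?s = "\<lambda>w. cox r r \<circ> w"
  let ?Q = "?P \<inter> WD r"
  have G: "w \<in> cox_group r" if "w \<in> ?P" for w by (rule parabolic_B_cox_group[OF that])
  have sub: "?s w \<in> ?P" if "w \<in> ?P" for w
    by (rule parabolic_B_comp[OF parabolic_B_gen[OF assms] that])
  have ss: "?s (?s w) = w" for w using last_gen by (simp add: fun_eq_iff)
  have par: "?s w \<in> WD r \<longleftrightarrow> w \<notin> WD r" if "w \<in> ?P" for w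
    using cox_group_WD_comp[OF cox_cox_group[OF last_gen] G[OF that]] cox_in_WD[OF last_gen] by simp
  have img: "?s ` ?Q = ?P - WD r"
  proof
    show "?s ` ?Q \<subseteq> ?P - WD r" using sub par by blast
    show "?P - WD r \<subseteq> ?s ` ?Q"
    proof
      fix w assume "w \<in> ?P - WD r"
      then show "w \<in> ?s ` ?Q"
        using sub par by (intro image_eqI[of _ _ "?s w"]) (auto simp only: ss IntI DiffD1 DiffD2)
    qed
  qed
  have inj: "inj_on ?s ?Q" by (rule inj_on_inverseI[of _ ?s]) (rule ss)
  have "xB n r l = finsum H (Tw r) (?Q \<union> (?P - WD r))"
    unfolding xB_def by (rule arg_cong[where f = "finsum H (Tw r)"]) blast
  also have "\<dots> = finsum H (Tw r) ?Q \<oplus>\<^bsub>H\<^esub> finsum H (Tw r) (?P - WD r)"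
    by (rule H.finsum_Un_disjoint) (auto simp: finite_parabolic_B Tw_parabolic[of _ l])
  also have "finsum H (Tw r) (?P - WD r) = finsum H (\<lambda>w. Tw r (?s w)) ?Q"
    unfolding img[symmetric] by (rule H.finsum_reindex[OF _ inj]) (auto simp: sub Tw_parabolic[of _ l] simp del: o_apply)
  also have "\<dots> = finsum H (\<lambda>w. T r \<otimes>\<^bsub>H\<^esub> Tw r w) ?Q"
    using T_r by (intro H.finsum_cong') (auto simp: last_mult_Tw G sub Tw_parabolic[of _ l] simp del: o_apply)
  also have "\<dots> = T r \<otimes>\<^bsub>H\<^esub> finsum H (Tw r) ?Q"
    using T_r by (intro H.finsum_rdistr[symmetric]) (auto simp: finite_parabolic_B Tw_parabolic[of _ l])
  finally show ?thesis by (simp add: xD_def)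
qed

lemma xD_Plus: "xD n r (Plus l) = xB n r l"
  by (simp add: xD_def xB_def)

text \<open>\<open>T\<^sub>r\<close> permutes the elements \<open>Tw\<close> from both sides, so
  conjugating the index set by \<open>s\<^sub>r\<close> conjugates the sum by
  \<open>T\<^sub>r\<close>.\<close>

lemma xD_Minus: "xD n r (Minus l) = T r \<otimes>\<^bsub>H\<^esub> xB n r l \<otimes>\<^bsub>H\<^esub> T r"
proof -
  let ?P = "parabolic_B n r l" and ?c = "\<lambda>w. cox r r \<circ> w \<circ> cox r r"
  have G: "w \<in> cox_group r" if "w \<in> ?P" for w by (rule parabolic_B_cox_group[OF that])
  have G': "cox r r \<circ> w \<in> cox_group r" "?c w \<in> cox_group r" if "w \<in> ?P" for w
    using cox_group_comp[OF cox_cox_group[OF last_gen] G[OF that]] comp_cox_group[OF last_gen] by auto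
  have cc: "?c (?c w) = w" for w using last_gen by (simp add: fun_eq_iff)
  have inj: "inj_on ?c ?P" by (rule inj_on_inverseI[of _ ?c]) (rule cc)
  have "xD n r (Minus l) = finsum H (\<lambda>w. Tw r (?c w)) ?P"
    unfolding xD_def parabolic_D.simps
    by (rule H.finsum_reindex[OF _ inj]) (auto simp del: o_apply intro: Tw_closed G')
  also have "\<dots> = finsum H (\<lambda>w. (T r \<otimes>\<^bsub>H\<^esub> Tw r w) \<otimes>\<^bsub>H\<^esub> T r) ?P"
    using T_r by (intro H.finsum_cong')
      (auto simp: last_mult_Tw Tw_mult_last G G' Tw_parabolic[of _ l] simp del: o_apply intro!: Tw_closed G')
  also have "\<dots> = finsum H (\<lambda>w. T r \<otimes>\<^bsub>H\<^esub> Tw r w) ?P \<otimes>\<^bsub>H\<^esub> T r"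
    using T_r by (intro H.finsum_ldistr[symmetric] finite_parabolic_B) (auto intro!: Tw_parabolic[of _ l])
  also have "finsum H (\<lambda>w. T r \<otimes>\<^bsub>H\<^esub> Tw r w) ?P = T r \<otimes>\<^bsub>H\<^esub> xB n r l"
    unfolding xB_def using T_r by (intro H.finsum_rdistr[symmetric] finite_parabolic_B) (auto intro!: Tw_parabolic[of _ l])
  finally show ?thesis .
qed

lemma xB_in_K:
  assumes "r \<notin> parabolic_gens n r l" shows "xB n r l \<in> K"
proof -
  have "parabolic_B n r l \<inter> WD r = parabolic_B n r l" using parabolic_B_WD[OF _ assms] by blast
  then show ?thesis using xD_Dot_in_K[of l] by (simp add: xD_def xB_def)
qed

text \<open>Conjugation by \<open>T\<^sub>r\<close> is multiplicative because
  \<open>T\<^sub>r\<close> is its own inverse, and it permutes the generators of \<open>K\<close>,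
  exchanging \<open>T (r - 1)\<close> with the extra one.\<close>

lemma T_r_conj_in_K:
  assumes "h \<in> K" shows "T r \<otimes>\<^bsub>H\<^esub> h \<otimes>\<^bsub>H\<^esub> T r \<in> K"
proof -
  have "h \<in> generate_ring H (T ` {1..<r} \<union> {T r \<otimes>\<^bsub>H\<^esub> T (r - 1) \<otimes>\<^bsub>H\<^esub> T r} \<union> range (\<lambda>a. a \<odot>\<^bsub>H\<^esub> \<one>\<^bsub>H\<^esub>))"
    using assms unfolding HD_def H.carrier_subalgebra_gen .
  then have "h \<in> carrier H \<and> T r \<otimes>\<^bsub>H\<^esub> h \<otimes>\<^bsub>H\<^esub> T r \<in> K"
  proof (induction rule: generate_ring.induct)
    case one then show ?case using T_r T_last_square by (simp add: K_one)
  next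
    case (incl h)
    then consider i where "i \<in> {1..<r}" "h = T i" | "h = T r \<otimes>\<^bsub>H\<^esub> T (r - 1) \<otimes>\<^bsub>H\<^esub> T r" | a where "h = a \<odot>\<^bsub>H\<^esub> \<one>\<^bsub>H\<^esub>"
      by blast
    then show ?case
    proof cases
      case 1
      then show ?thesis using T_conj_in_K[of i] by auto
    next
      case 2
      have l: "r - 1 \<in> {1..<r}" "r - 1 \<in> {1..r}" using rank by auto
      have "T r \<otimes>\<^bsub>H\<^esub> h \<otimes>\<^bsub>H\<^esub> T r = T (r - 1)"
        unfolding 2 using T_closed[OF l(2)] T_r T_last_square by (simp add: H.m_assoc T_r_T_r)
      then show ?thesis using T_in_K[OF l(1)] T_closed[OF l(2)] T_r 2 by simp
    next
      case 3
      then show ?thesis using T_r T_last_square K_scalar by (simp add: H.smult_mult_right H.smult_mult_left)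
    qed
  next
    case (a_inv h) then show ?case using T_r K_minus by (auto simp: H.r_minus H.l_minus)
  next
    case (eng_add h k) then show ?case using T_r by (auto simp: H.l_distr H.r_distr)
  next
    case (eng_mult h k)
    have "T r \<otimes>\<^bsub>H\<^esub> (h \<otimes>\<^bsub>H\<^esub> k) \<otimes>\<^bsub>H\<^esub> T r = (T r \<otimes>\<^bsub>H\<^esub> h \<otimes>\<^bsub>H\<^esub> T r) \<otimes>\<^bsub>H\<^esub> (T r \<otimes>\<^bsub>H\<^esub> k \<otimes>\<^bsub>H\<^esub> T r)"
      using eng_mult.IH T_r by (simp add: H.m_assoc T_r_T_r)
    then show ?case using eng_mult.IH by auto
  qed
  then show ?thesis ..
qed

lemma xD_in_K:
  assumes "\<alpha> \<in> LamD n r" shows "xD n r \<alpha> \<in> K"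
proof -
  obtain l where l: "l \<in> Lam (n + 1) r" and \<alpha>: "\<alpha> = Dot l \<or> \<alpha> = Plus l \<and> l ! n = 0 \<or> \<alpha> = Minus l \<and> l ! n = 0"
    using assms unfolding LamD_def by blast
  have "xB n r l \<in> K" if "l ! n = 0"
    using that last_in_parabolic_gens[OF l n] rank by (intro xB_in_K) simp
  then show ?thesis using \<alpha> xD_Dot_in_K xD_Plus xD_Minus T_r_conj_in_K by auto
qed

lemma in_D_module_iff: "z \<in> D_module n r \<alpha> \<longleftrightarrow> (\<exists>h\<in>K. z = xD n r \<alpha> \<otimes>\<^bsub>H\<^esub> h)"
  by (simp add: D_module_def in_l_coset_iff)

lemma D_module_K: "\<alpha> \<in> LamD n r \<Longrightarrow> z \<in> D_module n r \<alpha> \<Longrightarrow> z \<in> K"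
  unfolding in_D_module_iff using xD_in_K by blast

text \<open>The implication in the statement joins the two cases: for dotted symbols the pair of
  components is diagonal, otherwise the components are independent.\<close>

lemma xB_module_decomposition:
  assumes l: "l \<in> Lam (n + 1) r"
  shows "y \<in> xB n r l <#\<^bsub>H\<^esub> carrier H \<longleftrightarrow>
    (\<exists>a\<in>D_module n r (lower n l). \<exists>b\<in>D_module n r (upper n l).
       (lower n l = upper n l \<longrightarrow> a = b) \<and> y = a \<oplus>\<^bsub>H\<^esub> T r \<otimes>\<^bsub>H\<^esub> b)"
proof (cases "l ! n = 0")
  case False
  then have gen: "r \<in> parabolic_gens n r l" using last_in_parabolic_gens[OF l n] rank by simp
  let ?x = "xD n r (Dot l)"
  have x: "?x \<in> K" "?x \<in> carrier H" using xD_Dot_in_K by auto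
  have lu: "lower n l = Dot l" "upper n l = Dot l" using False by (simp_all add: lower_def upper_def)
  have *: "xB n r l \<otimes>\<^bsub>H\<^esub> k = ?x \<otimes>\<^bsub>H\<^esub> k \<oplus>\<^bsub>H\<^esub> T r \<otimes>\<^bsub>H\<^esub> (?x \<otimes>\<^bsub>H\<^esub> k)" if "k \<in> carrier H" for k
    unfolding xB_Dot[OF gen] using x(2) T_r that by (simp add: H.l_distr H.m_assoc)
  show ?thesis
    unfolding lu in_l_coset_iff
  proof
    assume "\<exists>h\<in>carrier H. y = xB n r l \<otimes>\<^bsub>H\<^esub> h"
    then obtain h where h: "h \<in> carrier H" "y = xB n r l \<otimes>\<^bsub>H\<^esub> h" by blast
    obtain a b where ab: "a \<in> K" "b \<in> K" "h = a \<oplus>\<^bsub>H\<^esub> T r \<otimes>\<^bsub>H\<^esub> b" using H_decomposition[OF h(1)] by blast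
    note c = K_carrier[OF ab(1)] K_carrier[OF ab(2)] T_r xB_closed[of l]
    have "y = xB n r l \<otimes>\<^bsub>H\<^esub> a \<oplus>\<^bsub>H\<^esub> (xB n r l \<otimes>\<^bsub>H\<^esub> T r) \<otimes>\<^bsub>H\<^esub> b"
      unfolding h(2) ab(3) using c by (simp add: H.r_distr H.m_assoc)
    \<comment> \<open>\<open>x\<^sub>\<lambda>\<close> absorbs \<open>T\<^sub>r\<close>, so the two
      components of \<open>h\<close> merge into \<open>a + b\<close>.\<close>
    also have "\<dots> = xB n r l \<otimes>\<^bsub>H\<^esub> (a \<oplus>\<^bsub>H\<^esub> b)"
      unfolding xB_mult_last[OF gen] using c by (simp add: H.r_distr)
    finally have y: "y = ?x \<otimes>\<^bsub>H\<^esub> (a \<oplus>\<^bsub>H\<^esub> b) \<oplus>\<^bsub>H\<^esub> T r \<otimes>\<^bsub>H\<^esub> (?x \<otimes>\<^bsub>H\<^esub> (a \<oplus>\<^bsub>H\<^esub> b))"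
      using *[of "a \<oplus>\<^bsub>H\<^esub> b"] c by simp
    have "a \<oplus>\<^bsub>H\<^esub> b \<in> K" using ab by blast
    then have "?x \<otimes>\<^bsub>H\<^esub> (a \<oplus>\<^bsub>H\<^esub> b) \<in> D_module n r (Dot l)" unfolding in_D_module_iff by blast
    with y show "\<exists>a\<in>D_module n r (Dot l). \<exists>b\<in>D_module n r (Dot l). (Dot l = Dot l \<longrightarrow> a = b) \<and> y = a \<oplus>\<^bsub>H\<^esub> T r \<otimes>\<^bsub>H\<^esub> b"
      by blast
  next
    assume "\<exists>a\<in>D_module n r (Dot l). \<exists>b\<in>D_module n r (Dot l). (Dot l = Dot l \<longrightarrow> a = b) \<and> y = a \<oplus>\<^bsub>H\<^esub> T r \<otimes>\<^bsub>H\<^esub> b"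
    then obtain a where a: "a \<in> D_module n r (Dot l)" "y = a \<oplus>\<^bsub>H\<^esub> T r \<otimes>\<^bsub>H\<^esub> a" by blast
    then obtain k where "k \<in> K" "a = ?x \<otimes>\<^bsub>H\<^esub> k" unfolding in_D_module_iff by blast
    then show "\<exists>h\<in>carrier H. y = xB n r l \<otimes>\<^bsub>H\<^esub> h"
      using * a(2) by (intro bexI[of _ k]) auto
  qed
next
  case True
  let ?x = "xB n r l"
  have x: "?x \<in> carrier H" by (rule xB_closed)
  have lu: "lower n l = Plus l" "upper n l = Minus l" using True by (simp_all add: lower_def upper_def)
  \<comment> \<open>Inserting \<open>T\<^sub>r T\<^sub>r = 1\<close> in front of
    \<open>x\<^sub>\<lambda> T\<^sub>r\<close> produces \<open>T\<^sub>r\<close> times the element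
    of the minus symbol.\<close>
  have *: "?x \<otimes>\<^bsub>H\<^esub> (a \<oplus>\<^bsub>H\<^esub> T r \<otimes>\<^bsub>H\<^esub> b) =
     xD n r (Plus l) \<otimes>\<^bsub>H\<^esub> a \<oplus>\<^bsub>H\<^esub> T r \<otimes>\<^bsub>H\<^esub> (xD n r (Minus l) \<otimes>\<^bsub>H\<^esub> b)" if "a \<in> K" "b \<in> K" for a b
    unfolding xD_Plus xD_Minus using that[THEN K_carrier] x T_r
    by (simp add: H.r_distr H.m_assoc T_r_T_r)
  have "y \<in> ?x <#\<^bsub>H\<^esub> carrier H \<longleftrightarrow> (\<exists>a\<in>K. \<exists>b\<in>K. y = ?x \<otimes>\<^bsub>H\<^esub> (a \<oplus>\<^bsub>H\<^esub> T r \<otimes>\<^bsub>H\<^esub> b))"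
    unfolding in_l_coset_iff
  proof
    assume "\<exists>h\<in>carrier H. y = ?x \<otimes>\<^bsub>H\<^esub> h"
    then show "\<exists>a\<in>K. \<exists>b\<in>K. y = ?x \<otimes>\<^bsub>H\<^esub> (a \<oplus>\<^bsub>H\<^esub> T r \<otimes>\<^bsub>H\<^esub> b)" using H_decomposition by metis
  next
    assume "\<exists>a\<in>K. \<exists>b\<in>K. y = ?x \<otimes>\<^bsub>H\<^esub> (a \<oplus>\<^bsub>H\<^esub> T r \<otimes>\<^bsub>H\<^esub> b)"
    then show "\<exists>h\<in>carrier H. y = ?x \<otimes>\<^bsub>H\<^esub> h" using T_r K_carrier by (metis H.a_closed H.m_closed)
  qed
  also have "\<dots> \<longleftrightarrow> (\<exists>a\<in>D_module n r (Plus l). \<exists>b\<in>D_module n r (Minus l). y = a \<oplus>\<^bsub>H\<^esub> T r \<otimes>\<^bsub>H\<^esub> b)"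
    using * in_D_module_iff by (metis (no_types, lifting))
  finally show ?thesis unfolding lu by simp
qed

sublocale kappa: direct_sum H K "Lam (n + 1) r" "\<lambda>l. xB n r l <#\<^bsub>H\<^esub> carrier H"
proof (rule H.direct_sum_principal[OF K_subring])
  show "K \<subseteq> carrier H" by (rule subringE(1)[OF K_subring])
qed (rule K_scalar xB_closed H.carrier_is_subring)+

sublocale typeD: direct_sum "HD r" K "LamD n r" "D_module n r"
proof -
  have eq: "D_module n r = (\<lambda>\<alpha>. xD n r \<alpha> <#\<^bsub>HD r\<^esub> K)" by (rule ext) (rule D_module_def)
  show "direct_sum (HD r) K (LamD n r) (D_module n r)"
    unfolding eq
  proof (rule HD.direct_sum_principal)
    show "subring K (HD r)" by (rule HD.carrier_is_subring)
    show "a \<odot>\<^bsub>HD r\<^esub> \<one>\<^bsub>HD r\<^esub> \<in> K" for a using K_scalar by simp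
  qed (use xD_in_K HD.carrier_is_subring in simp_all)
qed

definition theta :: "(D_index \<Rightarrow> (nat list \<Rightarrow>\<^sub>0 int poly) set) \<Rightarrow> nat list \<Rightarrow> (nat list \<Rightarrow>\<^sub>0 int poly) set" where
  "theta x = (\<lambda>l\<in>Lam (n + 1) r. x (lower n l) \<oplus>\<^bsub>H\<^esub> T r \<otimes>\<^bsub>H\<^esub> x (upper n l))"

lemma D_value_K: "x \<in> typeD.D \<Longrightarrow> \<alpha> \<in> LamD n r \<Longrightarrow> x \<alpha> \<in> K"
  using D_module_K[of \<alpha> "x \<alpha>"] PiE_mem[of x "LamD n r" "D_module n r" \<alpha>] by blast

lemma theta_closed:
  assumes x: "x \<in> typeD.D" shows "theta x \<in> kappa.D"
proof (rule PiE_I)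
  fix l assume l: "l \<in> Lam (n + 1) r"
  have "x (lower n l) \<in> D_module n r (lower n l)" "x (upper n l) \<in> D_module n r (upper n l)"
    using PiE_mem[OF x] lower_in[OF l] upper_in[OF l] by auto
  then show "theta x l \<in> xB n r l <#\<^bsub>H\<^esub> carrier H"
    unfolding xB_module_decomposition[OF l]
    by (rule_tac bexI[of _ "x (lower n l)"], rule_tac bexI[of _ "x (upper n l)"]) (use l in \<open>auto simp: theta_def\<close>)
qed (auto simp: theta_def restrict_def)

lemma theta_inj: "inj_on theta typeD.D"
proof (rule inj_onI)
  fix x y assume xy: "x \<in> typeD.D" "y \<in> typeD.D" "theta x = theta y"
  have "x (lower n l) = y (lower n l) \<and> x (upper n l) = y (upper n l)" if l: "l \<in> Lam (n + 1) r" for l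
  proof -
    have "x (lower n l) \<oplus>\<^bsub>H\<^esub> T r \<otimes>\<^bsub>H\<^esub> x (upper n l) = y (lower n l) \<oplus>\<^bsub>H\<^esub> T r \<otimes>\<^bsub>H\<^esub> y (upper n l)"
      using fun_cong[OF xy(3), of l] l by (simp add: theta_def)
    note H_decomposition_unique[OF D_value_K[OF xy(1) lower_in[OF l]] D_value_K[OF xy(1) upper_in[OF l]]
        D_value_K[OF xy(2) lower_in[OF l]] D_value_K[OF xy(2) upper_in[OF l]] this]
    then show ?thesis by simp
  qed
  then show "x = y"
    by (intro PiE_ext[OF xy(1,2)]) (auto simp: LamD_eq)
qed

lemma theta_surj:
  assumes y: "y \<in> kappa.D" shows "y \<in> theta ` typeD.D"
proof -
  have "\<forall>l\<in>Lam (n + 1) r. \<exists>p. fst p \<in> D_module n r (lower n l) \<and> snd p \<in> D_module n r (upper n l) \<and>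
       (lower n l = upper n l \<longrightarrow> fst p = snd p) \<and> y l = fst p \<oplus>\<^bsub>H\<^esub> T r \<otimes>\<^bsub>H\<^esub> snd p"
  proof
    fix l assume l: "l \<in> Lam (n + 1) r"
    from xB_module_decomposition[OF l, THEN iffD1, OF PiE_mem[OF y l]] obtain a b where
      "a \<in> D_module n r (lower n l)" "b \<in> D_module n r (upper n l)" "lower n l = upper n l \<longrightarrow> a = b"
      "y l = a \<oplus>\<^bsub>H\<^esub> T r \<otimes>\<^bsub>H\<^esub> b" by blast
    then show "\<exists>p. fst p \<in> D_module n r (lower n l) \<and> snd p \<in> D_module n r (upper n l) \<and>
       (lower n l = upper n l \<longrightarrow> fst p = snd p) \<and> y l = fst p \<oplus>\<^bsub>H\<^esub> T r \<otimes>\<^bsub>H\<^esub> snd p"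
      by (intro exI[of _ "(a, b)"]) simp
  qed
  then obtain p where p: "\<And>l. l \<in> Lam (n + 1) r \<Longrightarrow> fst (p l) \<in> D_module n r (lower n l) \<and> snd (p l) \<in> D_module n r (upper n l) \<and>
       (lower n l = upper n l \<longrightarrow> fst (p l) = snd (p l)) \<and> y l = fst (p l) \<oplus>\<^bsub>H\<^esub> T r \<otimes>\<^bsub>H\<^esub> snd (p l)"
    unfolding bchoice_iff by blast
  \<comment> \<open>For dotted symbols the two entries of \<open>p l\<close> agree, so
    \<open>fst\<close> serves both \<open>lower\<close> and \<open>upper\<close>.\<close>
  define x where "x = (\<lambda>\<alpha>\<in>LamD n r. case \<alpha> of Dot l \<Rightarrow> fst (p l) | Plus l \<Rightarrow> fst (p l) | Minus l \<Rightarrow> snd (p l))"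
  have xl: "x (lower n l) = fst (p l)" "x (upper n l) = snd (p l)" if l: "l \<in> Lam (n + 1) r" for l
    using lower_in[OF l] upper_in[OF l] p[OF l] by (auto simp: x_def lower_def upper_def split: if_splits)
  have "x \<in> typeD.D"
  proof (rule PiE_I)
    fix \<alpha> assume "\<alpha> \<in> LamD n r"
    then show "x \<alpha> \<in> D_module n r \<alpha>" unfolding LamD_eq using xl p by auto
  qed (simp add: x_def restrict_def)
  moreover have "theta x = y"
  proof (rule extensionalityI[of _ "Lam (n + 1) r"])
    show "y \<in> extensional (Lam (n + 1) r)" using y by (simp add: PiE_iff)
  qed (use xl p in \<open>simp_all add: theta_def\<close>)
  ultimately show ?thesis by blast
qed

sublocale equivalence: direct_sum_equivalence H K "Lam (n + 1) r" "\<lambda>l. xB n r l <#\<^bsub>H\<^esub> carrier H"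
  "HD r" "LamD n r" "D_module n r" theta
proof (intro direct_sum_equivalence.intro direct_sum_equivalence_axioms.intro kappa.direct_sum_axioms
    typeD.direct_sum_axioms, goal_cases)
  case 1
  have "theta ` typeD.D = kappa.D"
    by (rule equalityI) (rule image_subsetI, erule theta_closed, rule subsetI, erule theta_surj)
  with theta_inj show ?case by (rule bij_betw_imageI)
next
  case (2 x y)
  show ?case
    unfolding theta_def
  proof (rule restrict_ext)
    fix l assume l: "l \<in> Lam (n + 1) r"
    note lu = lower_in[OF l] upper_in[OF l]
    note c = D_value_K[OF 2(1) lu(1), THEN K_carrier] D_value_K[OF 2(1) lu(2), THEN K_carrier]
       D_value_K[OF 2(2) lu(1), THEN K_carrier] D_value_K[OF 2(2) lu(2), THEN K_carrier] T_r
    show "(\<lambda>j\<in>LamD n r. x j \<oplus>\<^bsub>HD r\<^esub> y j) (lower n l) \<oplus>\<^bsub>H\<^esub> T r \<otimes>\<^bsub>H\<^esub> (\<lambda>j\<in>LamD n r. x j \<oplus>\<^bsub>HD r\<^esub> y j) (upper n l) =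
      (\<lambda>l\<in>Lam (n + 1) r. x (lower n l) \<oplus>\<^bsub>H\<^esub> T r \<otimes>\<^bsub>H\<^esub> x (upper n l)) l \<oplus>\<^bsub>H\<^esub>
      (\<lambda>l\<in>Lam (n + 1) r. y (lower n l) \<oplus>\<^bsub>H\<^esub> T r \<otimes>\<^bsub>H\<^esub> y (upper n l)) l"
      using l lu c by (simp add: H.r_distr H.a_ac)
  qed
next
  case (3 x h)
  show ?case
    unfolding theta_def
  proof (rule restrict_ext)
    fix l assume l: "l \<in> Lam (n + 1) r"
    note lu = lower_in[OF l] upper_in[OF l]
    note c = D_value_K[OF 3(1) lu(1), THEN K_carrier] D_value_K[OF 3(1) lu(2), THEN K_carrier] K_carrier[OF 3(2)] T_r
    show "(\<lambda>j\<in>LamD n r. x j \<otimes>\<^bsub>HD r\<^esub> h) (lower n l) \<oplus>\<^bsub>H\<^esub> T r \<otimes>\<^bsub>H\<^esub> (\<lambda>j\<in>LamD n r. x j \<otimes>\<^bsub>HD r\<^esub> h) (upper n l) =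
      (\<lambda>l\<in>Lam (n + 1) r. x (lower n l) \<oplus>\<^bsub>H\<^esub> T r \<otimes>\<^bsub>H\<^esub> x (upper n l)) l \<otimes>\<^bsub>H\<^esub> h"
      using l lu c by (simp add: H.l_distr H.m_assoc)
  qed
next
  case (4 a) then show ?case by simp
qed

lemma S_kappa_eq: "S_kappa n r = kappa.E"
  by (simp add: S_kappa_def)

lemma S_D_eq: "S_D n r = typeD.E"
  by (simp add: S_D_def)

lemma conj_iso_S: "equivalence.conj_iso \<in> algebra_iso (S_kappa n r) (S_D n r)"
  unfolding S_kappa_eq S_D_eq by (rule equivalence.conj_iso)

end

section \<open>Laurent polynomials over \<int>[q]: even and odd exponents\<close>

section \<open>Laurent polynomials as an algebra over polynomials in the square\<close>

text \<open>The structure map \<open>q \<mapsto> \<upsilon>\<^sup>2\<close> of the base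
  change.\<close>

definition eval_sq :: "int poly \<Rightarrow> laurent" where
  "eval_sq p = poly (map_poly of_int p) (upsilon ^ 2)"

definition upow :: "int \<Rightarrow> laurent" where
  "upow k = Poly_Mapping.single k 1"

lemma upow_add: "upow (j + k) = upow j * upow k"
  by (simp add: upow_def mult_single)

lemma upow_0 [simp]: "upow 0 = 1"
  by (simp add: upow_def)

lemma upow_inverse [simp]: "upow k * upow (- k) = 1"
  by (simp flip: upow_add)

lemma upow_nat: "upow (2 * int n) = (upsilon ^ 2) ^ n"
proof (induction n)
  case (Suc n)
  have "upow (2 * int (Suc n)) = upow 1 * upow 1 * upow (2 * int n)"
    by (simp add: algebra_simps flip: upow_add)
  then show ?case using Suc by (simp add: upow_def upsilon_def power2_eq_square mult_ac)
qed simp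

lemma eval_sq_add: "eval_sq (p + q) = eval_sq p + eval_sq q"
proof -
  have "map_poly of_int (p + q) = (map_poly of_int p + map_poly of_int q :: laurent poly)"
    by (rule poly_eqI) (simp add: coeff_map_poly)
  then show ?thesis by (simp add: eval_sq_def)
qed

lemma eval_sq_mult: "eval_sq (p * q) = eval_sq p * eval_sq q"
proof -
  have "map_poly of_int (p * q) = (map_poly of_int p * map_poly of_int q :: laurent poly)"
    by (rule poly_eqI) (simp add: coeff_map_poly coeff_mult)
  then show ?thesis by (simp add: eval_sq_def)
qed

lemma eval_sq_1 [simp]: "eval_sq 1 = 1"
  by (simp add: eval_sq_def)

lemma eval_sq_0 [simp]: "eval_sq 0 = 0"
  by (simp add: eval_sq_def)

lemma eval_sq_uminus: "eval_sq (- p) = - eval_sq p"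
  using eval_sq_add[of p "- p"] by (simp add: eq_neg_iff_add_eq_0 add.commute)

lemma eval_sq_diff: "eval_sq (p - q) = eval_sq p - eval_sq q"
  using eval_sq_add[of p "- q"] by (simp add: eval_sq_uminus)

lemma eval_sq_monom: "eval_sq (Polynomial.monom 1 n) = upow (2 * int n)"
  by (simp add: eval_sq_def map_poly_monom poly_monom upow_nat)

lemma eval_sq_altdef: "eval_sq p = (\<Sum>i\<le>Polynomial.degree p. Poly_Mapping.single (2 * int i) (Polynomial.coeff p i))"
proof -
  have "of_int c * upow k = Poly_Mapping.single k c" for c k
    using mult_single[of 0 c k 1] by (simp add: upow_def flip: single_of_int)
  then show ?thesis
    by (simp add: eval_sq_def poly_altdef degree_map_poly coeff_map_poly flip: upow_nat)
qed

lemma upsilon_eval_sq_altdef: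
  "upsilon * eval_sq p = (\<Sum>i\<le>Polynomial.degree p. Poly_Mapping.single (2 * int i + 1) (Polynomial.coeff p i))"
  by (simp add: eval_sq_altdef sum_distrib_left upsilon_def mult_single add.commute)

text \<open>\<open>eval_sq p\<close> has only even exponents and \<open>upsilon * eval_sq q\<close>
  only odd ones, so they cannot cancel.\<close>

lemma eval_sq_independent:
  assumes "eval_sq p + upsilon * eval_sq q = 0"
  shows "p = 0" "q = 0"
proof -
  have zero: "Poly_Mapping.lookup (eval_sq p) k + Poly_Mapping.lookup (upsilon * eval_sq q) k = 0" for k
    using assms by (simp flip: lookup_add)
  note zero = zero[unfolded upsilon_eval_sq_altdef, unfolded eval_sq_altdef]
  have odd_ne: "2 * int i \<noteq> 2 * int j + 1" "2 * int i + 1 \<noteq> 2 * int j" for i j by presburger+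
  have "Polynomial.coeff p j = 0" for j
    using zero[of "2 * int j"] coeff_eq_0[of p j]
    by (simp add: lookup_sum lookup_single when_def odd_ne split: if_splits)
  then show "p = 0" by (simp add: poly_eq_iff)
  have "Polynomial.coeff q j = 0" for j
    using zero[of "2 * int j + 1"] coeff_eq_0[of q j]
    by (simp add: lookup_sum lookup_single when_def odd_ne split: if_splits)
  then show "q = 0" by (simp add: poly_eq_iff)
qed

lemma laurent_normal_form:
  obtains N :: nat and p q where "z = upow (- 2 * int N) * (eval_sq p + upsilon * eval_sq q)"
proof -
  have "\<exists>N p q. upow (2 * int N) * z = eval_sq p + upsilon * eval_sq q"
    using subset_UNIV
  proof (induction z rule: frag_induction)
    case zero
    show ?case by (rule exI[of _ 0], rule exI[of _ 0], rule exI[of _ 0]) simp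
  next
    case (one k)
    \<comment> \<open>The shift by \<open>2 * \<bar>k\<bar>\<close> is even, hence a power of
      \<open>\<upsilon>\<^sup>2\<close>, and large enough to make the exponent non-negative; the
      parity of \<open>m\<close> decides which of \<open>p\<close> and \<open>q\<close> is the
      monomial.\<close>
    define m where "m = nat (2 * int (nat \<bar>k\<bar>) + k)"
    have m: "2 * int (nat \<bar>k\<bar>) + k = int m" by (simp add: m_def)
    have *: "upow (2 * int (nat \<bar>k\<bar>)) * frag_of k = upow (int m)"
      using upow_add[of "2 * int (nat \<bar>k\<bar>)" k] m by (simp add: upow_def)
    show ?case
    proof (cases "even m")
      case True
      then obtain j where "m = 2 * j" by blast
      then show ?thesis unfolding *
        by (intro exI[of _ "nat \<bar>k\<bar>"] exI[of _ "Polynomial.monom 1 j"] exI[of _ 0])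
          (use * in \<open>simp add: eval_sq_monom\<close>)
    next
      case False
      then obtain j where "m = 2 * j + 1" by (elim oddE)
      then have "upow (int m) = upsilon * upow (2 * int j)"
        using upow_add[of 1 "2 * int j"] by (simp add: upsilon_def upow_def add.commute)
      then show ?thesis
        by (intro exI[of _ "nat \<bar>k\<bar>"] exI[of _ 0] exI[of _ "Polynomial.monom 1 j"])
          (use * in \<open>simp add: eval_sq_monom\<close>)
    qed
  next
    case (diff a b)
    then obtain N p q M p' q' where
      a: "upow (2 * int N) * a = eval_sq p + upsilon * eval_sq q" and
      b: "upow (2 * int M) * b = eval_sq p' + upsilon * eval_sq q'" by blast
    have "upow (2 * int (N + M)) = upow (2 * int N) * upow (2 * int M)"
      by (simp add: distrib_left flip: upow_add)
    then have "upow (2 * int (N + M)) * (a - b) =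
      upow (2 * int M) * (upow (2 * int N) * a) - upow (2 * int N) * (upow (2 * int M) * b)"
      by (simp add: algebra_simps)
    also have "\<dots> = eval_sq (Polynomial.monom 1 M * p - Polynomial.monom 1 N * p') + upsilon * eval_sq (Polynomial.monom 1 M * q - Polynomial.monom 1 N * q')"
      unfolding a b by (simp add: eval_sq_diff eval_sq_mult eval_sq_monom algebra_simps)
    finally show ?case by blast
  qed
  then obtain N p q where *: "upow (2 * int N) * z = eval_sq p + upsilon * eval_sq q" by blast
  have "z = upow (- 2 * int N) * (upow (2 * int N) * z)"
    by (simp flip: mult.assoc upow_add)
  then show thesis using * that by metis
qed

lemma laurent_algebra_simps [simp]:
  "carrier laurent_algebra = UNIV" "monoid.mult laurent_algebra = (*)" "one laurent_algebra = 1"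
  "ring.zero laurent_algebra = 0" "ring.add laurent_algebra = (+)" "smult laurent_algebra p z = eval_sq p * z"
  by (simp_all add: laurent_algebra_def eval_sq_def)

lemma assoc_algebra_laurent: "assoc_algebra laurent_algebra"
proof (rule assoc_algebraI)
  show "ring laurent_algebra"
    by (intro ringI abelian_groupI monoidI) (auto simp: algebra_simps intro: exI[of _ "- x" for x])
qed (simp_all add: eval_sq_add eval_sq_mult algebra_simps)

section \<open>Tensor products of algebras and base change\<close>

section \<open>Tensor products and base change\<close>

locale tensor_product = B: assoc_algebra B + C: assoc_algebra C
  for B :: "('a::comm_ring_1, 'b) module" and C :: "('a, 'c) module"
begin

abbreviation TF :: "(int, 'b \<times> 'c \<Rightarrow>\<^sub>0 int) module" where "TF \<equiv> tensor_free B C"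
abbreviation TI :: "('b \<times> 'c \<Rightarrow>\<^sub>0 int) set" where "TI \<equiv> tensor_ideal B C"
abbreviation Q :: "('b \<times> 'c \<Rightarrow>\<^sub>0 int) set ring" where "Q \<equiv> TF Quot TI"
abbreviation pt :: "'b \<Rightarrow> 'c \<Rightarrow> ('b \<times> 'c \<Rightarrow>\<^sub>0 int) set" where "pt \<equiv> pure_tensor B C"

sublocale TF: monoid_algebra_of "B \<times>\<times> C" TF
proof (rule monoid_algebra_of.intro)
  show "monoid (B \<times>\<times> C)" by (rule DirProd_monoid[OF B.monoid_axioms C.monoid_axioms])
  show "TF \<equiv> monoid_algebra (B \<times>\<times> C)" by (simp add: tensor_free_def)
qed

sublocale TF: assoc_algebra TF
  by (rule TF.assoc_algebra_monoid_algebra)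

lemma TF_simps:
  "carrier TF = {f. Poly_Mapping.keys f \<subseteq> carrier B \<times> carrier C}"
  "ring.add TF = (+)" "ring.zero TF = 0" "one TF = frag_of (\<one>\<^bsub>B\<^esub>, \<one>\<^bsub>C\<^esub>)"
  by (simp_all add: tensor_free_def monoid_algebra_def)

lemma frag_of_TF: "b \<in> carrier B \<Longrightarrow> c \<in> carrier C \<Longrightarrow> frag_of (b, c) \<in> carrier TF"
  by (simp add: TF_simps)

lemma frag_of_mult: "frag_of (b, c) \<otimes>\<^bsub>TF\<^esub> frag_of (b', c') = frag_of (b \<otimes>\<^bsub>B\<^esub> b', c \<otimes>\<^bsub>C\<^esub> c')"
  by (simp add: TF.monoid_algebra_mult_single)

lemma tensor_rels_cases:
  assumes "x \<in> tensor_rels B C"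
  obtains (left) b b' c where "b \<in> carrier B" "b' \<in> carrier B" "c \<in> carrier C"
      "x = frag_of (b \<oplus>\<^bsub>B\<^esub> b', c) - frag_of (b, c) - frag_of (b', c)"
    | (right) b c c' where "b \<in> carrier B" "c \<in> carrier C" "c' \<in> carrier C"
      "x = frag_of (b, c \<oplus>\<^bsub>C\<^esub> c') - frag_of (b, c) - frag_of (b, c')"
    | (scalar) a b c where "b \<in> carrier B" "c \<in> carrier C"
      "x = frag_of (a \<odot>\<^bsub>B\<^esub> b, c) - frag_of (b, a \<odot>\<^bsub>C\<^esub> c)"
  using assms unfolding tensor_rels_def Let_def
  by (elim UnE CollectE exE conjE)
    ((rule left[rotated 3], assumption+) | (rule right[rotated 3], assumption+) | (rule scalar[rotated 2], assumption+))+

lemma tensor_relsI: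
  "b \<in> carrier B \<Longrightarrow> b' \<in> carrier B \<Longrightarrow> c \<in> carrier C \<Longrightarrow>
     frag_of (b \<oplus>\<^bsub>B\<^esub> b', c) - frag_of (b, c) - frag_of (b', c) \<in> tensor_rels B C"
  "b \<in> carrier B \<Longrightarrow> c \<in> carrier C \<Longrightarrow> c' \<in> carrier C \<Longrightarrow>
     frag_of (b, c \<oplus>\<^bsub>C\<^esub> c') - frag_of (b, c) - frag_of (b, c') \<in> tensor_rels B C"
  "b \<in> carrier B \<Longrightarrow> c \<in> carrier C \<Longrightarrow>
     frag_of (a \<odot>\<^bsub>B\<^esub> b, c) - frag_of (b, a \<odot>\<^bsub>C\<^esub> c) \<in> tensor_rels B C"
  unfolding tensor_rels_def Let_def by blast+

lemma tensor_rels_carrier: "x \<in> tensor_rels B C \<Longrightarrow> x \<in> carrier TF"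
  by (erule tensor_rels_cases) (simp_all add: TF.monoid_algebra_diff frag_of_TF)

lemma tensor_rels_mult:
  assumes "x \<in> tensor_rels B C" "b0 \<in> carrier B" "c0 \<in> carrier C"
  shows "frag_of (b0, c0) \<otimes>\<^bsub>TF\<^esub> x \<in> tensor_rels B C" "x \<otimes>\<^bsub>TF\<^esub> frag_of (b0, c0) \<in> tensor_rels B C"
  using assms
  by (cases rule: tensor_rels_cases;
      simp add: TF.monoid_algebra_l_diff TF.monoid_algebra_r_diff frag_of_mult tensor_relsI
        B.l_distr B.r_distr C.l_distr C.r_distr B.smult_mult_left B.smult_mult_right C.smult_mult_left C.smult_mult_right)+

lemma TI_subgroup: "subgroup TI (add_monoid TF)"
  unfolding tensor_ideal_def by (rule TF.add.generate_is_subgroup) (auto intro: tensor_rels_carrier)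

lemma TI_0: "0 \<in> TI"
  using subgroup.one_closed[OF TI_subgroup] by (simp add: TF_simps)

lemma TI_add: "x \<in> TI \<Longrightarrow> y \<in> TI \<Longrightarrow> x + y \<in> TI"
  using subgroup.m_closed[OF TI_subgroup, of x y] by (simp add: TF_simps)

lemma TI_carrier: "x \<in> TI \<Longrightarrow> x \<in> carrier TF"
  using subgroup.subset[OF TI_subgroup] by auto

lemma TI_minus: "x \<in> TI \<Longrightarrow> - x \<in> TI"
  using subgroup.m_inv_closed[OF TI_subgroup, of x] TF.monoid_algebra_minus[OF TI_carrier]
  by (simp flip: a_inv_def)

lemma TI_rels: "x \<in> tensor_rels B C \<Longrightarrow> x \<in> TI"
  unfolding tensor_ideal_def by (rule generate.incl)

lemma TI_induct [consumes 1, case_names zero rel minus add]: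
  assumes "x \<in> TI" "P 0" "\<And>x. x \<in> tensor_rels B C \<Longrightarrow> P x"
    "\<And>x. x \<in> TI \<Longrightarrow> P x \<Longrightarrow> P (- x)" "\<And>x y. x \<in> TI \<Longrightarrow> y \<in> TI \<Longrightarrow> P x \<Longrightarrow> P y \<Longrightarrow> P (x + y)"
  shows "P x"
  using assms(1)[unfolded tensor_ideal_def]
proof (induction rule: generate.induct)
  case one then show ?case using assms(2) by (simp add: TF_simps)
next
  case (incl h) then show ?case by (rule assms(3))
next
  case (inv h)
  have "inv\<^bsub>add_monoid TF\<^esub> h = - h"
    using TF.monoid_algebra_minus[OF tensor_rels_carrier[OF inv]] by (simp add: a_inv_def)
  then show ?case using assms(3,4) inv TI_rels by simp
next
  case (eng h1 h2) then show ?case using assms(5) by (simp add: tensor_ideal_def TF_simps)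
qed

lemma TI_mult:
  assumes "x \<in> carrier TF" "y \<in> TI"
  shows "x \<otimes>\<^bsub>TF\<^esub> y \<in> TI \<and> y \<otimes>\<^bsub>TF\<^esub> x \<in> TI"
proof -
  have "Poly_Mapping.keys x \<subseteq> carrier B \<times> carrier C" using assms(1) by (simp add: TF_simps)
  then show ?thesis
  proof (induction x rule: frag_induction)
    case zero then show ?case using TI_0 by (simp add: TF.monoid_algebra_zero_mult)
  next
    case (one p)
    then obtain b c where p: "p = (b, c)" "b \<in> carrier B" "c \<in> carrier C" by blast
    show ?case
      using assms(2)
    proof (induction y rule: TI_induct)
      case zero then show ?case using TI_0 by (simp add: TF.monoid_algebra_zero_mult)
    next
      case (rel y) then show ?case using tensor_rels_mult[OF rel p(2,3)] p(1) TI_rels by simp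
    next
      case (minus y)
      then show ?case
        using TF.monoid_algebra_l_diff[of 0 y "frag_of p"] TF.monoid_algebra_r_diff[of "frag_of p" 0 y]
        by (simp add: TF.monoid_algebra_zero_mult TI_minus)
    next
      case (add y z) then show ?case by (simp add: TF.monoid_algebra_l_distr TF.monoid_algebra_r_distr TI_add)
    qed
  next
    case (diff f g)
    then show ?case
      using TI_add[OF _ TI_minus] by (simp add: TF.monoid_algebra_l_diff TF.monoid_algebra_r_diff)
  qed
qed

lemma TI_ideal: "ideal TI TF"
  by (rule idealI[OF TF.ring_axioms TI_subgroup]) (use TI_mult in auto)

sublocale TI: ideal TI TF by (rule TI_ideal)

sublocale Q: ring Q by (rule TI.quotient_is_ring)

abbreviation cls :: "('b \<times> 'c \<Rightarrow>\<^sub>0 int) \<Rightarrow> ('b \<times> 'c \<Rightarrow>\<^sub>0 int) set" where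
  "cls x \<equiv> TI +>\<^bsub>TF\<^esub> x"

lemma pt_eq_cls: "pt b c = cls (frag_of (b, c))"
  by (simp add: pure_tensor_def)

lemmas cls_hom = TI.rcos_ring_hom

lemma cls_add: "x \<in> carrier TF \<Longrightarrow> y \<in> carrier TF \<Longrightarrow> cls (x + y) = cls x \<oplus>\<^bsub>Q\<^esub> cls y"
  using ring_hom_add[OF cls_hom, of x y] by (simp add: TF_simps)

lemma cls_closed [simp]: "x \<in> carrier TF \<Longrightarrow> cls x \<in> carrier Q"
  by (rule ring_hom_closed[OF cls_hom])

lemma cls_eqI: "x \<in> carrier TF \<Longrightarrow> y \<in> carrier TF \<Longrightarrow> x - y \<in> TI \<Longrightarrow> cls x = cls y"
  using TF.quotient_eq_iff_same_a_r_cos[OF TI_ideal, of x y] by (simp add: TF.monoid_algebra_diff)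

lemma cls_0: "cls 0 = \<zero>\<^bsub>Q\<^esub>"
proof -
  have "cls 0 \<oplus>\<^bsub>Q\<^esub> cls 0 = cls 0"
    using cls_add[of 0 0] TF.zero_closed by (simp add: TF_simps)
  then show ?thesis using cls_closed[of 0] TF.zero_closed by (simp add: TF_simps)
qed

lemma cls_minus: "x \<in> carrier TF \<Longrightarrow> cls (- x) = \<ominus>\<^bsub>Q\<^esub> cls x"
  using cls_add[of "- x" x] TF.a_inv_closed[of x] TF.monoid_algebra_minus[of x]
  by (intro Q.minus_equality[symmetric]) (auto simp: cls_0)

lemma pt_closed [simp, intro]: "b \<in> carrier B \<Longrightarrow> c \<in> carrier C \<Longrightarrow> pt b c \<in> carrier Q"
  unfolding pt_eq_cls by (intro cls_closed frag_of_TF)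

lemma pt_add_left:
  assumes "b \<in> carrier B" "b' \<in> carrier B" "c \<in> carrier C"
  shows "pt (b \<oplus>\<^bsub>B\<^esub> b') c = pt b c \<oplus>\<^bsub>Q\<^esub> pt b' c"
proof -
  have "cls (frag_of (b \<oplus>\<^bsub>B\<^esub> b', c)) = cls (frag_of (b, c) + frag_of (b', c))"
    using assms TF.a_closed[OF frag_of_TF frag_of_TF] TI_rels[OF tensor_relsI(1)[OF assms]]
    by (intro cls_eqI frag_of_TF) (auto simp: TF_simps(2) diff_diff_eq)
  then show ?thesis using assms by (simp add: pt_eq_cls cls_add frag_of_TF)
qed

lemma pt_add_right:
  assumes "b \<in> carrier B" "c \<in> carrier C" "c' \<in> carrier C"
  shows "pt b (c \<oplus>\<^bsub>C\<^esub> c') = pt b c \<oplus>\<^bsub>Q\<^esub> pt b c'"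
proof -
  have "cls (frag_of (b, c \<oplus>\<^bsub>C\<^esub> c')) = cls (frag_of (b, c) + frag_of (b, c'))"
    using assms TF.a_closed[OF frag_of_TF frag_of_TF] TI_rels[OF tensor_relsI(2)[OF assms]]
    by (intro cls_eqI frag_of_TF) (auto simp: TF_simps(2) diff_diff_eq)
  then show ?thesis using assms by (simp add: pt_eq_cls cls_add frag_of_TF)
qed

lemma pt_scalar:
  assumes "b \<in> carrier B" "c \<in> carrier C"
  shows "pt (a \<odot>\<^bsub>B\<^esub> b) c = pt b (a \<odot>\<^bsub>C\<^esub> c)"
  unfolding pt_eq_cls
  using assms TI_rels[OF tensor_relsI(3)[OF assms]] by (intro cls_eqI frag_of_TF) auto

lemma pt_mult:
  assumes "b \<in> carrier B" "c \<in> carrier C" "b' \<in> carrier B" "c' \<in> carrier C"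
  shows "pt b c \<otimes>\<^bsub>Q\<^esub> pt b' c' = pt (b \<otimes>\<^bsub>B\<^esub> b') (c \<otimes>\<^bsub>C\<^esub> c')"
  using ring_hom_mult[OF cls_hom, of "frag_of (b, c)" "frag_of (b', c')"] assms
  by (simp add: pt_eq_cls frag_of_TF frag_of_mult)

lemma pt_one: "pt \<one>\<^bsub>B\<^esub> \<one>\<^bsub>C\<^esub> = \<one>\<^bsub>Q\<^esub>"
  using ring_hom_one[OF cls_hom] by (simp add: pt_eq_cls TF_simps)

lemma Q_induct [consumes 1, case_names pt add minus]:
  assumes "y \<in> carrier Q" "\<And>b c. b \<in> carrier B \<Longrightarrow> c \<in> carrier C \<Longrightarrow> P (pt b c)"
    and add: "\<And>x y. x \<in> carrier Q \<Longrightarrow> y \<in> carrier Q \<Longrightarrow> P x \<Longrightarrow> P y \<Longrightarrow> P (x \<oplus>\<^bsub>Q\<^esub> y)"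
    and minus: "\<And>x. x \<in> carrier Q \<Longrightarrow> P x \<Longrightarrow> P (\<ominus>\<^bsub>Q\<^esub> x)"
  shows "P y"
proof -
  obtain x where x: "x \<in> carrier TF" "y = cls x"
    using assms(1) by (auto simp: FactRing_def A_RCOSETS_def RCOSETS_def a_r_coset_def)
  \<comment> \<open>Zero is obtained from \<open>add\<close> and \<open>minus\<close> applied to the
    pure tensor of the units.\<close>
  have zero: "P \<zero>\<^bsub>Q\<^esub>"
  proof -
    have 1: "pt \<one>\<^bsub>B\<^esub> \<one>\<^bsub>C\<^esub> \<in> carrier Q" "P (pt \<one>\<^bsub>B\<^esub> \<one>\<^bsub>C\<^esub>)" using assms(2) by auto
    from add[OF _ _ minus[OF 1] 1(2)] 1(1) show ?thesis by (simp add: Q.l_neg)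
  qed
  have "Poly_Mapping.keys x \<subseteq> carrier B \<times> carrier C" using x(1) by (simp add: TF_simps)
  then have "x \<in> carrier TF \<and> P (cls x)"
  proof (induction x rule: frag_induction)
    case zero then show ?case using \<open>P \<zero>\<^bsub>Q\<^esub>\<close> TF.zero_closed by (simp add: cls_0) (simp add: TF_simps)
  next
    case (one p)
    then obtain b c where "p = (b, c)" "b \<in> carrier B" "c \<in> carrier C" by blast
    then show ?case using assms(2) frag_of_TF by (simp flip: pt_eq_cls)
  next
    case (diff f g)
    have g: "- g \<in> carrier TF" using TF.a_inv_closed[of g] TF.monoid_algebra_minus[of g] diff by simp
    have "cls (f - g) = cls f \<oplus>\<^bsub>Q\<^esub> \<ominus>\<^bsub>Q\<^esub> cls g"
      using cls_add[of f "- g"] diff g by (simp add: cls_minus)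
    then show ?case using diff add minus by (simp add: TF.monoid_algebra_diff)
  qed
  then show ?thesis using x by simp
qed

lemma base_change_simps [simp]:
  "carrier (base_change B C) = carrier Q" "monoid.mult (base_change B C) = monoid.mult Q"
  "one (base_change B C) = one Q" "ring.zero (base_change B C) = ring.zero Q"
  "ring.add (base_change B C) = ring.add Q"
  "smult (base_change B C) c y = pt \<one>\<^bsub>B\<^esub> c \<otimes>\<^bsub>Q\<^esub> y"
  by (simp_all add: base_change_def Let_def ring.extend_def)

end

section \<open>Extensions of scalars described by normal forms\<close>

section \<open>Extension of scalars to Laurent polynomials\<close>

abbreviation qpow :: "nat \<Rightarrow> int poly" where "qpow n \<equiv> Polynomial.monom 1 n"

text \<open>The Laurent polynomials are free over their even part \<open>\<int>[\<upsilon>\<^sup>2, \<upsilon>\<^sup>-\<^sup>2]\<close> with basis \<open>1, \<upsilon>\<close>.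
  So the elements of a base change \<open>C\<close> of \<open>B\<close> have the form \<open>\<upsilon>\<^sup>-\<^sup>2\<^sup>N (\<iota> b + \<upsilon> \<iota> b')\<close>, and when
  \<open>b\<close> and \<open>b'\<close> are unique for fixed \<open>N\<close> this form determines \<open>C\<close>.\<close>

locale laurent_scalars = B: lin_module B + C: lin_module C
  for B :: "(int poly, 'b) module" and C :: "(laurent, 'c) module" +
  fixes \<iota> :: "'b \<Rightarrow> 'c"
  assumes \<iota>_closed [simp, intro]: "b \<in> carrier B \<Longrightarrow> \<iota> b \<in> carrier C"
    and \<iota>_add: "b \<in> carrier B \<Longrightarrow> d \<in> carrier B \<Longrightarrow> \<iota> (b \<oplus>\<^bsub>B\<^esub> d) = \<iota> b \<oplus>\<^bsub>C\<^esub> \<iota> d"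
    and \<iota>_smult: "b \<in> carrier B \<Longrightarrow> \<iota> (a \<odot>\<^bsub>B\<^esub> b) = eval_sq a \<odot>\<^bsub>C\<^esub> \<iota> b"
begin

definition nf :: "'b \<Rightarrow> 'b \<Rightarrow> 'c" where "nf b b' = \<iota> b \<oplus>\<^bsub>C\<^esub> upsilon \<odot>\<^bsub>C\<^esub> \<iota> b'"

text \<open>Only even powers of \<open>\<upsilon>\<close> serve as denominators: they are powers of
  \<open>q\<close>, so they can be cleared inside \<open>B\<close>.\<close>

definition frac :: "nat \<Rightarrow> 'b \<Rightarrow> 'b \<Rightarrow> 'c" where "frac N b b' = upow (- 2 * int N) \<odot>\<^bsub>C\<^esub> nf b b'"

lemma \<iota>_zero: "\<iota> \<zero>\<^bsub>B\<^esub> = \<zero>\<^bsub>C\<^esub>"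
  using \<iota>_smult[of "\<zero>\<^bsub>B\<^esub>" 0] by simp

lemma nf_closed [simp, intro]: "b \<in> carrier B \<Longrightarrow> b' \<in> carrier B \<Longrightarrow> nf b b' \<in> carrier C"
  by (simp add: nf_def)

lemma frac_closed [simp, intro]: "b \<in> carrier B \<Longrightarrow> b' \<in> carrier B \<Longrightarrow> frac N b b' \<in> carrier C"
  by (simp add: frac_def)

lemma nf_add:
  "b \<in> carrier B \<Longrightarrow> b' \<in> carrier B \<Longrightarrow> d \<in> carrier B \<Longrightarrow> d' \<in> carrier B \<Longrightarrow>
    nf b b' \<oplus>\<^bsub>C\<^esub> nf d d' = nf (b \<oplus>\<^bsub>B\<^esub> d) (b' \<oplus>\<^bsub>B\<^esub> d')"
  by (simp add: nf_def \<iota>_add C.smult_r_distr C.a_ac)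

lemma nf_smult:
  "b \<in> carrier B \<Longrightarrow> b' \<in> carrier B \<Longrightarrow> eval_sq a \<odot>\<^bsub>C\<^esub> nf b b' = nf (a \<odot>\<^bsub>B\<^esub> b) (a \<odot>\<^bsub>B\<^esub> b')"
  by (simp add: nf_def \<iota>_smult C.smult_r_distr) (metis C.smult_commute \<iota>_closed)

lemma nf_upsilon:
  assumes "b \<in> carrier B" "b' \<in> carrier B"
  shows "upsilon \<odot>\<^bsub>C\<^esub> nf b b' = nf (qpow 1 \<odot>\<^bsub>B\<^esub> b') b"
proof -
  have "upsilon * upsilon = eval_sq (qpow 1)"
    using upow_add[of 1 1] by (simp add: eval_sq_monom) (simp add: upow_def upsilon_def)
  then show ?thesis
    using assms by (simp add: nf_def \<iota>_smult C.smult_r_distr C.a_comm flip: C.smult_assoc1)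
qed

lemma nf_minus: "b \<in> carrier B \<Longrightarrow> b' \<in> carrier B \<Longrightarrow> \<ominus>\<^bsub>C\<^esub> nf b b' = nf (\<ominus>\<^bsub>B\<^esub> b) (\<ominus>\<^bsub>B\<^esub> b')"
  using nf_smult[of b b' "-1"] by (simp add: eval_sq_uminus B.smult_l_minus C.smult_l_minus)

lemma upow_frac:
  assumes "b \<in> carrier B" "b' \<in> carrier B"
  shows "upow (2 * int (N + k)) \<odot>\<^bsub>C\<^esub> frac N b b' = nf (qpow k \<odot>\<^bsub>B\<^esub> b) (qpow k \<odot>\<^bsub>B\<^esub> b')"
proof -
  have "upow (2 * int (N + k)) * upow (- 2 * int N) = eval_sq (qpow k)"
    by (simp add: eval_sq_monom flip: upow_add)
  then show ?thesis using assms by (simp add: frac_def nf_smult flip: C.smult_assoc1)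
qed

lemma frac_upow:
  assumes "y \<in> carrier C" "upow (2 * int N) \<odot>\<^bsub>C\<^esub> y = nf b b'"
  shows "y = frac N b b'"
  unfolding frac_def assms(2)[symmetric] using assms(1) by (simp flip: C.smult_assoc1 upow_add)

text \<open>Expansion of a fraction by \<open>q\<^sup>k\<close>; it puts finitely many fractions
  over one denominator.\<close>

lemma frac_raise:
  assumes "b \<in> carrier B" "b' \<in> carrier B"
  shows "frac N b b' = frac (N + k) (qpow k \<odot>\<^bsub>B\<^esub> b) (qpow k \<odot>\<^bsub>B\<^esub> b')"
  using assms upow_frac by (intro frac_upow) auto

lemma frac_0: "b \<in> carrier B \<Longrightarrow> b' \<in> carrier B \<Longrightarrow> frac 0 b b' = nf b b'"
  by (simp add: frac_def)

lemma frac_\<iota>: "b \<in> carrier B \<Longrightarrow> frac 0 b \<zero>\<^bsub>B\<^esub> = \<iota> b"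
  by (simp add: frac_def nf_def \<iota>_zero)

lemma frac_add:
  assumes "b \<in> carrier B" "b' \<in> carrier B" "d \<in> carrier B" "d' \<in> carrier B"
  shows "frac N b b' \<oplus>\<^bsub>C\<^esub> frac M d d' =
    frac (N + M) (qpow M \<odot>\<^bsub>B\<^esub> b \<oplus>\<^bsub>B\<^esub> qpow N \<odot>\<^bsub>B\<^esub> d) (qpow M \<odot>\<^bsub>B\<^esub> b' \<oplus>\<^bsub>B\<^esub> qpow N \<odot>\<^bsub>B\<^esub> d')"
proof (rule frac_upow)
  show "upow (2 * int (N + M)) \<odot>\<^bsub>C\<^esub> (frac N b b' \<oplus>\<^bsub>C\<^esub> frac M d d') =
    nf (qpow M \<odot>\<^bsub>B\<^esub> b \<oplus>\<^bsub>B\<^esub> qpow N \<odot>\<^bsub>B\<^esub> d) (qpow M \<odot>\<^bsub>B\<^esub> b' \<oplus>\<^bsub>B\<^esub> qpow N \<odot>\<^bsub>B\<^esub> d')"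
    using assms upow_frac[OF assms(1,2), of N M] upow_frac[OF assms(3,4), of M N]
    by (simp add: C.smult_r_distr nf_add add.commute)
qed (use assms in simp)

lemma smult_frac:
  assumes "b \<in> carrier B" "b' \<in> carrier B"
  shows "(upow (- 2 * int M) * (eval_sq p + upsilon * eval_sq p')) \<odot>\<^bsub>C\<^esub> frac N b b' =
    frac (N + M) (p \<odot>\<^bsub>B\<^esub> b \<oplus>\<^bsub>B\<^esub> qpow 1 \<odot>\<^bsub>B\<^esub> (p' \<odot>\<^bsub>B\<^esub> b')) (p \<odot>\<^bsub>B\<^esub> b' \<oplus>\<^bsub>B\<^esub> p' \<odot>\<^bsub>B\<^esub> b)"
proof -
  have e: "upow (- 2 * int M) * (eval_sq p + upsilon * eval_sq p') * upow (- 2 * int N) =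
     upow (- 2 * int (N + M)) * (eval_sq p + upsilon * eval_sq p')"
    using upow_add[of "- 2 * int M" "- 2 * int N"] by (simp add: algebra_simps)
  have "(eval_sq p + upsilon * eval_sq p') \<odot>\<^bsub>C\<^esub> nf b b' =
     nf (p \<odot>\<^bsub>B\<^esub> b \<oplus>\<^bsub>B\<^esub> qpow 1 \<odot>\<^bsub>B\<^esub> (p' \<odot>\<^bsub>B\<^esub> b')) (p \<odot>\<^bsub>B\<^esub> b' \<oplus>\<^bsub>B\<^esub> p' \<odot>\<^bsub>B\<^esub> b)"
    using assms by (simp add: C.smult_l_distr C.smult_assoc1 nf_smult nf_upsilon nf_add)
  note nf = this
  have n: "nf b b' \<in> carrier C" using assms by simp
  show ?thesis
    unfolding frac_def C.smult_assoc1[OF n, symmetric] e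
    unfolding C.smult_assoc1[OF n] nf ..
qed

end

locale laurent_extension = laurent_scalars B C \<iota>
  for B :: "(int poly, 'b) module" and C :: "(laurent, 'c) module" and \<iota> :: "'b \<Rightarrow> 'c" +
  assumes normal: "y \<in> carrier C \<Longrightarrow> \<exists>N b b'. b \<in> carrier B \<and> b' \<in> carrier B \<and> y = frac N b b'"
    and unique: "b \<in> carrier B \<Longrightarrow> b' \<in> carrier B \<Longrightarrow> nf b b' = \<zero>\<^bsub>C\<^esub> \<Longrightarrow>
        b = \<zero>\<^bsub>B\<^esub> \<and> b' = \<zero>\<^bsub>B\<^esub>"
begin

lemma nf_inj:
  assumes "b \<in> carrier B" "b' \<in> carrier B" "d \<in> carrier B" "d' \<in> carrier B" "nf b b' = nf d d'"
  shows "b = d" "b' = d'"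
proof -
  have "nf (b \<oplus>\<^bsub>B\<^esub> \<ominus>\<^bsub>B\<^esub> d) (b' \<oplus>\<^bsub>B\<^esub> \<ominus>\<^bsub>B\<^esub> d') = nf b b' \<oplus>\<^bsub>C\<^esub> \<ominus>\<^bsub>C\<^esub> nf d d'"
    using assms(1-4) by (simp add: nf_minus nf_add)
  also have "\<dots> = \<zero>\<^bsub>C\<^esub>" using assms by (simp add: C.r_neg)
  finally have "b \<oplus>\<^bsub>B\<^esub> \<ominus>\<^bsub>B\<^esub> d = \<zero>\<^bsub>B\<^esub> \<and> b' \<oplus>\<^bsub>B\<^esub> \<ominus>\<^bsub>B\<^esub> d' = \<zero>\<^bsub>B\<^esub>"
    using assms(1-4) by (intro unique) auto
  then show "b = d" "b' = d'"
    using assms(1-4) by (metis B.minus_equality B.minus_minus B.a_inv_closed)+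
qed

text \<open>Cross-multiplication: after clearing denominators, uniqueness of normal forms compares
  the components.\<close>

lemma frac_eq_iff:
  assumes "b \<in> carrier B" "b' \<in> carrier B" "d \<in> carrier B" "d' \<in> carrier B"
  shows "frac N b b' = frac M d d' \<longleftrightarrow>
    qpow M \<odot>\<^bsub>B\<^esub> b = qpow N \<odot>\<^bsub>B\<^esub> d \<and> qpow M \<odot>\<^bsub>B\<^esub> b' = qpow N \<odot>\<^bsub>B\<^esub> d'"
proof
  assume "frac N b b' = frac M d d'"
  then have "nf (qpow M \<odot>\<^bsub>B\<^esub> b) (qpow M \<odot>\<^bsub>B\<^esub> b') = nf (qpow N \<odot>\<^bsub>B\<^esub> d) (qpow N \<odot>\<^bsub>B\<^esub> d')"
    using upow_frac[OF assms(1,2), of N M] upow_frac[OF assms(3,4), of M N] by (simp add: add.commute)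
  then show "qpow M \<odot>\<^bsub>B\<^esub> b = qpow N \<odot>\<^bsub>B\<^esub> d \<and> qpow M \<odot>\<^bsub>B\<^esub> b' = qpow N \<odot>\<^bsub>B\<^esub> d'"
    using nf_inj assms by (meson B.smult_closed)
next
  assume "qpow M \<odot>\<^bsub>B\<^esub> b = qpow N \<odot>\<^bsub>B\<^esub> d \<and> qpow M \<odot>\<^bsub>B\<^esub> b' = qpow N \<odot>\<^bsub>B\<^esub> d'"
  then show "frac N b b' = frac M d d'"
    using frac_raise[OF assms(1,2), of N M] frac_raise[OF assms(3,4), of M N] by (simp add: add.commute)
qed

lemma fracE:
  assumes "y \<in> carrier C"
  obtains N b b' where "b \<in> carrier B" "b' \<in> carrier B" "y = frac N b b'"
  using normal[OF assms] by blast

end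

locale laurent_extension_map = X: laurent_extension B C \<iota> + Y: laurent_extension B' C' \<iota>'
  for B :: "(int poly, 'b) module" and C :: "(laurent, 'c) module" and \<iota> :: "'b \<Rightarrow> 'c"
    and B' :: "(int poly, 'd) module" and C' :: "(laurent, 'e) module" and \<iota>' :: "'d \<Rightarrow> 'e" +
  fixes f :: "'b \<Rightarrow> 'd"
  assumes f_closed [simp, intro]: "b \<in> carrier B \<Longrightarrow> f b \<in> carrier B'"
    and f_add: "b \<in> carrier B \<Longrightarrow> d \<in> carrier B \<Longrightarrow> f (b \<oplus>\<^bsub>B\<^esub> d) = f b \<oplus>\<^bsub>B'\<^esub> f d"
    and f_smult: "b \<in> carrier B \<Longrightarrow> f (a \<odot>\<^bsub>B\<^esub> b) = a \<odot>\<^bsub>B'\<^esub> f b"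
begin

definition ext :: "'c \<Rightarrow> 'e" where
  "ext y = (THE y'. \<exists>N b b'. b \<in> carrier B \<and> b' \<in> carrier B \<and> y = X.frac N b b' \<and> y' = Y.frac N (f b) (f b'))"

lemma f_zero: "f \<zero>\<^bsub>B\<^esub> = \<zero>\<^bsub>B'\<^esub>"
  using f_smult[of "\<zero>\<^bsub>B\<^esub>" 0] by simp

text \<open>Equality of fractions amounts to equations in \<open>B\<close>, which the linear map
  \<open>f\<close> preserves; so the value does not depend on the fraction chosen.\<close>

lemma ext_frac:
  assumes "b \<in> carrier B" "b' \<in> carrier B"
  shows "ext (X.frac N b b') = Y.frac N (f b) (f b')"
  unfolding ext_def
proof (rule the_equality)
  fix y' assume "\<exists>M d d'. d \<in> carrier B \<and> d' \<in> carrier B \<and> X.frac N b b' = X.frac M d d' \<and> y' = Y.frac M (f d) (f d')"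
  then obtain M d d' where d: "d \<in> carrier B" "d' \<in> carrier B" "X.frac N b b' = X.frac M d d'" "y' = Y.frac M (f d) (f d')"
    by blast
  then have "qpow M \<odot>\<^bsub>B\<^esub> b = qpow N \<odot>\<^bsub>B\<^esub> d" "qpow M \<odot>\<^bsub>B\<^esub> b' = qpow N \<odot>\<^bsub>B\<^esub> d'"
    using assms by (simp_all add: X.frac_eq_iff)
  then have "qpow M \<odot>\<^bsub>B'\<^esub> f b = qpow N \<odot>\<^bsub>B'\<^esub> f d" "qpow M \<odot>\<^bsub>B'\<^esub> f b' = qpow N \<odot>\<^bsub>B'\<^esub> f d'"
    using assms d by (simp_all flip: f_smult)
  then show "y' = Y.frac N (f b) (f b')"
    using assms d by (simp add: Y.frac_eq_iff)
qed (use assms in blast)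

lemma ext_closed [simp, intro]: "y \<in> carrier C \<Longrightarrow> ext y \<in> carrier C'"
  by (erule X.fracE) (simp add: ext_frac)

lemma ext_\<iota>: "b \<in> carrier B \<Longrightarrow> ext (\<iota> b) = \<iota>' (f b)"
  using ext_frac[of b "\<zero>\<^bsub>B\<^esub>" 0] by (simp add: X.frac_\<iota> Y.frac_\<iota> f_zero)

lemma ext_add:
  assumes "y \<in> carrier C" "z \<in> carrier C" shows "ext (y \<oplus>\<^bsub>C\<^esub> z) = ext y \<oplus>\<^bsub>C'\<^esub> ext z"
proof -
  obtain N b b' where b: "b \<in> carrier B" "b' \<in> carrier B" "y = X.frac N b b'" by (rule X.fracE[OF assms(1)])
  obtain M d d' where d: "d \<in> carrier B" "d' \<in> carrier B" "z = X.frac M d d'" by (rule X.fracE[OF assms(2)])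
  show ?thesis using b(1,2) d(1,2) unfolding b(3) d(3)
    by (simp add: X.frac_add ext_frac Y.frac_add f_add f_smult)
qed

lemma ext_smult:
  assumes "y \<in> carrier C" shows "ext (c \<odot>\<^bsub>C\<^esub> y) = c \<odot>\<^bsub>C'\<^esub> ext y"
proof -
  obtain N b b' where b: "b \<in> carrier B" "b' \<in> carrier B" "y = X.frac N b b'" by (rule X.fracE[OF assms])
  obtain M p p' where c: "c = upow (- 2 * int M) * (eval_sq p + upsilon * eval_sq p')" by (rule laurent_normal_form)
  show ?thesis using b(1,2) unfolding b(3) c
    by (simp only: X.smult_frac) (simp add: ext_frac Y.smult_frac[simplified] f_add f_smult)
qed

lemma ext_inj:
  assumes "inj_on f (carrier B)" shows "inj_on ext (carrier C)"
proof (rule inj_onI)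
  fix y z assume yz: "y \<in> carrier C" "z \<in> carrier C" "ext y = ext z"
  obtain N b b' where b: "b \<in> carrier B" "b' \<in> carrier B" "y = X.frac N b b'" by (rule X.fracE[OF yz(1)])
  obtain M d d' where d: "d \<in> carrier B" "d' \<in> carrier B" "z = X.frac M d d'" by (rule X.fracE[OF yz(2)])
  have "f (qpow M \<odot>\<^bsub>B\<^esub> b) = f (qpow N \<odot>\<^bsub>B\<^esub> d)" "f (qpow M \<odot>\<^bsub>B\<^esub> b') = f (qpow N \<odot>\<^bsub>B\<^esub> d')"
    using yz(3) b(1,2) d(1,2) unfolding b(3) d(3) by (simp_all add: ext_frac Y.frac_eq_iff f_smult)
  then have "qpow M \<odot>\<^bsub>B\<^esub> b = qpow N \<odot>\<^bsub>B\<^esub> d" "qpow M \<odot>\<^bsub>B\<^esub> b' = qpow N \<odot>\<^bsub>B\<^esub> d'"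
    using assms b(1,2) d(1,2) by (meson X.B.smult_closed inj_onD)+
  then show "y = z" using b d by (simp add: X.frac_eq_iff)
qed

lemma ext_surj:
  assumes "f ` carrier B = carrier B'" shows "ext ` carrier C = carrier C'"
proof
  show "carrier C' \<subseteq> ext ` carrier C"
  proof
    fix y assume "y \<in> carrier C'"
    then obtain N d d' where d: "d \<in> carrier B'" "d' \<in> carrier B'" "y = Y.frac N d d'" by (rule Y.fracE)
    then obtain b b' where "b \<in> carrier B" "b' \<in> carrier B" "d = f b" "d' = f b'" using assms by blast
    then show "y \<in> ext ` carrier C"
      using d by (intro image_eqI[of _ _ "X.frac N b b'"]) (auto simp: ext_frac)
  qed
qed auto

end

locale laurent_algebra_extension = laurent_extension B C \<iota> + B: assoc_algebra B + C: assoc_algebra C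
  for B :: "(int poly, 'b) module" and C :: "(laurent, 'c) module" and \<iota> :: "'b \<Rightarrow> 'c" +
  assumes \<iota>_mult: "b \<in> carrier B \<Longrightarrow> d \<in> carrier B \<Longrightarrow> \<iota> (b \<otimes>\<^bsub>B\<^esub> d) = \<iota> b \<otimes>\<^bsub>C\<^esub> \<iota> d"
    and \<iota>_one: "\<iota> \<one>\<^bsub>B\<^esub> = \<one>\<^bsub>C\<^esub>"
begin

text \<open>Expand \<open>(b + \<upsilon> b') (d + \<upsilon> d')\<close> with
  \<open>\<upsilon>\<^sup>2 = q\<close>; as a scalar, \<open>\<upsilon>\<close> passes over every
  factor.\<close>

lemma nf_mult:
  assumes "b \<in> carrier B" "b' \<in> carrier B" "d \<in> carrier B" "d' \<in> carrier B"
  shows "nf b b' \<otimes>\<^bsub>C\<^esub> nf d d' =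
    nf (b \<otimes>\<^bsub>B\<^esub> d \<oplus>\<^bsub>B\<^esub> qpow 1 \<odot>\<^bsub>B\<^esub> (b' \<otimes>\<^bsub>B\<^esub> d')) (b \<otimes>\<^bsub>B\<^esub> d' \<oplus>\<^bsub>B\<^esub> b' \<otimes>\<^bsub>B\<^esub> d)"
proof -
  have \<iota>_nf: "\<iota> x \<otimes>\<^bsub>C\<^esub> nf d d' = nf (x \<otimes>\<^bsub>B\<^esub> d) (x \<otimes>\<^bsub>B\<^esub> d')" if "x \<in> carrier B" for x
    using that assms by (simp add: nf_def C.r_distr C.smult_mult_right \<iota>_mult)
  have "nf b b' \<otimes>\<^bsub>C\<^esub> nf d d' = \<iota> b \<otimes>\<^bsub>C\<^esub> nf d d' \<oplus>\<^bsub>C\<^esub> upsilon \<odot>\<^bsub>C\<^esub> (\<iota> b' \<otimes>\<^bsub>C\<^esub> nf d d')"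
    using assms nf_closed[of d d'] by (simp add: nf_def[of b b'] C.l_distr C.smult_mult_left)
  then show ?thesis using assms by (simp add: \<iota>_nf nf_upsilon nf_add)
qed

lemma frac_mult:
  assumes "b \<in> carrier B" "b' \<in> carrier B" "d \<in> carrier B" "d' \<in> carrier B"
  shows "frac N b b' \<otimes>\<^bsub>C\<^esub> frac M d d' =
    frac (N + M) (b \<otimes>\<^bsub>B\<^esub> d \<oplus>\<^bsub>B\<^esub> qpow 1 \<odot>\<^bsub>B\<^esub> (b' \<otimes>\<^bsub>B\<^esub> d')) (b \<otimes>\<^bsub>B\<^esub> d' \<oplus>\<^bsub>B\<^esub> b' \<otimes>\<^bsub>B\<^esub> d)"
proof -
  have "upow (- 2 * int M) * upow (- 2 * int N) = upow (- 2 * int (N + M))"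
    using upow_add[of "- 2 * int M" "- 2 * int N"] by (simp add: algebra_simps)
  then show ?thesis
    using assms by (simp add: frac_def C.smult_mult_left C.smult_mult_right nf_mult flip: C.smult_assoc1)
qed

end

text \<open>Equality, sums and products of fractions are governed by formulas in the small algebra
  alone, so its isomorphisms extend. This allows a tensor product to be compared with an
  endomorphism algebra.\<close>

theorem laurent_algebra_extension_iso:
  assumes "laurent_algebra_extension B C \<iota>" "laurent_algebra_extension B' C' \<iota>'" "\<phi> \<in> algebra_iso B B'"
  shows "\<exists>\<psi>\<in>algebra_iso C C'. \<forall>b\<in>carrier B. \<psi> (\<iota> b) = \<iota>' (\<phi> b)"
proof -
  interpret X: laurent_algebra_extension B C \<iota> by fact
  interpret Y: laurent_algebra_extension B' C' \<iota>' by fact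
  have hom: "\<phi> \<in> ring_hom B B'" and bij: "bij_betw \<phi> (carrier B) (carrier B')"
    and lin: "\<And>a x. x \<in> carrier B \<Longrightarrow> \<phi> (a \<odot>\<^bsub>B\<^esub> x) = a \<odot>\<^bsub>B'\<^esub> \<phi> x"
    using assms(3) by (auto simp: algebra_iso_def ring_iso_def)
  interpret E: laurent_extension_map B C \<iota> B' C' \<iota>' \<phi>
    by unfold_locales (use ring_hom_closed[OF hom] ring_hom_add[OF hom] lin in auto)
  have one: "X.frac 0 \<one>\<^bsub>B\<^esub> \<zero>\<^bsub>B\<^esub> = \<one>\<^bsub>C\<^esub>" "Y.frac 0 \<one>\<^bsub>B'\<^esub> \<zero>\<^bsub>B'\<^esub> = \<one>\<^bsub>C'\<^esub>"
    by (simp_all add: X.frac_\<iota> Y.frac_\<iota> X.\<iota>_one Y.\<iota>_one)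
  have "E.ext \<in> ring_hom C C'"
  proof (rule ring_hom_memI)
    fix y z assume yz: "y \<in> carrier C" "z \<in> carrier C"
    obtain N b b' where b: "b \<in> carrier B" "b' \<in> carrier B" "y = X.frac N b b'" by (rule X.fracE[OF yz(1)])
    obtain M d d' where d: "d \<in> carrier B" "d' \<in> carrier B" "z = X.frac M d d'" by (rule X.fracE[OF yz(2)])
    show "E.ext (y \<otimes>\<^bsub>C\<^esub> z) = E.ext y \<otimes>\<^bsub>C'\<^esub> E.ext z"
      using b(1,2) d(1,2) unfolding b(3) d(3)
      by (simp add: X.frac_mult Y.frac_mult E.ext_frac E.f_add E.f_smult ring_hom_mult[OF hom])
    show "E.ext (y \<oplus>\<^bsub>C\<^esub> z) = E.ext y \<oplus>\<^bsub>C'\<^esub> E.ext z" by (rule E.ext_add[OF yz])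
  next
    show "E.ext \<one>\<^bsub>C\<^esub> = \<one>\<^bsub>C'\<^esub>"
      using E.ext_\<iota>[OF X.B.one_closed] ring_hom_one[OF hom] by (simp add: X.\<iota>_one Y.\<iota>_one)
  qed auto
  moreover have "bij_betw E.ext (carrier C) (carrier C')"
    using bij E.ext_inj E.ext_surj by (simp add: bij_betw_def)
  ultimately have "E.ext \<in> algebra_iso C C'"
    by (simp add: algebra_iso_def ring_iso_def E.ext_smult)
  then show ?thesis using E.ext_\<iota> by blast
qed

section \<open>The tensor product as an extension with normal forms\<close>

subsection \<open>Base change\<close>

definition linear_functional :: "('a::comm_ring_1, 'b) module \<Rightarrow> ('b \<Rightarrow> 'a) \<Rightarrow> bool" where
  "linear_functional A \<xi> \<longleftrightarrow>
     (\<forall>x\<in>carrier A. \<forall>y\<in>carrier A. \<xi> (x \<oplus>\<^bsub>A\<^esub> y) = \<xi> x + \<xi> y) \<and>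
     (\<forall>a. \<forall>x\<in>carrier A. \<xi> (a \<odot>\<^bsub>A\<^esub> x) = a * \<xi> x)"

text \<open>The standard notion: linear functionals separate the elements, that is, the module
  embeds in its double dual. It passes to the subalgebra of type D and to endomorphism algebras, so
  only \<open>H\<close> needs a model.\<close>

definition torsionless :: "('a::comm_ring_1, 'b) module \<Rightarrow> bool" where
  "torsionless A \<longleftrightarrow>
     (\<forall>x\<in>carrier A. (\<forall>\<xi>. linear_functional A \<xi> \<longrightarrow> \<xi> x = 0) \<longrightarrow> x = \<zero>\<^bsub>A\<^esub>)"

text \<open>Separating functionals on \<open>B\<close> yield the uniqueness of the normal form in the tensor product.\<close>

lemma functional_vanishes:
  fixes B :: "(int poly, 'b) module"
  assumes "assoc_algebra B" "linear_functional B \<xi>" "x \<in> tensor_ideal B laurent_algebra"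
  shows "frag_extend (\<lambda>(b, z). eval_sq (\<xi> b) * z) x = 0"
proof -
  interpret T: tensor_product B laurent_algebra
    by (intro tensor_product.intro assms(1) assoc_algebra_laurent)
  show ?thesis
    using assms(3)
  proof (induction x rule: T.TI_induct)
    case (rel x)
    have l: "\<xi> (b \<oplus>\<^bsub>B\<^esub> b') = \<xi> b + \<xi> b'" "\<xi> (a \<odot>\<^bsub>B\<^esub> b) = a * \<xi> b"
      if "b \<in> carrier B" "b' \<in> carrier B" for a b b'
      using assms(2) that by (auto simp: linear_functional_def)
    show ?case
      using rel
      by (cases rule: T.tensor_rels_cases)
        (simp_all add: frag_extend_diff l eval_sq_add eval_sq_mult ring_distribs mult_ac)
  qed (simp_all add: frag_extend_add frag_extend_minus)
qed

text \<open>Existence of normal forms is bilinearity plus the normal form of a Laurent polynomial.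
  For uniqueness, a functional \<open>\<xi>\<close> turns
  \<open>b \<otimes> 1 + b' \<otimes> \<upsilon> = 0\<close> into an equation between even and odd
  Laurent polynomials, which forces \<open>\<xi> b\<close> and \<open>\<xi> b'\<close> to
  vanish.\<close>

theorem base_change_laurent:
  fixes A :: "(int poly, 'b) module"
  assumes "assoc_algebra A" "torsionless A"
  shows "laurent_algebra_extension A (base_change A laurent_algebra) (\<lambda>b. pure_tensor A laurent_algebra b 1)"
proof -
  interpret A: assoc_algebra A by fact
  interpret L: assoc_algebra laurent_algebra by (rule assoc_algebra_laurent)
  interpret T: tensor_product A laurent_algebra by (intro tensor_product.intro assms(1) assoc_algebra_laurent)
  define C where "C = base_change A laurent_algebra"
  note C_simps = T.base_change_simps[folded C_def]
  have pt: "T.pt b z \<in> carrier C" if "b \<in> carrier A" for b z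
    using that T.pt_closed[of b z] by (simp add: C_simps)
  have pt_smult: "c \<odot>\<^bsub>C\<^esub> T.pt b z = T.pt b (c * z)" if "b \<in> carrier A" for b c z
    using that by (simp add: C_simps T.pt_mult)
  \<comment> \<open>The scalar \<open>c\<close> acts as left multiplication by
    \<open>1 \<otimes> c\<close>; for it to pass over left factors, this element must be
    central.\<close>
  have central: "T.pt \<one>\<^bsub>A\<^esub> c \<otimes>\<^bsub>T.Q\<^esub> y = y \<otimes>\<^bsub>T.Q\<^esub> T.pt \<one>\<^bsub>A\<^esub> c" if "y \<in> carrier T.Q" for c y
    using that
  proof (induction y rule: T.Q_induct)
    case (pt b z) then show ?case by (simp add: T.pt_mult mult.commute)
  next
    case (add x y) then show ?case by (simp add: T.Q.l_distr T.Q.r_distr)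
  next
    case (minus x) then show ?case by (simp add: T.Q.l_minus T.Q.r_minus)
  qed
  have ringC: "ring C"
    by (rule ring_cong[OF T.Q.ring_axioms]) (simp_all add: C_simps)
  interpret C: assoc_algebra C
  proof (rule assoc_algebraI[OF ringC], goal_cases)
    case (2 x a b)
    then show ?case using T.pt_add_right[of "\<one>\<^bsub>A\<^esub>" a b] by (simp add: C_simps T.Q.l_distr)
  next
    case (4 x a b)
    then show ?case using T.pt_mult[of "\<one>\<^bsub>A\<^esub>" a "\<one>\<^bsub>A\<^esub>" b] by (simp add: C_simps flip: T.Q.m_assoc)
  next
    case (5 x)
    have "\<one>\<^bsub>T.Q\<^esub> = T.pt \<one>\<^bsub>A\<^esub> 1" using T.pt_one by simp
    then show ?case using 5 T.Q.l_one[of x] by (simp add: C_simps)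
  next
    case (7 x y a)
    then have xy: "x \<in> carrier T.Q" "y \<in> carrier T.Q" by (simp_all add: C_simps)
    have p: "T.pt \<one>\<^bsub>A\<^esub> a \<in> carrier T.Q" by simp
    show ?case
      unfolding C_simps T.Q.m_assoc[OF xy(1) p xy(2), symmetric] central[OF xy(1), symmetric]
      by (rule T.Q.m_assoc[OF p xy])
  qed (simp_all add: C_simps T.Q.r_distr T.Q.m_assoc)
  interpret S: laurent_scalars A C "\<lambda>b. T.pt b 1"
  proof unfold_locales
    fix b d a assume b: "b \<in> carrier A"
    show "T.pt b 1 \<in> carrier C" by (rule pt[OF b])
    show "T.pt (a \<odot>\<^bsub>A\<^esub> b) 1 = eval_sq a \<odot>\<^bsub>C\<^esub> T.pt b 1"
      using b by (simp add: pt_smult T.pt_scalar)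
    show "T.pt (b \<oplus>\<^bsub>A\<^esub> d) 1 = T.pt b 1 \<oplus>\<^bsub>C\<^esub> T.pt d 1" if "d \<in> carrier A"
      using b that by (simp add: T.pt_add_left C_simps)
  qed
  have nf: "S.nf b b' = T.pt b 1 \<oplus>\<^bsub>C\<^esub> T.pt b' upsilon" if "b \<in> carrier A" "b' \<in> carrier A" for b b'
    using that by (simp add: S.nf_def pt_smult)
  interpret E: laurent_extension A C "\<lambda>b. T.pt b 1"
  proof unfold_locales
    fix y assume "y \<in> carrier C"
    then have "y \<in> carrier T.Q" by (simp add: C_simps)
    then show "\<exists>N b b'. b \<in> carrier A \<and> b' \<in> carrier A \<and> y = S.frac N b b'"
    proof (induction y rule: T.Q_induct)
      case (pt b z)
      obtain N p p' where z: "z = upow (- 2 * int N) * (eval_sq p + upsilon * eval_sq p')" by (rule laurent_normal_form)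
      have "T.pt b z = S.frac N (p \<odot>\<^bsub>A\<^esub> b) (p' \<odot>\<^bsub>A\<^esub> b)"
        using pt z T.pt_add_right[of b "eval_sq p" "upsilon * eval_sq p'"] pt_smult[of b "upow (- 2 * int N)" "eval_sq p + upsilon * eval_sq p'"]
        by (simp add: S.frac_def nf T.pt_scalar C_simps(5) mult.commute)
      then show ?case using pt by blast
    next
      case (add x y)
      then obtain N b b' M d d' where "b \<in> carrier A" "b' \<in> carrier A" "x = S.frac N b b'"
        "d \<in> carrier A" "d' \<in> carrier A" "y = S.frac M d d'" by blast
      note bd = this
      then have "x \<oplus>\<^bsub>T.Q\<^esub> y = S.frac (N + M) (qpow M \<odot>\<^bsub>A\<^esub> b \<oplus>\<^bsub>A\<^esub> qpow N \<odot>\<^bsub>A\<^esub> d) (qpow M \<odot>\<^bsub>A\<^esub> b' \<oplus>\<^bsub>A\<^esub> qpow N \<odot>\<^bsub>A\<^esub> d')"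
        using S.frac_add[of b b' d d' N M] by (simp add: C_simps(5))
      then show ?case
        using bd by (intro exI[of _ "N + M"] exI[of _ "qpow M \<odot>\<^bsub>A\<^esub> b \<oplus>\<^bsub>A\<^esub> qpow N \<odot>\<^bsub>A\<^esub> d"]
            exI[of _ "qpow M \<odot>\<^bsub>A\<^esub> b' \<oplus>\<^bsub>A\<^esub> qpow N \<odot>\<^bsub>A\<^esub> d'"]) simp
    next
      case (minus x)
      then obtain N b b' where b: "b \<in> carrier A" "b' \<in> carrier A" "x = S.frac N b b'" by blast
      have "\<ominus>\<^bsub>T.Q\<^esub> x = \<ominus>\<^bsub>C\<^esub> x"
        using minus(1) C.a_inv_closed[of x] C.l_neg[of x] by (intro T.Q.minus_equality) (simp_all add: C_simps)
      also have "\<dots> = S.frac N (\<ominus>\<^bsub>A\<^esub> b) (\<ominus>\<^bsub>A\<^esub> b')"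
        unfolding b(3) S.frac_def S.nf_minus[OF b(1,2), symmetric]
        using b by (intro C.smult_r_minus[symmetric]) auto
      finally show ?case using b by blast
    qed
  next
    fix b b' assume b: "b \<in> carrier A" "b' \<in> carrier A" "S.nf b b' = \<zero>\<^bsub>C\<^esub>"
    have TF: "frag_of (b, 1) \<in> carrier T.TF" "frag_of (b', upsilon) \<in> carrier T.TF"
      using b by (auto intro!: T.frag_of_TF)
    have sum: "frag_of (b, 1) + frag_of (b', upsilon) \<in> carrier T.TF"
      using T.TF.a_closed[OF TF] by (simp add: T.TF_simps)
    have "T.cls (frag_of (b, 1) + frag_of (b', upsilon)) = \<zero>\<^bsub>T.Q\<^esub>"
      using b nf[OF b(1,2)] by (simp add: T.cls_add[OF TF] T.pt_eq_cls C_simps)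
    also have "\<dots> = T.cls 0" by (rule T.cls_0[symmetric])
    finally have "frag_of (b, 1) + frag_of (b', upsilon) \<in> T.TI"
      using T.TF.quotient_eq_iff_same_a_r_cos[OF T.TI_ideal sum, of 0] T.TF.zero_closed
      by (simp add: T.TF.monoid_algebra_diff[OF sum] T.TF_simps(3))
    then have "eval_sq (\<xi> b) + upsilon * eval_sq (\<xi> b') = 0" if "linear_functional A \<xi>" for \<xi>
      using functional_vanishes[OF assms(1) that] by (force simp: frag_extend_add mult.commute)
    then have "\<xi> b = 0 \<and> \<xi> b' = 0" if "linear_functional A \<xi>" for \<xi>
      using that eval_sq_independent by blast
    then show "b = \<zero>\<^bsub>A\<^esub> \<and> b' = \<zero>\<^bsub>A\<^esub>" using assms(2) b unfolding torsionless_def by blast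
  qed
  show ?thesis
    unfolding C_def[symmetric]
    by unfold_locales (use T.pt_mult T.pt_one in \<open>auto simp: C_simps\<close>)
qed

section \<open>Endomorphism algebras commute with the extension of scalars\<close>

subsection \<open>Base change of endomorphism algebras\<close>

text \<open>A direct sum of right ideals gets no product here; \<open>undefined\<close> fills the
  two ring fields of the record.\<close>

definition direct_sum_module ::
  "('a, 'b) module \<Rightarrow> 'i set \<Rightarrow> ('i \<Rightarrow> 'b set) \<Rightarrow> ('a, 'i \<Rightarrow> 'b) module" where
  "direct_sum_module B I M =
     \<lparr>carrier = Pi\<^sub>E I M, monoid.mult = undefined, one = undefined,
      ring.zero = (\<lambda>i\<in>I. \<zero>\<^bsub>B\<^esub>), ring.add = (\<lambda>x y. \<lambda>i\<in>I. x i \<oplus>\<^bsub>B\<^esub> y i),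
      smult = (\<lambda>a x. \<lambda>i\<in>I. a \<odot>\<^bsub>B\<^esub> x i)\<rparr>"

lemma direct_sum_module_simps [simp]:
  "carrier (direct_sum_module B I M) = Pi\<^sub>E I M"
  "ring.zero (direct_sum_module B I M) = (\<lambda>i\<in>I. \<zero>\<^bsub>B\<^esub>)"
  "ring.add (direct_sum_module B I M) x y = (\<lambda>i\<in>I. x i \<oplus>\<^bsub>B\<^esub> y i)"
  "smult (direct_sum_module B I M) a x = (\<lambda>i\<in>I. a \<odot>\<^bsub>B\<^esub> x i)"
  by (simp_all add: direct_sum_module_def)

lemma (in direct_sum) lin_module_direct_sum: "lin_module (direct_sum_module B I M)"
proof (intro lin_module.intro lin_module_axioms.intro abelian_groupI)
  fix x assume "x \<in> carrier (direct_sum_module B I M)"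
  then have x: "x \<in> D" by simp
  have "(\<lambda>i\<in>I. (-1) \<odot> x i) \<in> D" by (rule D_smult[OF x])
  then show "\<exists>y\<in>carrier (direct_sum_module B I M). y \<oplus>\<^bsub>direct_sum_module B I M\<^esub> x = \<zero>\<^bsub>direct_sum_module B I M\<^esub>"
    by (intro bexI[of _ "\<lambda>i\<in>I. (-1) \<odot> x i"])
      (auto intro!: restrict_ext simp: D_carrier[OF x] smult_l_minus l_neg)
  show "\<zero>\<^bsub>direct_sum_module B I M\<^esub> \<oplus>\<^bsub>direct_sum_module B I M\<^esub> x = x"
    "1 \<odot>\<^bsub>direct_sum_module B I M\<^esub> x = x"
    using x by (auto intro!: D_eqI D_add D_smult D_zero simp: D_carrier)
next
  fix x y z and a b
  assume "x \<in> carrier (direct_sum_module B I M)" "y \<in> carrier (direct_sum_module B I M)"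
    "z \<in> carrier (direct_sum_module B I M)"
  then show "x \<oplus>\<^bsub>direct_sum_module B I M\<^esub> y \<oplus>\<^bsub>direct_sum_module B I M\<^esub> z =
      x \<oplus>\<^bsub>direct_sum_module B I M\<^esub> (y \<oplus>\<^bsub>direct_sum_module B I M\<^esub> z)"
    by (auto intro!: restrict_ext simp: D_carrier a_assoc)
qed (auto intro!: restrict_ext D_add D_zero D_smult
    simp: D_carrier a_comm smult_l_distr smult_r_distr smult_assoc1 simp del: restrict_PiE_iff)

lemma (in direct_sum) E_zero_value:
  assumes "f \<in> carrier E" shows "f (\<lambda>i\<in>I. \<zero>) = (\<lambda>i\<in>I. \<zero>)"
proof -
  have "f (\<lambda>i\<in>I. \<zero>) = f (\<lambda>i\<in>I. 0 \<odot> (\<lambda>i\<in>I. \<zero>) i)"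
    by (rule arg_cong[of _ _ f]) (rule restrict_ext, simp)
  also have "\<dots> = (\<lambda>i\<in>I. 0 \<odot> f (\<lambda>i\<in>I. \<zero>) i)" by (rule E_smult[OF assms D_zero])
  also have "\<dots> = (\<lambda>i\<in>I. \<zero>)" using E_value[OF assms D_zero] by (intro restrict_ext) simp
  finally show ?thesis .
qed

text \<open>The modules are right ideals with one generator \<open>g i\<close> each, and the
  extended modules are generated by the images of the same elements. With \<open>I\<close> finite
  the sum has finitely many generators, hence common denominators.\<close>

locale laurent_End = laurent_algebra_extension B C \<iota>
  for B :: "(int poly, 'b) module" and C :: "(laurent, 'c) module" and \<iota> :: "'b \<Rightarrow> 'c" +
  fixes I :: "'i set" and g :: "'i \<Rightarrow> 'b"
  assumes finite_I: "finite I" and g_closed: "i \<in> I \<Longrightarrow> g i \<in> carrier B"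
begin

abbreviation M :: "'i \<Rightarrow> 'b set" where "M \<equiv> \<lambda>i. g i <#\<^bsub>B\<^esub> carrier B"
abbreviation MC :: "'i \<Rightarrow> 'c set" where "MC \<equiv> \<lambda>i. \<iota> (g i) <#\<^bsub>C\<^esub> carrier C"

sublocale S: direct_sum B "carrier B" I M
  by (rule B.direct_sum_principal) (simp_all add: B.carrier_is_subring g_closed)

sublocale SC: direct_sum C "carrier C" I MC
  by (rule C.direct_sum_principal) (simp_all add: C.carrier_is_subring g_closed)

abbreviation DM :: "(int poly, 'i \<Rightarrow> 'b) module" where "DM \<equiv> direct_sum_module B I M"
abbreviation DMC :: "(laurent, 'i \<Rightarrow> 'c) module" where "DMC \<equiv> direct_sum_module C I MC"

definition \<iota>D :: "('i \<Rightarrow> 'b) \<Rightarrow> 'i \<Rightarrow> 'c" where "\<iota>D m = (\<lambda>i\<in>I. \<iota> (m i))"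

lemma \<iota>D_closed: "m \<in> S.D \<Longrightarrow> \<iota>D m \<in> SC.D"
proof (rule PiE_I)
  fix i assume m: "m \<in> S.D" and i: "i \<in> I"
  then obtain h where "h \<in> carrier B" "m i = g i \<otimes>\<^bsub>B\<^esub> h"
    using PiE_mem[OF m i] by (auto simp: in_l_coset_iff)
  then show "\<iota>D m i \<in> MC i"
    using i g_closed by (auto simp: \<iota>D_def \<iota>_mult in_l_coset_iff)
qed (auto simp: \<iota>D_def restrict_def)

sublocale DS: laurent_scalars DM DMC \<iota>D
proof (intro laurent_scalars.intro laurent_scalars_axioms.intro S.lin_module_direct_sum SC.lin_module_direct_sum)
  fix m m' a assume m: "m \<in> carrier DM"
  then show "\<iota>D m \<in> carrier DMC" by (simp add: \<iota>D_closed)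
  have c: "m i \<in> carrier B" if "i \<in> I" for i using m that S.D_carrier by simp
  show "\<iota>D (a \<odot>\<^bsub>DM\<^esub> m) = eval_sq a \<odot>\<^bsub>DMC\<^esub> \<iota>D m"
    using c by (auto intro!: restrict_ext simp: \<iota>D_def \<iota>_smult)
  assume "m' \<in> carrier DM"
  then have "m' i \<in> carrier B" if "i \<in> I" for i using that S.D_carrier by simp
  then show "\<iota>D (m \<oplus>\<^bsub>DM\<^esub> m') = \<iota>D m \<oplus>\<^bsub>DMC\<^esub> \<iota>D m'"
    using c by (auto intro!: restrict_ext simp: \<iota>D_def \<iota>_add)
qed

lemma DS_nf: "DS.nf m m' = (\<lambda>i\<in>I. nf (m i) (m' i))"
  unfolding DS.nf_def by (auto intro!: restrict_ext simp: \<iota>D_def nf_def)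

lemma DS_frac: "DS.frac N m m' = (\<lambda>i\<in>I. frac N (m i) (m' i))"
  unfolding DS.frac_def DS_nf by (auto intro!: restrict_ext simp: frac_def)

text \<open>The numerators have to lie in the right ideal \<open>M i\<close>, not only in
  \<open>B\<close>; they are \<open>g i\<close> times the numerators of \<open>h\<close>. The form
  with \<open>eventually\<close> lets finitely many indices share one exponent.\<close>

lemma MC_frac:
  assumes i: "i \<in> I" and y: "y \<in> MC i"
  shows "eventually (\<lambda>N. \<exists>b\<in>M i. \<exists>b'\<in>M i. y = frac N b b') sequentially"
proof -
  obtain h where h: "h \<in> carrier C" "y = \<iota> (g i) \<otimes>\<^bsub>C\<^esub> h" using y by (auto simp: in_l_coset_iff)
  obtain N a a' where a: "a \<in> carrier B" "a' \<in> carrier B" "h = frac N a a'" by (rule fracE[OF h(1)])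
  have *: "\<exists>b\<in>M i. \<exists>b'\<in>M i. y = frac (N + k) b b'" for k
  proof -
    let ?a = "qpow k \<odot>\<^bsub>B\<^esub> a" and ?a' = "qpow k \<odot>\<^bsub>B\<^esub> a'"
    have "y = frac 0 (g i) \<zero>\<^bsub>B\<^esub> \<otimes>\<^bsub>C\<^esub> frac (N + k) ?a ?a'"
      unfolding h(2) a(3) frac_\<iota>[OF g_closed[OF i]] frac_raise[OF a(1,2), of N k] ..
    also have "\<dots> = frac (N + k) (g i \<otimes>\<^bsub>B\<^esub> ?a) (g i \<otimes>\<^bsub>B\<^esub> ?a')"
      using a g_closed[OF i] by (subst frac_mult) simp_all
    finally have "y = frac (N + k) (g i \<otimes>\<^bsub>B\<^esub> ?a) (g i \<otimes>\<^bsub>B\<^esub> ?a')" .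
    moreover have "g i \<otimes>\<^bsub>B\<^esub> ?a \<in> M i" "g i \<otimes>\<^bsub>B\<^esub> ?a' \<in> M i"
      using a(1,2) by (auto simp: in_l_coset_iff)
    ultimately show ?thesis by (intro bexI)
  qed
  show ?thesis
    unfolding eventually_sequentially
  proof (intro exI[of _ N] allI impI)
    show "\<exists>b\<in>M i. \<exists>b'\<in>M i. y = frac n b b'" if "N \<le> n" for n
      using *[of "n - N"] that by simp
  qed
qed

sublocale DE: laurent_extension DM DMC \<iota>D
proof unfold_locales
  fix y assume "y \<in> carrier DMC"
  then have y: "y \<in> SC.D" by simp
  have "eventually (\<lambda>N. \<forall>i\<in>I. \<exists>b\<in>M i. \<exists>b'\<in>M i. y i = frac N b b') sequentially"
    using MC_frac PiE_mem[OF y] by (intro eventually_ball_finite[OF finite_I]) blast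
  then obtain N where "\<forall>i\<in>I. \<exists>b\<in>M i. \<exists>b'\<in>M i. y i = frac N b b'"
    by (auto simp: eventually_sequentially)
  then obtain b b' where b: "\<And>i. i \<in> I \<Longrightarrow> b i \<in> M i \<and> b' i \<in> M i \<and> y i = frac N (b i) (b' i)"
    by metis
  have D: "(\<lambda>i\<in>I. b i) \<in> S.D" "(\<lambda>i\<in>I. b' i) \<in> S.D"
    using b by (simp_all add: PiE_iff)
  have "y = DS.frac N (\<lambda>i\<in>I. b i) (\<lambda>i\<in>I. b' i)"
    unfolding DS_frac
    by (rule extensionalityI[of _ I]) (use y b in \<open>simp_all add: PiE_iff\<close>)
  then show "\<exists>N b b'. b \<in> carrier DM \<and> b' \<in> carrier DM \<and> y = DS.frac N b b'"
    using D by (intro exI[of _ N] exI[of _ "\<lambda>i\<in>I. b i"] exI[of _ "\<lambda>i\<in>I. b' i"]) simp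
next
  fix m m' assume "m \<in> carrier DM" "m' \<in> carrier DM" and z: "DS.nf m m' = \<zero>\<^bsub>DMC\<^esub>"
  then have m: "m \<in> S.D" "m' \<in> S.D" by simp_all
  have "m i = \<zero>\<^bsub>B\<^esub> \<and> m' i = \<zero>\<^bsub>B\<^esub>" if i: "i \<in> I" for i
  proof (rule unique)
    show "nf (m i) (m' i) = \<zero>\<^bsub>C\<^esub>"
      using fun_cong[OF z, of i] i by (simp add: DS_nf)
  qed (use S.D_carrier m i in auto)
  then show "m = \<zero>\<^bsub>DM\<^esub> \<and> m' = \<zero>\<^bsub>DM\<^esub>"
    using m S.D_zero by (auto intro!: S.D_eqI)
qed

lemma End_scale_add:
  assumes "F \<in> carrier SC.E" "x \<in> SC.D" "y \<in> SC.D"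
  shows "F (c \<odot>\<^bsub>DMC\<^esub> (x \<oplus>\<^bsub>DMC\<^esub> d \<odot>\<^bsub>DMC\<^esub> y)) = c \<odot>\<^bsub>DMC\<^esub> (F x \<oplus>\<^bsub>DMC\<^esub> d \<odot>\<^bsub>DMC\<^esub> F y)"
  using assms by (simp add: SC.E_smult SC.E_add SC.D_add SC.D_smult)

lemma End_frac:
  assumes "F \<in> carrier SC.E" "m \<in> S.D" "m' \<in> S.D"
  shows "F (DS.frac N m m') = upow (- 2 * int N) \<odot>\<^bsub>DMC\<^esub> (F (\<iota>D m) \<oplus>\<^bsub>DMC\<^esub> upsilon \<odot>\<^bsub>DMC\<^esub> F (\<iota>D m'))"
  unfolding DS.frac_def DS.nf_def by (rule End_scale_add[OF assms(1) \<iota>D_closed[OF assms(2)] \<iota>D_closed[OF assms(3)]])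

text \<open>Every element of the extended sum is a fraction of elements \<open>\<iota>D m\<close>,
  and endomorphisms commute with Laurent scalars.\<close>

lemma End_unique:
  assumes "F \<in> carrier SC.E" "G \<in> carrier SC.E" "\<And>m. m \<in> S.D \<Longrightarrow> F (\<iota>D m) = G (\<iota>D m)"
  shows "F = G"
proof (rule SC.E_eqI[OF assms(1,2)])
  fix x i assume "x \<in> SC.D"
  then have "x \<in> carrier DMC" by simp
  then obtain N m m' where "m \<in> carrier DM" "m' \<in> carrier DM" "x = DS.frac N m m'" by (rule DE.fracE)
  then show "F x i = G x i" using End_frac[OF assms(1)] End_frac[OF assms(2)] assms(3) by simp
qed

lemma D_mult_comb:
  assumes "m \<in> S.D" "m' \<in> S.D" "a \<in> carrier B" "a' \<in> carrier B"
  shows "(\<lambda>i\<in>I. m i \<otimes>\<^bsub>B\<^esub> a \<oplus>\<^bsub>B\<^esub> c \<odot>\<^bsub>B\<^esub> (m' i \<otimes>\<^bsub>B\<^esub> a')) \<in> S.D"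
    and "f \<in> carrier S.E \<Longrightarrow> f (\<lambda>i\<in>I. m i \<otimes>\<^bsub>B\<^esub> a \<oplus>\<^bsub>B\<^esub> c \<odot>\<^bsub>B\<^esub> (m' i \<otimes>\<^bsub>B\<^esub> a')) =
      (\<lambda>i\<in>I. f m i \<otimes>\<^bsub>B\<^esub> a \<oplus>\<^bsub>B\<^esub> c \<odot>\<^bsub>B\<^esub> (f m' i \<otimes>\<^bsub>B\<^esub> a'))"
proof -
  define p t s where "p = (\<lambda>i\<in>I. m i \<otimes>\<^bsub>B\<^esub> a)" and "t = (\<lambda>i\<in>I. m' i \<otimes>\<^bsub>B\<^esub> a')" and "s = (\<lambda>i\<in>I. c \<odot>\<^bsub>B\<^esub> t i)"
  have D: "p \<in> S.D" "t \<in> S.D" "s \<in> S.D"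
    unfolding p_def t_def s_def using assms by (intro S.D_mult S.D_smult; simp)+
  have eq: "(\<lambda>i\<in>I. m i \<otimes>\<^bsub>B\<^esub> a \<oplus>\<^bsub>B\<^esub> c \<odot>\<^bsub>B\<^esub> (m' i \<otimes>\<^bsub>B\<^esub> a')) = (\<lambda>i\<in>I. p i \<oplus>\<^bsub>B\<^esub> s i)"
    by (rule restrict_ext) (simp add: p_def s_def t_def)
  show "(\<lambda>i\<in>I. m i \<otimes>\<^bsub>B\<^esub> a \<oplus>\<^bsub>B\<^esub> c \<odot>\<^bsub>B\<^esub> (m' i \<otimes>\<^bsub>B\<^esub> a')) \<in> S.D"
    unfolding eq by (rule S.D_add[OF D(1,3)])
  assume f: "f \<in> carrier S.E"
  show "f (\<lambda>i\<in>I. m i \<otimes>\<^bsub>B\<^esub> a \<oplus>\<^bsub>B\<^esub> c \<odot>\<^bsub>B\<^esub> (m' i \<otimes>\<^bsub>B\<^esub> a')) =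
      (\<lambda>i\<in>I. f m i \<otimes>\<^bsub>B\<^esub> a \<oplus>\<^bsub>B\<^esub> c \<odot>\<^bsub>B\<^esub> (f m' i \<otimes>\<^bsub>B\<^esub> a'))"
    unfolding eq S.E_add[OF f D(1,3)]
    unfolding s_def S.E_smult[OF f D(2)]
    unfolding p_def t_def S.E_mult[OF f assms(1,3)] S.E_mult[OF f assms(2,4)]
    by (rule restrict_ext) simp
qed

text \<open>The factor \<open>1\<close> gives the second component the shape of the first, so that
  \<open>D_mult_comb\<close> applies to both.\<close>

lemma DS_frac_mult:
  assumes "m \<in> S.D" "m' \<in> S.D" "a \<in> carrier B" "a' \<in> carrier B"
  shows "(\<lambda>i\<in>I. DS.frac N m m' i \<otimes>\<^bsub>C\<^esub> frac L a a') =
    DS.frac (N + L) (\<lambda>i\<in>I. m i \<otimes>\<^bsub>B\<^esub> a \<oplus>\<^bsub>B\<^esub> qpow 1 \<odot>\<^bsub>B\<^esub> (m' i \<otimes>\<^bsub>B\<^esub> a'))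
      (\<lambda>i\<in>I. m i \<otimes>\<^bsub>B\<^esub> a' \<oplus>\<^bsub>B\<^esub> 1 \<odot>\<^bsub>B\<^esub> (m' i \<otimes>\<^bsub>B\<^esub> a))"
  unfolding DS_frac using assms by (intro restrict_ext) (simp add: frac_mult S.D_carrier)

text \<open>As a linear map, \<open>f\<close> extends to fractions by \<open>ext\<close>.
  Compatibility with multiplication by \<open>C\<close> is checked by writing both factors as
  fractions, as \<open>f\<close> commutes with multiplication by \<open>B\<close>.\<close>

lemma End_lift:
  assumes f: "f \<in> carrier S.E"
  shows "\<exists>F. F \<in> carrier SC.E \<and> (\<forall>m\<in>S.D. F (\<iota>D m) = \<iota>D (f m))"
proof -
  interpret L: laurent_extension_map DM DMC \<iota>D DM DMC \<iota>D f
    by unfold_locales (use S.E_closed[OF f] S.E_add[OF f] S.E_smult[OF f] in simp_all)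
  note fc = S.E_closed[OF f]
  have "(\<lambda>x\<in>SC.D. L.ext x) \<in> carrier SC.E"
  proof (rule SC.E_carrierI)
    show "(\<lambda>x\<in>SC.D. L.ext x) x \<in> SC.D" if "x \<in> SC.D" for x
      using L.ext_closed[of x] that by simp
    show "(\<lambda>x\<in>SC.D. L.ext x) (\<lambda>i\<in>I. x i \<oplus>\<^bsub>C\<^esub> y i) i = (\<lambda>x\<in>SC.D. L.ext x) x i \<oplus>\<^bsub>C\<^esub> (\<lambda>x\<in>SC.D. L.ext x) y i"
      if "x \<in> SC.D" "y \<in> SC.D" "i \<in> I" for x y i
      using L.ext_add[of x y] that by (simp add: SC.D_add)
    show "(\<lambda>x\<in>SC.D. L.ext x) (\<lambda>i\<in>I. x i \<otimes>\<^bsub>C\<^esub> h) i = (\<lambda>x\<in>SC.D. L.ext x) x i \<otimes>\<^bsub>C\<^esub> h"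
      if x: "x \<in> SC.D" and h: "h \<in> carrier C" and i: "i \<in> I" for x h i
    proof -
      have "x \<in> carrier DMC" using x by simp
      then obtain N m m' where m: "m \<in> carrier DM" "m' \<in> carrier DM" "x = DS.frac N m m'" by (rule DE.fracE)
      then have mD: "m \<in> S.D" "m' \<in> S.D" by simp_all
      obtain L a a' where a: "a \<in> carrier B" "a' \<in> carrier B" "h = frac L a a'" by (rule fracE[OF h])
      have "L.ext (\<lambda>i\<in>I. x i \<otimes>\<^bsub>C\<^esub> h) = DS.frac (N + L)
         (\<lambda>i\<in>I. f m i \<otimes>\<^bsub>B\<^esub> a \<oplus>\<^bsub>B\<^esub> qpow 1 \<odot>\<^bsub>B\<^esub> (f m' i \<otimes>\<^bsub>B\<^esub> a'))
         (\<lambda>i\<in>I. f m i \<otimes>\<^bsub>B\<^esub> a' \<oplus>\<^bsub>B\<^esub> 1 \<odot>\<^bsub>B\<^esub> (f m' i \<otimes>\<^bsub>B\<^esub> a))"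
        unfolding m(3) a(3) DS_frac_mult[OF mD a(1,2)]
        using D_mult_comb[OF mD a(1,2)] D_mult_comb[OF mD a(2,1)] f by (subst L.ext_frac) simp_all
      also have "\<dots> = (\<lambda>i\<in>I. L.ext x i \<otimes>\<^bsub>C\<^esub> h)"
        unfolding m(3) a(3) L.ext_frac[OF m(1,2)] DS_frac_mult[OF fc[OF mD(1)] fc[OF mD(2)] a(1,2)] ..
      finally show ?thesis using x h i SC.D_mult by simp
    qed
  qed simp
  moreover have "(\<lambda>x\<in>SC.D. L.ext x) (\<iota>D m) = \<iota>D (f m)" if "m \<in> S.D" for m
    using that L.ext_\<iota>[of m] by (simp add: \<iota>D_closed)
  ultimately show ?thesis by blast
qed

text \<open>By \<open>End_unique\<close> there is only one such endomorphism, so the choice is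
  canonical.\<close>

definition lift :: "(('i \<Rightarrow> 'b) \<Rightarrow> 'i \<Rightarrow> 'b) \<Rightarrow> ('i \<Rightarrow> 'c) \<Rightarrow> 'i \<Rightarrow> 'c" where
  "lift f = (SOME F. F \<in> carrier SC.E \<and> (\<forall>m\<in>S.D. F (\<iota>D m) = \<iota>D (f m)))"

lemma lift:
  assumes "f \<in> carrier S.E"
  shows "lift f \<in> carrier SC.E" "m \<in> S.D \<Longrightarrow> lift f (\<iota>D m) = \<iota>D (f m)"
  using someI_ex[OF End_lift[OF assms]] unfolding lift_def by blast+

lemma lift_eqI:
  assumes "f \<in> carrier S.E" "F \<in> carrier SC.E" "\<And>m. m \<in> S.D \<Longrightarrow> F (\<iota>D m) = \<iota>D (f m)"
  shows "lift f = F"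
  using assms by (intro End_unique) (simp_all add: lift)

lemma DE_frac_inj:
  assumes "b \<in> S.D" "b' \<in> S.D" "d \<in> S.D" "d' \<in> S.D" "DS.frac N b b' = DS.frac N d d'"
  shows "b = d" "b' = d'"
proof -
  \<comment> \<open>\<open>upow_frac\<close> with surplus exponent 0 clears exactly the common
    denominator.\<close>
  have "qpow 0 = 1" by (simp add: monom_0 flip: one_pCons)
  then have "DS.nf b b' = DS.nf d d'"
    using DS.upow_frac[of b b' N 0] DS.upow_frac[of d d' N 0] assms
      DS.B.smult_one[of b] DS.B.smult_one[of b'] DS.B.smult_one[of d] DS.B.smult_one[of d']
    by (simp del: direct_sum_module_simps(4))
  then show "b = d" "b' = d'" using DE.nf_inj[of b b' d d'] assms by simp_all
qed

lemma DS_frac_add: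
  assumes "b \<in> S.D" "b' \<in> S.D" "d \<in> S.D" "d' \<in> S.D"
  shows "DS.frac N b b' \<oplus>\<^bsub>DMC\<^esub> DS.frac N d d' = DS.frac N (b \<oplus>\<^bsub>DM\<^esub> d) (b' \<oplus>\<^bsub>DM\<^esub> d')"
  using assms DS.nf_add[of b b' d d'] DS.nf_closed[of b b'] DS.nf_closed[of d d']
  by (simp add: DS.frac_def DS.C.smult_r_distr[symmetric] del: direct_sum_module_simps(3,4))

lemma DS_frac_mult_\<iota>:
  assumes "m \<in> S.D" "m' \<in> S.D" "a \<in> carrier B"
  shows "(\<lambda>i\<in>I. DS.frac N m m' i \<otimes>\<^bsub>C\<^esub> \<iota> a) = DS.frac N (\<lambda>i\<in>I. m i \<otimes>\<^bsub>B\<^esub> a) (\<lambda>i\<in>I. m' i \<otimes>\<^bsub>B\<^esub> a)"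
  unfolding DS_frac frac_\<iota>[OF assms(3), symmetric]
  using assms by (intro restrict_ext) (simp add: frac_mult S.D_carrier)

text \<open>A denominator that suffices for the finitely many generators suffices everywhere, since
  all elements arise from them by sums and right multiplication by \<open>B\<close>, neither of
  which enlarges it. Only a denominator independent of \<open>m\<close> lets the numerators become
  maps of the direct sum.\<close>

lemma End_frac_uniform:
  assumes F: "F \<in> carrier SC.E"
  shows "\<exists>N. \<forall>m\<in>S.D. \<exists>a\<in>S.D. \<exists>a'\<in>S.D. F (\<iota>D m) = DS.frac N a a'"
proof -
  define P where "P N m \<longleftrightarrow> m \<in> S.D \<and> (\<exists>a\<in>S.D. \<exists>a'\<in>S.D. F (\<iota>D m) = DS.frac N a a')" for N m
  \<comment> \<open>The generator \<open>g j\<close>, placed in the component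
    \<open>j\<close>.\<close>
  define e where "e j = (\<lambda>i\<in>I. if i = j then g i else \<zero>\<^bsub>B\<^esub>)" for j
  have e: "e j \<in> S.D" for j
  proof (rule PiE_I)
    fix i assume i: "i \<in> I"
    have "g i \<in> M i"
      unfolding in_l_coset_iff using g_closed[OF i] by (intro bexI[of _ "\<one>\<^bsub>B\<^esub>"]) simp_all
    then show "e j i \<in> M i" using S.M_zero[OF i] i by (cases "i = j") (simp_all add: e_def)
  qed (simp add: e_def restrict_def)
  have P_add: "P N (m \<oplus>\<^bsub>DM\<^esub> m')" if P: "P N m" "P N m'" for N m m'
  proof -
    have m: "m \<in> S.D" "m' \<in> S.D" using P by (simp_all add: P_def)
    obtain a a' where a1: "a \<in> S.D" "a' \<in> S.D" "F (\<iota>D m) = DS.frac N a a'"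
      using P(1) unfolding P_def by blast
    obtain d d' where a2: "d \<in> S.D" "d' \<in> S.D" "F (\<iota>D m') = DS.frac N d d'"
      using P(2) unfolding P_def by blast
    note a = a1 a2
    have "F (\<iota>D (m \<oplus>\<^bsub>DM\<^esub> m')) = F (\<iota>D m) \<oplus>\<^bsub>DMC\<^esub> F (\<iota>D m')"
      using DS.\<iota>_add[of m m'] m SC.E_add[OF F \<iota>D_closed[OF m(1)] \<iota>D_closed[OF m(2)]] by simp
    also have "\<dots> = DS.frac N (a \<oplus>\<^bsub>DM\<^esub> d) (a' \<oplus>\<^bsub>DM\<^esub> d')"
      unfolding a(3,6) by (rule DS_frac_add[OF a(1,2,4,5)])
    finally show ?thesis
      unfolding P_def using S.D_add[OF m] S.D_add[OF a(1,4)] S.D_add[OF a(2,5)] by auto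
  qed
  have P_mult: "P N (\<lambda>i\<in>I. m i \<otimes>\<^bsub>B\<^esub> h)" if P: "P N m" and h: "h \<in> carrier B" for N m h
  proof -
    obtain a a' where a: "a \<in> S.D" "a' \<in> S.D" "F (\<iota>D m) = DS.frac N a a'" and m: "m \<in> S.D"
      using P unfolding P_def by blast
    have "\<iota>D (\<lambda>i\<in>I. m i \<otimes>\<^bsub>B\<^esub> h) = (\<lambda>i\<in>I. \<iota>D m i \<otimes>\<^bsub>C\<^esub> \<iota> h)"
      unfolding \<iota>D_def using h S.D_carrier[OF m] by (intro restrict_ext) (simp add: \<iota>_mult)
    then have "F (\<iota>D (\<lambda>i\<in>I. m i \<otimes>\<^bsub>B\<^esub> h)) = (\<lambda>i\<in>I. DS.frac N a a' i \<otimes>\<^bsub>C\<^esub> \<iota> h)"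
      using SC.E_mult[OF F \<iota>D_closed[OF m]] h a(3) by simp
    then show ?thesis
      unfolding P_def DS_frac_mult_\<iota>[OF a(1,2) h]
      using S.D_mult[OF m h] S.D_mult[OF a(1) h] S.D_mult[OF a(2) h] by blast
  qed
  have "eventually (\<lambda>N. P N (e j)) sequentially" for j
  proof -
    have "F (\<iota>D (e j)) \<in> carrier DMC" using SC.E_closed[OF F \<iota>D_closed[OF e]] by simp
    then obtain N a a' where a: "a \<in> carrier DM" "a' \<in> carrier DM" "F (\<iota>D (e j)) = DS.frac N a a'" by (rule DE.fracE)
    have *: "P (N + k) (e j)" for k
      unfolding P_def a(3) DS.frac_raise[OF a(1,2), of N k]
      using e DS.B.smult_closed[OF a(1)] DS.B.smult_closed[OF a(2)] unfolding direct_sum_module_simps(1) by blast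
    show ?thesis
      unfolding eventually_sequentially
    proof (intro exI[of _ N] allI impI)
      show "P n (e j)" if "N \<le> n" for n using *[of "n - N"] that by simp
    qed
  qed
  then have "eventually (\<lambda>N. \<forall>j\<in>I. P N (e j)) sequentially"
    by (intro eventually_ball_finite[OF finite_I]) blast
  then obtain N where Pe: "\<And>j. j \<in> I \<Longrightarrow> P N (e j)"
    by (auto simp: eventually_sequentially)
  have "P N m" if m: "m \<in> S.D" for m
  proof -
    \<comment> \<open>Induction on the set of components that are switched on: the new index
      \<open>j\<close> contributes \<open>e j\<close> times an element of \<open>B\<close>.\<close>
    have "P N (\<lambda>i\<in>I. if i \<in> J then m i else \<zero>\<^bsub>B\<^esub>)" if "finite J" "J \<subseteq> I" for J
      using that
    proof (induction J)
      case empty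
      have z: "\<zero>\<^bsub>DM\<^esub> \<in> S.D" "\<zero>\<^bsub>DMC\<^esub> \<in> SC.D" using S.D_zero SC.D_zero by simp_all
      have "F \<zero>\<^bsub>DMC\<^esub> = \<zero>\<^bsub>DMC\<^esub>" using SC.E_zero_value[OF F] by simp
      also have "\<dots> = DS.frac N \<zero>\<^bsub>DM\<^esub> \<zero>\<^bsub>DM\<^esub>"
        unfolding DS_frac by (auto intro!: restrict_ext simp: frac_def nf_def \<iota>_zero)
      finally have "P N \<zero>\<^bsub>DM\<^esub>" unfolding P_def DS.\<iota>_zero using z(1) by blast
      then show ?case by simp
    next
      case (insert j J)
      then have j: "j \<in> I" by simp
      obtain h where h: "h \<in> carrier B" "m j = g j \<otimes>\<^bsub>B\<^esub> h"
        using PiE_mem[OF m j] by (auto simp: in_l_coset_iff)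
      have "(\<lambda>i\<in>I. if i \<in> insert j J then m i else \<zero>\<^bsub>B\<^esub>) =
         (\<lambda>i\<in>I. if i \<in> J then m i else \<zero>\<^bsub>B\<^esub>) \<oplus>\<^bsub>DM\<^esub> (\<lambda>i\<in>I. e j i \<otimes>\<^bsub>B\<^esub> h)"
        unfolding direct_sum_module_simps
        using insert.hyps h S.D_carrier[OF m] g_closed g_closed[OF j] by (intro restrict_ext) (simp add: e_def)
      then show ?case using P_add[OF insert.IH P_mult[OF Pe[OF j] h(1)]] insert.prems by (simp del: direct_sum_module_simps)
    qed
    from this[OF finite_I] have "P N (\<lambda>i\<in>I. if i \<in> I then m i else \<zero>\<^bsub>B\<^esub>)" by simp
    moreover have "(\<lambda>i\<in>I. if i \<in> I then m i else \<zero>\<^bsub>B\<^esub>) = m"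
      by (rule extensionalityI[of _ I]) (use m in \<open>simp_all add: PiE_iff\<close>)
    ultimately show ?thesis by simp
  qed
  then show ?thesis unfolding P_def by blast
qed

sublocale LE: laurent_scalars S.E SC.E lift
proof -
  interpret E: assoc_algebra S.E by (rule S.E_assoc_algebra)
  interpret EC: assoc_algebra SC.E by (rule SC.E_assoc_algebra)
  show "laurent_scalars S.E SC.E lift"
  proof (intro laurent_scalars.intro laurent_scalars_axioms.intro E.lin_module_axioms EC.lin_module_axioms)
    fix f h a assume f: "f \<in> carrier S.E"
    show "lift f \<in> carrier SC.E" by (rule lift[OF f])
    show "lift (a \<odot>\<^bsub>S.E\<^esub> f) = eval_sq a \<odot>\<^bsub>SC.E\<^esub> lift f"
    proof (rule lift_eqI[OF E.smult_closed[OF f] EC.smult_closed[OF lift(1)[OF f]]])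
      fix m assume m: "m \<in> S.D"
      show "(eval_sq a \<odot>\<^bsub>SC.E\<^esub> lift f) (\<iota>D m) = \<iota>D ((a \<odot>\<^bsub>S.E\<^esub> f) m)"
        using DS.\<iota>_smult[of "f m" a] S.E_closed[OF f m] m
        by (simp add: SC.E_ops S.E_ops \<iota>D_closed lift(2)[OF f])
    qed
    assume h: "h \<in> carrier S.E"
    show "lift (f \<oplus>\<^bsub>S.E\<^esub> h) = lift f \<oplus>\<^bsub>SC.E\<^esub> lift h"
    proof (rule lift_eqI[OF E.a_closed[OF f h] EC.a_closed[OF lift(1)[OF f] lift(1)[OF h]]])
      fix m assume m: "m \<in> S.D"
      show "(lift f \<oplus>\<^bsub>SC.E\<^esub> lift h) (\<iota>D m) = \<iota>D ((f \<oplus>\<^bsub>S.E\<^esub> h) m)"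
        using DS.\<iota>_add[of "f m" "h m"] S.E_closed[OF f m] S.E_closed[OF h m] m
        by (simp add: SC.E_ops S.E_ops \<iota>D_closed lift(2)[OF f] lift(2)[OF h])
    qed
  qed
qed

text \<open>With a uniform \<open>N\<close> the numerators of \<open>F (\<iota>D m)\<close> are
  functions of \<open>m\<close>, and uniqueness of normal forms makes them endomorphisms over
  \<open>B\<close>. Uniqueness for endomorphisms is pointwise uniqueness in the direct sum.\<close>

theorem laurent_algebra_extension_End: "laurent_algebra_extension S.E SC.E lift"
proof -
  interpret E: assoc_algebra S.E by (rule S.E_assoc_algebra)
  interpret EC: assoc_algebra SC.E by (rule SC.E_assoc_algebra)
  have at_\<iota>: "LE.frac N f f' (\<iota>D m) = DS.frac N (f m) (f' m)" if "f \<in> carrier S.E" "f' \<in> carrier S.E" "m \<in> S.D" for N f f' m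
    using that lift(2)[OF that(1,3)] lift(2)[OF that(2,3)] SC.D_add SC.D_smult \<iota>D_closed[OF that(3)]
    by (simp add: LE.frac_def LE.nf_def DS.frac_def DS.nf_def SC.E_ops)
  interpret X: laurent_extension S.E SC.E lift
  proof unfold_locales
    fix F assume F: "F \<in> carrier SC.E"
    obtain N where "\<forall>m\<in>S.D. \<exists>a\<in>S.D. \<exists>a'\<in>S.D. F (\<iota>D m) = DS.frac N a a'"
      using End_frac_uniform[OF F] by blast
    \<comment> \<open>These are chosen separately for each \<open>m\<close>, but for fixed
      \<open>N\<close> the numerators are unique, which gives the additivity and linearity
      below.\<close>
    then obtain p p' where p: "\<And>m. m \<in> S.D \<Longrightarrow> p m \<in> S.D" "\<And>m. m \<in> S.D \<Longrightarrow> p' m \<in> S.D"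
        "\<And>m. m \<in> S.D \<Longrightarrow> F (\<iota>D m) = DS.frac N (p m) (p' m)"
      by metis
    have add: "p (\<lambda>i\<in>I. x i \<oplus>\<^bsub>B\<^esub> y i) = (\<lambda>i\<in>I. p x i \<oplus>\<^bsub>B\<^esub> p y i)"
      "p' (\<lambda>i\<in>I. x i \<oplus>\<^bsub>B\<^esub> y i) = (\<lambda>i\<in>I. p' x i \<oplus>\<^bsub>B\<^esub> p' y i)" if "x \<in> S.D" "y \<in> S.D" for x y
    proof -
      have "DS.frac N (p (\<lambda>i\<in>I. x i \<oplus>\<^bsub>B\<^esub> y i)) (p' (\<lambda>i\<in>I. x i \<oplus>\<^bsub>B\<^esub> y i)) = F (\<iota>D x) \<oplus>\<^bsub>DMC\<^esub> F (\<iota>D y)"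
        using DS.\<iota>_add[of x y] that SC.E_add[OF F \<iota>D_closed[OF that(1)] \<iota>D_closed[OF that(2)]]
        by (simp add: S.D_add flip: p(3))
      also have "\<dots> = DS.frac N (\<lambda>i\<in>I. p x i \<oplus>\<^bsub>B\<^esub> p y i) (\<lambda>i\<in>I. p' x i \<oplus>\<^bsub>B\<^esub> p' y i)"
        using DS_frac_add[of "p x" "p' x" "p y" "p' y" N] that p by (simp del: direct_sum_module_simps(3)) simp
      finally have eq: "DS.frac N (p (\<lambda>i\<in>I. x i \<oplus>\<^bsub>B\<^esub> y i)) (p' (\<lambda>i\<in>I. x i \<oplus>\<^bsub>B\<^esub> y i)) =
        DS.frac N (\<lambda>i\<in>I. p x i \<oplus>\<^bsub>B\<^esub> p y i) (\<lambda>i\<in>I. p' x i \<oplus>\<^bsub>B\<^esub> p' y i)" .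
      note pD = p(1)[OF S.D_add[OF that]] p(2)[OF S.D_add[OF that]]
        S.D_add[OF p(1)[OF that(1)] p(1)[OF that(2)]] S.D_add[OF p(2)[OF that(1)] p(2)[OF that(2)]]
      show "p (\<lambda>i\<in>I. x i \<oplus>\<^bsub>B\<^esub> y i) = (\<lambda>i\<in>I. p x i \<oplus>\<^bsub>B\<^esub> p y i)"
        "p' (\<lambda>i\<in>I. x i \<oplus>\<^bsub>B\<^esub> y i) = (\<lambda>i\<in>I. p' x i \<oplus>\<^bsub>B\<^esub> p' y i)"
        by (rule DE_frac_inj[OF pD eq])+
    qed
    have mult: "p (\<lambda>i\<in>I. x i \<otimes>\<^bsub>B\<^esub> h) = (\<lambda>i\<in>I. p x i \<otimes>\<^bsub>B\<^esub> h)"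
      "p' (\<lambda>i\<in>I. x i \<otimes>\<^bsub>B\<^esub> h) = (\<lambda>i\<in>I. p' x i \<otimes>\<^bsub>B\<^esub> h)" if "x \<in> S.D" "h \<in> carrier B" for x h
    proof -
      have "\<iota>D (\<lambda>i\<in>I. x i \<otimes>\<^bsub>B\<^esub> h) = (\<lambda>i\<in>I. \<iota>D x i \<otimes>\<^bsub>C\<^esub> \<iota> h)"
        unfolding \<iota>D_def using that S.D_carrier by (intro restrict_ext) (simp add: \<iota>_mult)
      then have "DS.frac N (p (\<lambda>i\<in>I. x i \<otimes>\<^bsub>B\<^esub> h)) (p' (\<lambda>i\<in>I. x i \<otimes>\<^bsub>B\<^esub> h)) = (\<lambda>i\<in>I. F (\<iota>D x) i \<otimes>\<^bsub>C\<^esub> \<iota> h)"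
        using that SC.E_mult[OF F \<iota>D_closed[OF that(1)]] by (simp add: S.D_mult flip: p(3))
      also have "\<dots> = DS.frac N (\<lambda>i\<in>I. p x i \<otimes>\<^bsub>B\<^esub> h) (\<lambda>i\<in>I. p' x i \<otimes>\<^bsub>B\<^esub> h)"
        unfolding p(3)[OF that(1)] by (rule DS_frac_mult_\<iota>[OF p(1,2)[OF that(1)] that(2)])
      finally have eq: "DS.frac N (p (\<lambda>i\<in>I. x i \<otimes>\<^bsub>B\<^esub> h)) (p' (\<lambda>i\<in>I. x i \<otimes>\<^bsub>B\<^esub> h)) =
        DS.frac N (\<lambda>i\<in>I. p x i \<otimes>\<^bsub>B\<^esub> h) (\<lambda>i\<in>I. p' x i \<otimes>\<^bsub>B\<^esub> h)" .
      note pD = p(1)[OF S.D_mult[OF that]] p(2)[OF S.D_mult[OF that]]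
        S.D_mult[OF p(1)[OF that(1)] that(2)] S.D_mult[OF p(2)[OF that(1)] that(2)]
      show "p (\<lambda>i\<in>I. x i \<otimes>\<^bsub>B\<^esub> h) = (\<lambda>i\<in>I. p x i \<otimes>\<^bsub>B\<^esub> h)"
        "p' (\<lambda>i\<in>I. x i \<otimes>\<^bsub>B\<^esub> h) = (\<lambda>i\<in>I. p' x i \<otimes>\<^bsub>B\<^esub> h)"
        by (rule DE_frac_inj[OF pD eq])+
    qed
    define f f' where "f = (\<lambda>m\<in>S.D. p m)" and "f' = (\<lambda>m\<in>S.D. p' m)"
    have f: "f \<in> carrier S.E" "f' \<in> carrier S.E"
      unfolding f_def f'_def
      by (intro S.E_carrierI; simp add: p S.D_add S.D_mult add mult)+
    have "F = LE.frac N f f'"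
    proof (rule End_unique[OF F])
      show "LE.frac N f f' \<in> carrier SC.E" by (rule LE.frac_closed[OF f])
      show "F (\<iota>D m) = LE.frac N f f' (\<iota>D m)" if "m \<in> S.D" for m
        unfolding at_\<iota>[OF f that] using that p(3) by (simp add: f_def f'_def)
    qed
    then show "\<exists>N b b'. b \<in> carrier S.E \<and> b' \<in> carrier S.E \<and> F = LE.frac N b b'"
      using f by blast
  next
    fix f f' assume f: "f \<in> carrier S.E" "f' \<in> carrier S.E" "LE.nf f f' = \<zero>\<^bsub>SC.E\<^esub>"
    have z: "f m = \<zero>\<^bsub>DM\<^esub> \<and> f' m = \<zero>\<^bsub>DM\<^esub>" if m: "m \<in> S.D" for m
    proof (rule DE.unique)
      show "DS.nf (f m) (f' m) = \<zero>\<^bsub>DMC\<^esub>"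
        using at_\<iota>[OF f(1,2) m, of 0] f m S.E_closed[OF f(1) m] S.E_closed[OF f(2) m] \<iota>D_closed[OF m]
        by (simp add: LE.frac_0 DS.frac_0 SC.E_ops(3))
    qed (use S.E_closed f m in auto)
    then show "f = \<zero>\<^bsub>S.E\<^esub> \<and> f' = \<zero>\<^bsub>S.E\<^esub>"
      using f S.E_zero_closed by (intro conjI S.E_eqI) (simp_all add: S.E_ops)
  qed
  show ?thesis
  proof (intro laurent_algebra_extension.intro laurent_algebra_extension_axioms.intro X.laurent_extension_axioms
      E.assoc_algebra_axioms EC.assoc_algebra_axioms)
    fix f h assume f: "f \<in> carrier S.E" and h: "h \<in> carrier S.E"
    show "lift (f \<otimes>\<^bsub>S.E\<^esub> h) = lift f \<otimes>\<^bsub>SC.E\<^esub> lift h"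
    proof (rule lift_eqI[OF E.m_closed[OF f h] EC.m_closed[OF lift(1)[OF f] lift(1)[OF h]]])
      fix m assume m: "m \<in> S.D"
      show "(lift f \<otimes>\<^bsub>SC.E\<^esub> lift h) (\<iota>D m) = \<iota>D ((f \<otimes>\<^bsub>S.E\<^esub> h) m)"
        using S.E_closed[OF h m] m
        by (simp add: SC.E_ops S.E_ops compose_eq \<iota>D_closed lift(2)[OF f] lift(2)[OF h])
    qed
  next
    show "lift \<one>\<^bsub>S.E\<^esub> = \<one>\<^bsub>SC.E\<^esub>"
      by (rule lift_eqI[OF E.one_closed EC.one_closed]) (simp add: SC.E_ops S.E_ops S.E_closed \<iota>D_closed)
  qed
qed

end

section \<open>Separating functionals and the conclusion\<close>

lemma (in direct_sum) torsionless_E: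
  assumes "torsionless B" shows "torsionless E"
  unfolding torsionless_def
proof (intro ballI impI)
  fix f assume f: "f \<in> carrier E" "\<forall>\<xi>. linear_functional E \<xi> \<longrightarrow> \<xi> f = 0"
  show "f = \<zero>\<^bsub>E\<^esub>"
  proof (rule E_eqI[OF f(1) E_zero_closed])
    fix x i assume xi: "x \<in> D" "i \<in> I"
    have "\<xi> (f x i) = 0" if "linear_functional B \<xi>" for \<xi>
    proof -
      \<comment> \<open>Evaluate at \<open>x\<close>, take the component \<open>i\<close>, and apply
        a functional of \<open>B\<close>.\<close>
      have "linear_functional E (\<lambda>f. \<xi> (f x i))"
        using that xi by (simp add: linear_functional_def E_ops E_value)
      then show ?thesis using f(2) by blast
    qed
    then show "f x i = \<zero>\<^bsub>E\<^esub> x i"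
      using assms E_value[OF f(1) xi] xi by (simp add: torsionless_def E_ops)
  qed
qed

text \<open>Each coordinate of the action on the unit is a linear functional, and together they
  determine \<open>h\<close>.\<close>

lemma (in hecke_B) torsionless_HB: "torsionless H"
  unfolding torsionless_def
proof (intro ballI impI)
  fix h assume h: "h \<in> carrier H" "\<forall>\<xi>. linear_functional H \<xi> \<longrightarrow> \<xi> h = 0"
  have "linear_functional H (\<lambda>h. hecke_act unit_coord h w)" for w
    by (simp add: linear_functional_def hecke_act_add hecke_act_smult supported_unit_coord)
  then have "hecke_act unit_coord h w = 0" for w using h(2) by blast
  then show "h = \<zero>\<^bsub>H\<^esub>" using h(1) by (intro hecke_act_unit_coord_inj) auto
qed

lemma (in hecke_B) torsionless_HD: "torsionless (HD r)"
  unfolding torsionless_def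
proof (intro ballI impI)
  fix h assume h: "h \<in> K" "\<forall>\<xi>. linear_functional (HD r) \<xi> \<longrightarrow> \<xi> h = 0"
  have "linear_functional (HD r) \<xi>" if "linear_functional H \<xi>" for \<xi>
    using that by (simp add: linear_functional_def K_carrier)
  then show "h = \<zero>\<^bsub>HD r\<^esub>" using torsionless_HB h by (auto simp: torsionless_def)
qed

text \<open>The last clause makes precise in what sense \<open>\<psi>\<close> extends
  \<open>\<phi>\<close>. It is available because \<open>\<psi>\<close> is built from
  \<open>\<phi>\<close> along the inclusions of the algebras over \<int>[q], and on the side of type
  D this inclusion is \<open>lift\<close>.\<close>

theorem proposition4p2:
  fixes n r :: nat
  assumes "n \<ge> 1" and "r \<ge> 4"
  shows "\<exists>\<phi> \<psi>.
    \<phi> \<in> algebra_iso (S_kappa n r) (S_D n r) \<and>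
    \<psi> \<in> algebra_iso (S_kappa_upsilon n r) (S_D_upsilon n r) \<and>
    (\<forall>s \<in> carrier (S_kappa n r). \<forall>x \<in> Pi\<^sub>E (LamD n r) (D_module n r).
       \<psi> (pure_tensor (S_kappa n r) laurent_algebra s 1)
           (\<lambda>\<alpha>\<in>LamD n r. HD_to_upsilon r (x \<alpha>)) =
         (\<lambda>\<alpha>\<in>LamD n r. HD_to_upsilon r (\<phi> s x \<alpha>)))"
proof -
  interpret hecke_modules r n
    by unfold_locales (use assms in auto)
  let ?C = "HD_upsilon r"
  \<comment> \<open>The base change of \<open>H\<^sub>D\<close> itself, over which the endomorphisms
    in \<open>S_D_upsilon\<close> are taken.\<close>
  have extD: "laurent_algebra_extension (HD r) ?C (HD_to_upsilon r)"
    unfolding HD_upsilon_def by (rule base_change_laurent[OF HD.assoc_algebra_axioms torsionless_HD])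
  interpret L: laurent_End "HD r" ?C "HD_to_upsilon r" "LamD n r" "xD n r"
    by (intro laurent_End.intro laurent_End_axioms.intro extD finite_LamD xD_in_K)
  have M: "L.M = D_module n r" by (rule ext) (simp add: D_module_def)
  have E: "L.S.E = S_D n r" unfolding S_D_def M ..
  have EC: "L.SC.E = S_D_upsilon n r" unfolding S_D_upsilon_def ..
  \<comment> \<open>On the other side the tensor product is taken after forming endomorphisms;
    uniqueness comes from the functionals on \<open>H\<close>.\<close>
  have extK: "laurent_algebra_extension (S_kappa n r) (S_kappa_upsilon n r)
      (\<lambda>s. pure_tensor (S_kappa n r) laurent_algebra s 1)"
    unfolding S_kappa_upsilon_def S_kappa_eq
    by (rule base_change_laurent[OF kappa.E_assoc_algebra kappa.torsionless_E[OF torsionless_HB]])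
  let ?\<phi> = equivalence.conj_iso
  obtain \<psi> where \<psi>: "\<psi> \<in> algebra_iso (S_kappa_upsilon n r) (S_D_upsilon n r)"
    "\<And>s. s \<in> carrier (S_kappa n r) \<Longrightarrow> \<psi> (pure_tensor (S_kappa n r) laurent_algebra s 1) = L.lift (?\<phi> s)"
    using laurent_algebra_extension_iso[OF extK L.laurent_algebra_extension_End[unfolded E EC] conj_iso_S] by blast
  have "\<psi> (pure_tensor (S_kappa n r) laurent_algebra s 1) (\<lambda>\<alpha>\<in>LamD n r. HD_to_upsilon r (x \<alpha>)) =
      (\<lambda>\<alpha>\<in>LamD n r. HD_to_upsilon r (?\<phi> s x \<alpha>))"
    if s: "s \<in> carrier (S_kappa n r)" and x: "x \<in> Pi\<^sub>E (LamD n r) (D_module n r)" for s x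
  proof -
    have "?\<phi> s \<in> carrier L.S.E"
      using equivalence.conj_iso_closed s unfolding E S_kappa_eq S_D_eq by blast
    from L.lift(2)[OF this, of x] show ?thesis
      unfolding \<psi>(2)[OF s] L.\<iota>D_def M using x by blast
  qed
  then show ?thesis using conj_iso_S \<psi>(1) by blast
qed

end
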